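(* Let $V$ be a valuation ring with non-zero maximal ideal $\mathfrak m$ and residue field $\kappa$. Let $M$ be a $V$-module. (1) If $\mathfrak m$ is principal, then $R^i\Gamma_{\mathfrak m}(M) = 0$ for all $i \geq 2$, and $R^1\Gamma_{\mathfrak m}(M)$ is (isomorphic to) the cokernel of the natural localization map $M \rightarrow M_f$, where $f$ is a generator of $\mathfrak m$. (2) If $\mathfrak m$ is not principal, then $R^i\Gamma_{\mathfrak m}(M) \cong \operatorname{Ext}^i_V(\kappa, M)$ for all $i \geq 0$. In particular, $\Gamma_{\mathfrak m}(M) = \{x \in M : \mathfrak{m}x = 0\}$, i.e., $\Gamma_{\mathfrak m}(M)$ is the socle of $M$.
   Context: Rings are commutative with identity. Valuation rings are not assumed Noetherian. $\mathbb N$ denotes the positive integers. For a ring $A$ and an ideal $I \subset A$, the $I$-torsion functor $\Gamma_I$ on $A$-modules is $\Gamma_I(M) = \{m \in M : \exists\, n \in \mathbb N \text{ such that } I^n m = 0\}$. It is left exact, and its right derived functors are denoted $R^i\Gamma_I$, $i \ge 0$ (the $I$-torsion cohomology functors). *)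

theory Defs
  imports
    "HOL-Algebra.Module"
    "HOL-Algebra.Divisibility"
    "HOL-Algebra.QuotRing"
    "HOL-Algebra.Ideal_Product"
begin

section \<open>Valuation rings\<close>

text \<open>
  The condition says that every element \<open>a / b\<close> of the fraction field, or its inverse
  \<open>b / a\<close>, lies in \<open>V\<close>. Fields are included.
\<close>

definition valuation_ring :: "('a, 'r) ring_scheme \<Rightarrow> bool" where
  "valuation_ring V \<longleftrightarrow>
     domain V \<and>
     (\<forall>a\<in>carrier V. \<forall>b\<in>carrier V. a divides\<^bsub>V\<^esub> b \<or> b divides\<^bsub>V\<^esub> a)"


section \<open>Modules and their homomorphisms\<close>

text \<open>
  Module records inherit the fields \<open>mult\<close> and \<open>one\<close> from rings; the locale \<open>module\<close> does not
  constrain them, and they are left \<open>undefined\<close> in the constructions below.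
\<close>

definition mod_hom ::
    "('a, 'r) ring_scheme \<Rightarrow> ('a, 'b, 'm) module_scheme \<Rightarrow> ('a, 'c, 'n) module_scheme
      \<Rightarrow> ('b \<Rightarrow> 'c) set" where
  "mod_hom R M N =
     {h \<in> carrier M \<rightarrow> carrier N.
       (\<forall>x\<in>carrier M. \<forall>y\<in>carrier M. h (x \<oplus>\<^bsub>M\<^esub> y) = h x \<oplus>\<^bsub>N\<^esub> h y) \<and>
       (\<forall>a\<in>carrier R. \<forall>x\<in>carrier M. h (a \<odot>\<^bsub>M\<^esub> x) = a \<odot>\<^bsub>N\<^esub> h x)}"

definition mod_isomorphic ::
    "('a, 'r) ring_scheme \<Rightarrow> ('a, 'b, 'm) module_scheme \<Rightarrow> ('a, 'c, 'n) module_scheme \<Rightarrow> bool" where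
  "mod_isomorphic R M N \<longleftrightarrow> (\<exists>h\<in>mod_hom R M N. bij_betw h (carrier M) (carrier N))"

definition zero_module :: "('a, 'b, 'm) module_scheme \<Rightarrow> bool" where
  "zero_module M \<longleftrightarrow> carrier M = {\<zero>\<^bsub>M\<^esub>}"

definition quotient_module :: "('a, 'b, 'm) module_scheme \<Rightarrow> 'b set \<Rightarrow> ('a, 'b set) module" where
  "quotient_module M N =
     \<lparr>carrier = a_rcosets\<^bsub>M\<^esub> N, monoid.mult = undefined, one = undefined,
      zero = N, add = set_add M,
      smult = (\<lambda>a X. \<Union>x\<in>X. N +>\<^bsub>M\<^esub> (a \<odot>\<^bsub>M\<^esub> x))\<rparr>"

text \<open>\<open>R / I\<close>, with \<open>R\<close> acting through the projection \<open>R \<rightarrow> R / I\<close>.\<close>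

definition residue_module :: "('a, 'r) ring_scheme \<Rightarrow> 'a set \<Rightarrow> ('a, 'a set) module" where
  "residue_module R I =
     \<lparr>carrier = carrier (R Quot I), monoid.mult = monoid.mult (R Quot I), one = one (R Quot I),
      zero = zero (R Quot I), add = add (R Quot I),
      smult = (\<lambda>a X. (I +>\<^bsub>R\<^esub> a) \<otimes>\<^bsub>R Quot I\<^esub> X)\<rparr>"

text \<open>
  Homomorphisms are taken extensional (\<open>undefined\<close> off the carrier of \<open>M\<close>), so that equal
  homomorphisms are equal as HOL functions.
\<close>

definition Hom_module ::
    "('a, 'r) ring_scheme \<Rightarrow> ('a, 'b, 'm) module_scheme \<Rightarrow> ('a, 'c, 'n) module_scheme
      \<Rightarrow> ('a, 'b \<Rightarrow> 'c) module" where
  "Hom_module R M N =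
     \<lparr>carrier = mod_hom R M N \<inter> extensional (carrier M), monoid.mult = undefined, one = undefined,
      zero = (\<lambda>x\<in>carrier M. \<zero>\<^bsub>N\<^esub>),
      add = (\<lambda>g h. \<lambda>x\<in>carrier M. g x \<oplus>\<^bsub>N\<^esub> h x),
      smult = (\<lambda>a h. \<lambda>x\<in>carrier M. a \<odot>\<^bsub>N\<^esub> h x)\<rparr>"

definition simple_submodule ::
    "('a, 'r) ring_scheme \<Rightarrow> ('a, 'b, 'm) module_scheme \<Rightarrow> 'b set \<Rightarrow> bool" where
  "simple_submodule R M S \<longleftrightarrow>
     submodule S R M \<and> S \<noteq> {\<zero>\<^bsub>M\<^esub>} \<and>
     (\<forall>T. submodule T R M \<and> T \<subseteq> S \<longrightarrow> T = {\<zero>\<^bsub>M\<^esub>} \<or> T = S)"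

text \<open>The sum of all simple submodules.\<close>

definition socle :: "('a, 'r) ring_scheme \<Rightarrow> ('a, 'b, 'm) module_scheme \<Rightarrow> 'b set" where
  "socle R M = \<Inter>{N. submodule N R M \<and> (\<forall>S. simple_submodule R M S \<longrightarrow> S \<subseteq> N)}"


section \<open>Localization of a module\<close>

definition loc_rel ::
    "('a, 'b, 'm) module_scheme \<Rightarrow> 'a set \<Rightarrow> (('b \<times> 'a) \<times> ('b \<times> 'a)) set" where
  "loc_rel M S =
     {((x, s), (y, t)). x \<in> carrier M \<and> s \<in> S \<and> y \<in> carrier M \<and> t \<in> S \<and>
       (\<exists>u\<in>S. u \<odot>\<^bsub>M\<^esub> (t \<odot>\<^bsub>M\<^esub> x) = u \<odot>\<^bsub>M\<^esub> (s \<odot>\<^bsub>M\<^esub> y))}"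

definition loc_frac :: "('a, 'b, 'm) module_scheme \<Rightarrow> 'a set \<Rightarrow> 'b \<Rightarrow> 'a \<Rightarrow> ('b \<times> 'a) set" where
  "loc_frac M S x s = loc_rel M S `` {(x, s)}"

text \<open>\<open>S\<^sup>-\<^sup>1 M\<close> as an \<open>R\<close>-module, for a multiplicative set \<open>S\<close> of \<open>R\<close>.\<close>

definition localization_module ::
    "('a, 'r) ring_scheme \<Rightarrow> 'a set \<Rightarrow> ('a, 'b, 'm) module_scheme \<Rightarrow> ('a, ('b \<times> 'a) set) module" where
  "localization_module R S M =
     \<lparr>carrier = (carrier M \<times> S) // loc_rel M S, monoid.mult = undefined, one = undefined,
      zero = loc_frac M S \<zero>\<^bsub>M\<^esub> \<one>\<^bsub>R\<^esub>,
      add = (\<lambda>X Y. \<Union>(x, s)\<in>X. \<Union>(y, t)\<in>Y.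
               loc_frac M S ((t \<odot>\<^bsub>M\<^esub> x) \<oplus>\<^bsub>M\<^esub> (s \<odot>\<^bsub>M\<^esub> y)) (s \<otimes>\<^bsub>R\<^esub> t)),
      smult = (\<lambda>a X. \<Union>(x, s)\<in>X. loc_frac M S (a \<odot>\<^bsub>M\<^esub> x) s)\<rparr>"

definition powers_of :: "('a, 'r) ring_scheme \<Rightarrow> 'a \<Rightarrow> 'a set" where
  "powers_of R f = range (\<lambda>n::nat. f [^]\<^bsub>R\<^esub> n)"

definition localization_away ::
    "('a, 'r) ring_scheme \<Rightarrow> 'a \<Rightarrow> ('a, 'b, 'm) module_scheme \<Rightarrow> ('a, ('b \<times> 'a) set) module" where
  "localization_away R f M = localization_module R (powers_of R f) M"

definition localization_away_map ::
    "('a, 'r) ring_scheme \<Rightarrow> 'a \<Rightarrow> ('a, 'b, 'm) module_scheme \<Rightarrow> 'b \<Rightarrow> ('b \<times> 'a) set" where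
  "localization_away_map R f M x = loc_frac M (powers_of R f) x \<one>\<^bsub>R\<^esub>"

definition cokernel ::
    "('a, 'b, 'm) module_scheme \<Rightarrow> ('a, 'c, 'n) module_scheme \<Rightarrow> ('b \<Rightarrow> 'c) \<Rightarrow> ('a, 'c set) module" where
  "cokernel M N h = quotient_module N (h ` carrier M)"


section \<open>Injective resolutions and cohomology\<close>

text \<open>
  A HOL definition cannot quantify over modules of all types; the test modules \<open>A\<close>, \<open>B\<close> range
  over all \<open>R\<close>-modules whose elements are drawn from the type of elements of \<open>R\<close>. These include
  \<open>R\<close> and its ideals, so by Baer's criterion the extension property then holds for test modules
  of every type.
\<close>

definition injective_module ::
    "('a, 'r) ring_scheme \<Rightarrow> ('a, 'c, 'm) module_scheme \<Rightarrow> bool" where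
  "injective_module R E \<longleftrightarrow>
     module R E \<and>
     (\<forall>(A :: ('a, 'a) module) (B :: ('a, 'a) module) j g.
        module R A \<and> module R B \<and>
        j \<in> mod_hom R A B \<and> inj_on j (carrier A) \<and> g \<in> mod_hom R A E \<longrightarrow>
        (\<exists>h\<in>mod_hom R B E. \<forall>x\<in>carrier A. h (j x) = g x))"

text \<open>\<open>0 \<rightarrow> M \<rightarrow> E 0 \<rightarrow> E 1 \<rightarrow> \<dots>\<close> is exact, with augmentation \<open>e\<close> and differentials \<open>d\<close>.\<close>

definition injective_resolution ::
    "('a, 'r) ring_scheme \<Rightarrow> ('a, 'b, 'm) module_scheme \<Rightarrow> ('b \<Rightarrow> 'c)
      \<Rightarrow> (nat \<Rightarrow> ('a, 'c) module) \<Rightarrow> (nat \<Rightarrow> 'c \<Rightarrow> 'c) \<Rightarrow> bool" where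
  "injective_resolution R M e E d \<longleftrightarrow>
     module R M \<and>
     (\<forall>i. injective_module R (E i)) \<and>
     e \<in> mod_hom R M (E 0) \<and>
     (\<forall>i. d i \<in> mod_hom R (E i) (E (Suc i))) \<and>
     inj_on e (carrier M) \<and>
     e ` carrier M = {x \<in> carrier (E 0). d 0 x = \<zero>\<^bsub>E 1\<^esub>} \<and>
     (\<forall>i. d i ` carrier (E i) =
            {x \<in> carrier (E (Suc i)). d (Suc i) x = \<zero>\<^bsub>E (Suc (Suc i))\<^esub>})"

definition cocycles ::
    "(nat \<Rightarrow> ('a, 'c) module) \<Rightarrow> (nat \<Rightarrow> 'c \<Rightarrow> 'c) \<Rightarrow> nat \<Rightarrow> 'c set" where
  "cocycles C d i = {x \<in> carrier (C i). d i x = \<zero>\<^bsub>C (Suc i)\<^esub>}"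

definition coboundaries ::
    "(nat \<Rightarrow> ('a, 'c) module) \<Rightarrow> (nat \<Rightarrow> 'c \<Rightarrow> 'c) \<Rightarrow> nat \<Rightarrow> 'c set" where
  "coboundaries C d i = (case i of 0 \<Rightarrow> {\<zero>\<^bsub>C 0\<^esub>} | Suc j \<Rightarrow> d j ` carrier (C j))"

definition cohomology ::
    "(nat \<Rightarrow> ('a, 'c) module) \<Rightarrow> (nat \<Rightarrow> 'c \<Rightarrow> 'c) \<Rightarrow> nat \<Rightarrow> ('a, 'c set) module" where
  "cohomology C d i =
     quotient_module ((C i)\<lparr>carrier := cocycles C d i\<rparr>) (coboundaries C d i)"


section \<open>Torsion cohomology and Ext\<close>

definition torsion ::
    "('a, 'r) ring_scheme \<Rightarrow> 'a set \<Rightarrow> ('a, 'b, 'm) module_scheme \<Rightarrow> 'b set" where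
  "torsion R I M =
     {x \<in> carrier M. \<exists>n::nat. n \<ge> 1 \<and> (\<forall>a \<in> I [^]\<^bsub>ideals_set R\<^esub> n. a \<odot>\<^bsub>M\<^esub> x = \<zero>\<^bsub>M\<^esub>)}"

definition torsion_module ::
    "('a, 'r) ring_scheme \<Rightarrow> 'a set \<Rightarrow> ('a, 'b) module \<Rightarrow> ('a, 'b) module" where
  "torsion_module R I M = M\<lparr>carrier := torsion R I M\<rparr>"

text \<open>
  Right derived functors are computed from an injective resolution \<open>(E, d)\<close> of the module, which
  is an explicit argument: \<open>torsion_cohomology R I E d i\<close> is the \<open>i\<close>-th cohomology of the complex
  \<open>\<Gamma>\<^sub>I(E)\<close>, and \<open>Ext_module R A E d i\<close> that of the complex \<open>Hom(A, E)\<close>. On homomorphisms,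
  \<open>\<Gamma>\<^sub>I\<close> is restriction, so the differentials of \<open>\<Gamma>\<^sub>I(E)\<close> are given by the same functions \<open>d i\<close>.
\<close>

definition torsion_cohomology ::
    "('a, 'r) ring_scheme \<Rightarrow> 'a set \<Rightarrow> (nat \<Rightarrow> ('a, 'c) module) \<Rightarrow> (nat \<Rightarrow> 'c \<Rightarrow> 'c)
      \<Rightarrow> nat \<Rightarrow> ('a, 'c set) module" where
  "torsion_cohomology R I E d i = cohomology (\<lambda>j. torsion_module R I (E j)) d i"

definition Ext_module ::
    "('a, 'r) ring_scheme \<Rightarrow> ('a, 'b, 'm) module_scheme \<Rightarrow> (nat \<Rightarrow> ('a, 'c) module)
      \<Rightarrow> (nat \<Rightarrow> 'c \<Rightarrow> 'c) \<Rightarrow> nat \<Rightarrow> ('a, ('b \<Rightarrow> 'c) set) module" where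
  "Ext_module R A E d i =
     cohomology (\<lambda>j. Hom_module R A (E j)) (\<lambda>j. compose (carrier A) (d j)) i"

end

theory Submission
  imports Defs
begin

text \<open>
  Let \<open>\<mm> = (f)\<close>. An injective module \<open>E\<close> is divisible by the nonzerodivisor \<open>f\<close>, so an
  \<open>f\<close>-power torsion cocycle \<open>x = d y\<close> can be corrected: \<open>f\<^sup>n y\<close> is a cocycle; in degrees \<open>\<ge> 2\<close>
  it is \<open>d (f\<^sup>n w)\<close> for some \<open>w\<close>, and \<open>y - d w\<close> is torsion with the same boundary \<open>x\<close>; in degree
  \<open>1\<close> it is an element \<open>z\<close> of \<open>M\<close>, and \<open>x \<mapsto> z / f\<^sup>n\<close> identifies the cohomology with the cokernel
  of \<open>M \<rightarrow> M\<^sub>f\<close>.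

  If \<open>\<mm>\<close> is not principal, then \<open>\<mm>\<^sup>2 = \<mm>\<close>: for \<open>x \<in> \<mm>\<close> and \<open>y \<in> \<mm> - (x)\<close> we have \<open>x = y z\<close> with
  \<open>z \<in> \<mm>\<close>. Hence \<open>\<mm>\<close>-torsion is the part killed by \<open>\<mm>\<close>, that is, \<open>Hom(\<kappa>, -)\<close>, and the two
  cohomologies agree once injective resolutions are compared up to homotopy.
\<close>

section \<open>Modules and quotients\<close>

text \<open>Neither isomorphism is built as a function on cosets. Sending a class to
  \<open>z / f^n\<close> depends on choices of \<open>y\<close>, \<open>z\<close> and
  \<open>n\<close>, and the comparison with Ext relates cosets of elements to cosets of functions.
  Both are given as relations that contain all choices at once, so that well-definedness turns into
  a computation of the two fibres over zero. Degree 1 is exceptional in the principal case because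
  the preimage of \<open>f^n y\<close> then lies in \<open>M\<close>, which need not be divisible;
  from degree 2 on it lies in an injective module. \<open>injective_module\<close> tests only
  modules over the element type of the ring, whereas the maps to be extended start from terms of
  resolutions over other types. Extensions therefore pass through Baer's criterion, in this form: a
  map into an injective module that vanishes on the kernel of \<open>d\<close> factors through
  \<open>d\<close>. Divisibility, chain maps and homotopies are all instances of it. A homotopy on
  the full resolution is linear, so it restricts to the elements killed by \<mm>; this is what
  carries the comparison over to the subcomplex.\<close>

lemma mod_hom_closed: "h \<in> mod_hom R M N \<Longrightarrow> x \<in> carrier M \<Longrightarrow> h x \<in> carrier N"
  by (auto simp: mod_hom_def)

lemma mod_hom_add:
  "h \<in> mod_hom R M N \<Longrightarrow> x \<in> carrier M \<Longrightarrow> y \<in> carrier M \<Longrightarrow> h (x \<oplus>\<^bsub>M\<^esub> y) = h x \<oplus>\<^bsub>N\<^esub> h y"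
  by (simp add: mod_hom_def)

lemma mod_hom_smult:
  "h \<in> mod_hom R M N \<Longrightarrow> a \<in> carrier R \<Longrightarrow> x \<in> carrier M \<Longrightarrow> h (a \<odot>\<^bsub>M\<^esub> x) = a \<odot>\<^bsub>N\<^esub> h x"
  by (simp add: mod_hom_def)

lemma mod_homI:
  assumes "\<And>x. x \<in> carrier M \<Longrightarrow> h x \<in> carrier N"
    and "\<And>x y. x \<in> carrier M \<Longrightarrow> y \<in> carrier M \<Longrightarrow> h (x \<oplus>\<^bsub>M\<^esub> y) = h x \<oplus>\<^bsub>N\<^esub> h y"
    and "\<And>a x. a \<in> carrier R \<Longrightarrow> x \<in> carrier M \<Longrightarrow> h (a \<odot>\<^bsub>M\<^esub> x) = a \<odot>\<^bsub>N\<^esub> h x"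
  shows "h \<in> mod_hom R M N"
  using assms by (auto simp: mod_hom_def)

lemma mod_hom_zero:
  assumes "module R M" "module R N" "h \<in> mod_hom R M N"
  shows "h \<zero>\<^bsub>M\<^esub> = \<zero>\<^bsub>N\<^esub>"
proof -
  interpret M: module R M by fact
  interpret N: module R N by fact
  have "h \<zero>\<^bsub>M\<^esub> = h (\<zero>\<^bsub>R\<^esub> \<odot>\<^bsub>M\<^esub> \<zero>\<^bsub>M\<^esub>)" by simp
  also have "\<dots> = \<zero>\<^bsub>R\<^esub> \<odot>\<^bsub>N\<^esub> h \<zero>\<^bsub>M\<^esub>" by (rule mod_hom_smult[OF assms(3)]) auto
  also have "\<dots> = \<zero>\<^bsub>N\<^esub>" by (simp add: mod_hom_closed[OF assms(3)])
  finally show ?thesis .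
qed

text \<open>Makes negation a scalar action: whatever is closed under \<open>smult\<close>
  (submodules, relations between modules, graphs) is then closed under negation.\<close>

lemma (in module) uminus_eq_smult: "x \<in> carrier M \<Longrightarrow> \<ominus>\<^bsub>M\<^esub> x = (\<ominus> \<one>) \<odot>\<^bsub>M\<^esub> x"
  by (simp add: smult_l_minus)

lemma mod_hom_uminus:
  assumes "module R M" "module R N" "h \<in> mod_hom R M N" "x \<in> carrier M"
  shows "h (\<ominus>\<^bsub>M\<^esub> x) = \<ominus>\<^bsub>N\<^esub> h x"
proof -
  interpret M: module R M by fact
  interpret N: module R N by fact
  show ?thesis
    using assms(4) by (simp add: M.uminus_eq_smult N.uminus_eq_smult mod_hom_smult[OF assms(3)]
        mod_hom_closed[OF assms(3)])
qed

lemma mod_hom_minus: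
  assumes "module R M" "module R N" "h \<in> mod_hom R M N" "x \<in> carrier M" "y \<in> carrier M"
  shows "h (x \<ominus>\<^bsub>M\<^esub> y) = h x \<ominus>\<^bsub>N\<^esub> h y"
proof -
  interpret M: module R M by fact
  show ?thesis
    using assms by (simp add: a_minus_def mod_hom_add[OF assms(3)] mod_hom_uminus)
qed

lemma mod_hom_comp:
  "g \<in> mod_hom R M N \<Longrightarrow> h \<in> mod_hom R N P \<Longrightarrow> (\<lambda>x. h (g x)) \<in> mod_hom R M P"
  by (rule mod_homI) (auto simp: mod_hom_closed mod_hom_add mod_hom_smult)

lemma mod_hom_diff:
  assumes "module R N" "g \<in> mod_hom R M N" "h \<in> mod_hom R M N"
  shows "(\<lambda>x. g x \<ominus>\<^bsub>N\<^esub> h x) \<in> mod_hom R M N"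
proof -
  interpret N: module R N by fact
  show ?thesis
  proof (rule mod_homI)
    fix x y assume "x \<in> carrier M" "y \<in> carrier M"
    note cl = this[THEN mod_hom_closed[OF assms(2)]] this[THEN mod_hom_closed[OF assms(3)]]
    show "g (x \<oplus>\<^bsub>M\<^esub> y) \<ominus>\<^bsub>N\<^esub> h (x \<oplus>\<^bsub>M\<^esub> y) = g x \<ominus>\<^bsub>N\<^esub> h x \<oplus>\<^bsub>N\<^esub> (g y \<ominus>\<^bsub>N\<^esub> h y)"
      using cl by (simp add: mod_hom_add[OF assms(2)] mod_hom_add[OF assms(3)]
          \<open>x \<in> carrier M\<close> \<open>y \<in> carrier M\<close> a_minus_def N.minus_add N.a_ac)
  next
    fix a x assume "a \<in> carrier R" "x \<in> carrier M"
    then show "g (a \<odot>\<^bsub>M\<^esub> x) \<ominus>\<^bsub>N\<^esub> h (a \<odot>\<^bsub>M\<^esub> x) = a \<odot>\<^bsub>N\<^esub> (g x \<ominus>\<^bsub>N\<^esub> h x)"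
      by (simp add: mod_hom_smult[OF assms(2)] mod_hom_smult[OF assms(3)] a_minus_def
          N.smult_r_distr N.smult_r_minus mod_hom_closed[OF assms(2)] mod_hom_closed[OF assms(3)])
  qed (auto simp: mod_hom_closed[OF assms(2)] mod_hom_closed[OF assms(3)])
qed

section \<open>Differences, submodules, kernels and images\<close>

lemma (in abelian_group) minus_of_zero: "\<ominus> \<zero> = \<zero>"
  by (rule minus_equality) auto

lemma (in abelian_group) minus_eq_zero_iff:
  "x \<in> carrier G \<Longrightarrow> y \<in> carrier G \<Longrightarrow> x \<ominus> y = \<zero> \<longleftrightarrow> x = y"
  by (metis a_minus_def add.inv_closed minus_equality minus_minus r_neg)

lemma (in module) submoduleI':
  assumes "H \<subseteq> carrier M" "\<zero>\<^bsub>M\<^esub> \<in> H"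
    and "\<And>a b. \<lbrakk>a \<in> H; b \<in> H\<rbrakk> \<Longrightarrow> a \<oplus>\<^bsub>M\<^esub> b \<in> H"
    and "\<And>a x. \<lbrakk>a \<in> carrier R; x \<in> H\<rbrakk> \<Longrightarrow> a \<odot>\<^bsub>M\<^esub> x \<in> H"
  shows "submodule H R M"
  using assms by (intro submoduleI) (auto simp: uminus_eq_smult subset_iff)

lemma (in module) submodule_zero: "submodule H R M \<Longrightarrow> \<zero>\<^bsub>M\<^esub> \<in> H"
  by (metis subgroup.one_closed monoid.simps(2) submodule.axioms(1))

lemma (in module) submodule_minus:
  "submodule H R M \<Longrightarrow> x \<in> H \<Longrightarrow> y \<in> H \<Longrightarrow> x \<ominus>\<^bsub>M\<^esub> y \<in> H"
  by (simp add: a_minus_def submoduleE)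

lemma (in module) submodule_abelian_subgroup: "submodule H R M \<Longrightarrow> abelian_subgroup H M"
  by (intro abelian_subgroupI3 additive_subgroupI submodule.axioms(1) M.abelian_group_axioms)

lemma (in module) submodule_Int:
  assumes "submodule H R M" "submodule K R M"
  shows "submodule (H \<inter> K) R M"
proof (rule submoduleI')
  show "H \<inter> K \<subseteq> carrier M" using submoduleE(1)[OF assms(1)] by blast
  show "\<zero>\<^bsub>M\<^esub> \<in> H \<inter> K" using submodule_zero assms by blast
qed (auto intro: submoduleE(4,5)[OF assms(1)] submoduleE(4,5)[OF assms(2)])

lemma (in module) submodule_kernel:
  assumes "module R N" "h \<in> mod_hom R M N"
  shows "submodule {x \<in> carrier M. h x = \<zero>\<^bsub>N\<^esub>} R M"
proof -
  interpret N: module R N by fact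
  show ?thesis
    by (rule submoduleI')
      (auto simp: mod_hom_add[OF assms(2)] mod_hom_smult[OF assms(2)]
        mod_hom_zero[OF module_axioms assms])
qed

lemma mod_hom_image_submodule:
  assumes M: "module R M" and N: "module R N" "h \<in> mod_hom R M N"
    and H: "submodule H R M"
  shows "submodule (h ` H) R N"
proof -
  interpret M: module R M by fact
  interpret N: module R N by fact
  have sub: "x \<in> H \<Longrightarrow> x \<in> carrier M" for x using M.submoduleE(1)[OF H] by auto
  show ?thesis
  proof (rule N.submoduleI')
    show "h ` H \<subseteq> carrier N" using sub mod_hom_closed[OF N(2)] by auto
    show "\<zero>\<^bsub>N\<^esub> \<in> h ` H"
      using M.submodule_zero[OF H] mod_hom_zero[OF M N] by (metis image_eqI)
    show "a \<oplus>\<^bsub>N\<^esub> b \<in> h ` H" if "a \<in> h ` H" "b \<in> h ` H" for a b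
      using that by (auto simp flip: mod_hom_add[OF N(2)] intro!: M.submoduleE(5)[OF H] simp: sub)
    show "a \<odot>\<^bsub>N\<^esub> x \<in> h ` H" if "a \<in> carrier R" "x \<in> h ` H" for a x
      using that by (auto simp flip: mod_hom_smult[OF N(2)] intro!: M.submoduleE(4)[OF H] simp: sub)
  qed
qed

text \<open>Scalar multiplication in \<open>quotient_module\<close> is a union over all
  representatives. Two representatives differ by an element of \<open>H\<close>, and
  \<open>H\<close> is stable under \<open>a\<close>, so all cosets in the union coincide.\<close>

lemma (in module) coset_smult:
  assumes H: "submodule H R M" and "a \<in> carrier R" "x \<in> carrier M"
  shows "(\<Union>y\<in>H +>\<^bsub>M\<^esub> x. H +>\<^bsub>M\<^esub> (a \<odot>\<^bsub>M\<^esub> y)) = H +>\<^bsub>M\<^esub> (a \<odot>\<^bsub>M\<^esub> x)"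
proof -
  interpret H: abelian_subgroup H M by (rule submodule_abelian_subgroup[OF H])
  have "H +>\<^bsub>M\<^esub> (a \<odot>\<^bsub>M\<^esub> y) = H +>\<^bsub>M\<^esub> (a \<odot>\<^bsub>M\<^esub> x)" if y: "y \<in> H +>\<^bsub>M\<^esub> x" for y
  proof -
    obtain z where z: "z \<in> H" "y = z \<oplus>\<^bsub>M\<^esub> x" using y by (auto simp: a_r_coset_def')
    have "a \<odot>\<^bsub>M\<^esub> y = a \<odot>\<^bsub>M\<^esub> z \<oplus>\<^bsub>M\<^esub> a \<odot>\<^bsub>M\<^esub> x"
      using z assms by (simp add: smult_r_distr)
    then have "a \<odot>\<^bsub>M\<^esub> y \<in> H +>\<^bsub>M\<^esub> (a \<odot>\<^bsub>M\<^esub> x)"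
      using z assms(2) submoduleE(4)[OF H] by (auto simp: a_r_coset_def')
    then show ?thesis using H.a_repr_independence' assms by auto
  qed
  moreover have "x \<in> H +>\<^bsub>M\<^esub> x" using assms by (simp add: H.a_rcos_self)
  ultimately show ?thesis by blast
qed

text \<open>
  The graph version of the first isomorphism theorem: \<open>P\<close> is a submodule of \<open>A \<times> B\<close> that projects
  onto both factors.
\<close>

lemma quotient_iso_of_relation:
  assumes A: "module R A" and B: "module R B"
    and Pc: "\<And>a b. P a b \<Longrightarrow> a \<in> carrier A \<and> b \<in> carrier B"
    and Padd: "\<And>a b a' b'. P a b \<Longrightarrow> P a' b' \<Longrightarrow> P (a \<oplus>\<^bsub>A\<^esub> a') (b \<oplus>\<^bsub>B\<^esub> b')"
    and Psmult: "\<And>r a b. r \<in> carrier R \<Longrightarrow> P a b \<Longrightarrow> P (r \<odot>\<^bsub>A\<^esub> a) (r \<odot>\<^bsub>B\<^esub> b)"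
    and tot: "\<And>a. a \<in> carrier A \<Longrightarrow> \<exists>b. P a b"
    and sur: "\<And>b. b \<in> carrier B \<Longrightarrow> \<exists>a. P a b"
    and NA: "\<And>a. a \<in> NA \<longleftrightarrow> P a \<zero>\<^bsub>B\<^esub>" and NB: "\<And>b. b \<in> NB \<longleftrightarrow> P \<zero>\<^bsub>A\<^esub> b"
  shows "mod_isomorphic R (quotient_module A NA) (quotient_module B NB)"
proof -
  interpret A: module R A by fact
  interpret B: module R B by fact
  \<comment> \<open>Some \<open>b\<close> is related to zero; scaling the pair by 0 makes the second
    entry zero as well.\<close>
  have P0: "P \<zero>\<^bsub>A\<^esub> \<zero>\<^bsub>B\<^esub>"
  proof -
    obtain b where b: "P \<zero>\<^bsub>A\<^esub> b" using tot[OF A.M.zero_closed] by blast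
    show ?thesis using Psmult[OF A.R.zero_closed b] Pc[OF b] by simp
  qed
  have Pneg: "P (\<ominus>\<^bsub>A\<^esub> a) (\<ominus>\<^bsub>B\<^esub> b)" if "P a b" for a b
    using Psmult[OF _ that, of "\<ominus>\<^bsub>R\<^esub> \<one>\<^bsub>R\<^esub>"] Pc[OF that]
    by (simp add: A.uminus_eq_smult B.uminus_eq_smult)
  have Pdiff: "P (a \<ominus>\<^bsub>A\<^esub> a') (b \<ominus>\<^bsub>B\<^esub> b')" if "P a b" "P a' b'" for a b a' b'
    using Padd[OF that(1) Pneg[OF that(2)]] by (simp add: a_minus_def)
  have subA: "submodule NA R A"
  proof (rule A.submoduleI')
    show "a \<oplus>\<^bsub>A\<^esub> b \<in> NA" if "a \<in> NA" "b \<in> NA" for a b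
      using that Padd[of a "\<zero>\<^bsub>B\<^esub>" b "\<zero>\<^bsub>B\<^esub>"] by (simp add: NA)
    show "a \<odot>\<^bsub>A\<^esub> x \<in> NA" if "a \<in> carrier R" "x \<in> NA" for a x
      using that Psmult[of a x "\<zero>\<^bsub>B\<^esub>"] by (simp add: NA)
  qed (use Pc P0 in \<open>auto simp: NA\<close>)
  have subB: "submodule NB R B"
  proof (rule B.submoduleI')
    show "a \<oplus>\<^bsub>B\<^esub> b \<in> NB" if "a \<in> NB" "b \<in> NB" for a b
      using that Padd[of "\<zero>\<^bsub>A\<^esub>" a "\<zero>\<^bsub>A\<^esub>" b] by (simp add: NB)
    show "a \<odot>\<^bsub>B\<^esub> x \<in> NB" if "a \<in> carrier R" "x \<in> NB" for a x
      using that Psmult[of a "\<zero>\<^bsub>A\<^esub>" x] by (simp add: NB)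
  qed (use Pc P0 in \<open>auto simp: NB\<close>)
  interpret SA: abelian_subgroup NA A by (rule A.submodule_abelian_subgroup[OF subA])
  interpret SB: abelian_subgroup NB B by (rule B.submodule_abelian_subgroup[OF subB])
  \<comment> \<open>\<open>F\<close> is the full image of a coset under \<open>P\<close>, so no
    representative is chosen. The next fact shows that this image is exactly one coset of
    \<open>NB\<close>.\<close>
  define F where "F X = {b. \<exists>a\<in>X. P a b}" for X
  have F: "F (NA +>\<^bsub>A\<^esub> a) = NB +>\<^bsub>B\<^esub> b" if ab: "P a b" for a b
  proof (intro equalityI subsetI)
    fix b' assume "b' \<in> F (NA +>\<^bsub>A\<^esub> a)"
    then obtain a' where a': "a' \<in> NA +>\<^bsub>A\<^esub> a" "P a' b'" by (auto simp: F_def)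
    have "a' \<ominus>\<^bsub>A\<^esub> a \<in> NA"
      using SA.a_rcos_module_imp[OF _ a'(1)] Pc[OF ab] by (simp add: a_minus_def)
    then have "P (a' \<ominus>\<^bsub>A\<^esub> a) \<zero>\<^bsub>B\<^esub>" by (simp add: NA)
    \<comment> \<open>Subtracting the pair \<open>(a' - a, 0)\<close> from
      \<open>(a' - a, b' - b)\<close> leaves \<open>(0, b' - b)\<close>, which is membership in
      \<open>NB\<close>.\<close>
    from Pdiff[OF Pdiff[OF a'(2) ab] this] have "P \<zero>\<^bsub>A\<^esub> (b' \<ominus>\<^bsub>B\<^esub> b)"
      using Pc[OF ab] Pc[OF a'(2)] by (simp add: a_minus_def A.M.r_neg B.M.minus_of_zero)
    then show "b' \<in> NB +>\<^bsub>B\<^esub> b"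
      using Pc[OF ab] Pc[OF a'(2)] by (simp add: NB SB.a_rcos_module a_minus_def)
  next
    fix b' assume "b' \<in> NB +>\<^bsub>B\<^esub> b"
    then obtain n where n: "n \<in> NB" "b' = n \<oplus>\<^bsub>B\<^esub> b" by (auto simp: a_r_coset_def')
    have "P a b'" using Padd[of "\<zero>\<^bsub>A\<^esub>" n a b] n ab Pc[OF ab] by (simp add: NB)
    then show "b' \<in> F (NA +>\<^bsub>A\<^esub> a)"
      using SA.a_rcos_self Pc[OF ab] by (auto simp: F_def)
  qed
  show ?thesis unfolding mod_isomorphic_def
  proof (rule bexI[of _ F])
    show "F \<in> mod_hom R (quotient_module A NA) (quotient_module B NB)"
    proof (rule mod_homI)
      fix X assume "X \<in> carrier (quotient_module A NA)"
      then obtain a where a: "a \<in> carrier A" "X = NA +>\<^bsub>A\<^esub> a"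
        by (auto simp: quotient_module_def A_RCOSETS_def')
      obtain b where b: "P a b" using tot a by blast
      show "F X \<in> carrier (quotient_module B NB)"
        using F[OF b] Pc[OF b] by (auto simp: quotient_module_def A_RCOSETS_def' a)
      fix r assume r: "r \<in> carrier R"
      show "F (r \<odot>\<^bsub>quotient_module A NA\<^esub> X) = r \<odot>\<^bsub>quotient_module B NB\<^esub> F X"
        using F[OF b] F[OF Psmult[OF r b]] Pc[OF b] r
        by (simp add: quotient_module_def a A.coset_smult[OF subA] B.coset_smult[OF subB])
    next
      fix X Y assume "X \<in> carrier (quotient_module A NA)" "Y \<in> carrier (quotient_module A NA)"
      then obtain a a' where a: "a \<in> carrier A" "X = NA +>\<^bsub>A\<^esub> a" "a' \<in> carrier A" "Y = NA +>\<^bsub>A\<^esub> a'"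
        by (auto simp: quotient_module_def A_RCOSETS_def')
      obtain b b' where b: "P a b" "P a' b'" using tot a by blast
      show "F (X \<oplus>\<^bsub>quotient_module A NA\<^esub> Y) = F X \<oplus>\<^bsub>quotient_module B NB\<^esub> F Y"
        using F[OF b(1)] F[OF b(2)] F[OF Padd[OF b]] Pc[OF b(1)] Pc[OF b(2)]
        by (simp add: quotient_module_def a SA.a_rcos_sum SB.a_rcos_sum)
    qed
    have "inj_on F (a_rcosets\<^bsub>A\<^esub> NA)"
    proof (rule inj_onI)
      fix X Y assume "X \<in> a_rcosets\<^bsub>A\<^esub> NA" "Y \<in> a_rcosets\<^bsub>A\<^esub> NA" and eq: "F X = F Y"
      then obtain a a' where a: "a \<in> carrier A" "X = NA +>\<^bsub>A\<^esub> a" "a' \<in> carrier A" "Y = NA +>\<^bsub>A\<^esub> a'"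
        by (auto simp: A_RCOSETS_def')
      obtain b b' where b: "P a b" "P a' b'" using tot a by blast
      have "NB +>\<^bsub>B\<^esub> b = NB +>\<^bsub>B\<^esub> b'" using eq F[OF b(1)] F[OF b(2)] a by simp
      then have "b \<in> NB +>\<^bsub>B\<^esub> b'" using SB.a_rcos_self Pc[OF b(1)] by auto
      then have "P \<zero>\<^bsub>A\<^esub> (b \<ominus>\<^bsub>B\<^esub> b')"
        using Pc[OF b(1)] Pc[OF b(2)] by (simp add: SB.a_rcos_module NB a_minus_def)
      \<comment> \<open>The mirror image: \<open>(0, b - b')\<close> is subtracted from
        \<open>(a - a', b - b')\<close>.\<close>
      from Pdiff[OF Pdiff[OF b] this] have "a \<ominus>\<^bsub>A\<^esub> a' \<in> NA"
        using Pc[OF b(1)] Pc[OF b(2)] by (simp add: NA a_minus_def B.M.r_neg A.M.minus_of_zero)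
      then have "a \<in> NA +>\<^bsub>A\<^esub> a'" using a by (simp add: SA.a_rcos_module a_minus_def)
      then show "X = Y" using a SA.a_repr_independence' by metis
    qed
    moreover have "F ` (a_rcosets\<^bsub>A\<^esub> NA) = a_rcosets\<^bsub>B\<^esub> NB"
    proof (intro equalityI subsetI)
      fix Y assume "Y \<in> F ` (a_rcosets\<^bsub>A\<^esub> NA)"
      then obtain a where a: "a \<in> carrier A" "Y = F (NA +>\<^bsub>A\<^esub> a)"
        by (auto simp: A_RCOSETS_def')
      obtain b where b: "P a b" using tot a by blast
      show "Y \<in> a_rcosets\<^bsub>B\<^esub> NB" using F[OF b] Pc[OF b] a by (auto simp: A_RCOSETS_def')
    next
      fix Y assume "Y \<in> a_rcosets\<^bsub>B\<^esub> NB"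
      then obtain b where b: "b \<in> carrier B" "Y = NB +>\<^bsub>B\<^esub> b" by (auto simp: A_RCOSETS_def')
      obtain a where a: "P a b" using sur b by blast
      show "Y \<in> F ` (a_rcosets\<^bsub>A\<^esub> NA)" using F[OF a] Pc[OF a] b
        by (auto simp: A_RCOSETS_def' intro!: image_eqI[of _ _ "NA +>\<^bsub>A\<^esub> a"])
    qed
    ultimately show "bij_betw F (carrier (quotient_module A NA)) (carrier (quotient_module B NB))"
      by (simp add: quotient_module_def bij_betw_def)
  qed
qed

lemma zero_quotient_module:
  assumes M: "module R M" and N: "carrier M = N"
  shows "zero_module (quotient_module M N)"
proof -
  interpret M: module R M by fact
  have sub: "submodule N R M" using M.carrier_is_submodule N by simp
  interpret N: abelian_subgroup N M by (rule M.submodule_abelian_subgroup[OF sub])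
  have "a_rcosets\<^bsub>M\<^esub> N = {N}"
    using N.a_rcos_const N N.zero_closed by (auto simp: A_RCOSETS_def')
  then show ?thesis by (simp add: zero_module_def quotient_module_def)
qed

section \<open>Injective modules\<close>

text \<open>\<open>R\<close> as a module over itself, rebuilt as a plain record whose elements have
  the type of the ring; the test modules in \<open>injective_module\<close> must have this
  type.\<close>

definition regular_module :: "('a, 'r) ring_scheme \<Rightarrow> ('a, 'a) module" where
  "regular_module R =
     \<lparr>carrier = carrier R, monoid.mult = monoid.mult R, one = one R, zero = zero R, add = add R,
      smult = monoid.mult R\<rparr>"

lemma regular_module_simps [simp]:
  "carrier (regular_module R) = carrier R" "zero (regular_module R) = zero R"
  "add (regular_module R) = add R" "smult (regular_module R) = monoid.mult R"
  by (simp_all add: regular_module_def)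

lemma (in cring) module_regular_module: "module R (regular_module R)"
proof (rule moduleI)
  show "abelian_group (regular_module R)"
    by (rule abelian_groupI) (auto simp: a_ac intro!: bexI[where x = "\<ominus> x" for x] l_neg)
qed (auto simp: l_distr r_distr m_assoc is_cring)

text \<open>An ideal and \<open>R\<close> itself are admissible test modules. An extension
  \<open>h\<close> of \<open>g\<close> to all of \<open>R\<close> satisfies
  \<open>h a = a h(1)\<close>, so \<open>y = h(1)\<close>.\<close>

lemma injective_moduleD_ideal:
  assumes E: "injective_module R E" and I: "submodule I R (regular_module R)"
    and g: "g \<in> mod_hom R ((regular_module R)\<lparr>carrier := I\<rparr>) E"
  obtains y where "y \<in> carrier E" "\<And>a. a \<in> I \<Longrightarrow> g a = a \<odot>\<^bsub>E\<^esub> y"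
proof -
  have mE: "module R E" using E by (simp add: injective_module_def)
  interpret E: module R E by fact
  have reg: "module R (regular_module R)" by (rule E.R.module_regular_module)
  interpret reg: module R "regular_module R" by fact
  have sub: "I \<subseteq> carrier R" using reg.submoduleE(1)[OF I] by simp
  have mI: "module R ((regular_module R)\<lparr>carrier := I\<rparr>)"
    by (rule submodule.submodule_is_module[OF I reg])
  have j: "(\<lambda>x. x) \<in> mod_hom R ((regular_module R)\<lparr>carrier := I\<rparr>) (regular_module R)"
    by (rule mod_homI) (use sub in auto)
  have "\<exists>h\<in>mod_hom R (regular_module R) E. \<forall>x\<in>carrier ((regular_module R)\<lparr>carrier := I\<rparr>). h x = g x"
    using E[unfolded injective_module_def, THEN conjunct2, rule_format,
        of "(regular_module R)\<lparr>carrier := I\<rparr>" "regular_module R" "\<lambda>x. x" g] mI reg j g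
    by simp
  then obtain h where h: "h \<in> mod_hom R (regular_module R) E" "\<And>a. a \<in> I \<Longrightarrow> h a = g a"
    by auto
  show ?thesis
  proof (rule that[of "h \<one>\<^bsub>R\<^esub>"])
    show "h \<one>\<^bsub>R\<^esub> \<in> carrier E" using mod_hom_closed[OF h(1)] by simp
    show "g a = a \<odot>\<^bsub>E\<^esub> h \<one>\<^bsub>R\<^esub>" if "a \<in> I" for a
      using mod_hom_smult[OF h(1), of a "\<one>\<^bsub>R\<^esub>"] that sub h(2)[OF that] by auto
  qed
qed

text \<open>The graph of a homomorphism from a submodule of \<open>C\<close> to \<open>E\<close>. In
  graph form, extension is inclusion and the union of a chain is again a graph, as Zorn's lemma
  requires. Single-valuedness is demanded only at zero; additivity spreads it to all points.\<close>

locale partial_hom =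
  C: module R C + E: module R E
  for R :: "('a, 'r) ring_scheme" and C :: "('a, 'c, 'm) module_scheme"
    and E :: "('a, 'e, 'n) module_scheme" +
  fixes G :: "('c \<times> 'e) set"
  assumes sub: "G \<subseteq> carrier C \<times> carrier E"
    and zero: "(\<zero>\<^bsub>C\<^esub>, \<zero>\<^bsub>E\<^esub>) \<in> G"
    and add: "(x, y) \<in> G \<Longrightarrow> (x', y') \<in> G \<Longrightarrow> (x \<oplus>\<^bsub>C\<^esub> x', y \<oplus>\<^bsub>E\<^esub> y') \<in> G"
    and smult: "a \<in> carrier R \<Longrightarrow> (x, y) \<in> G \<Longrightarrow> (a \<odot>\<^bsub>C\<^esub> x, a \<odot>\<^bsub>E\<^esub> y) \<in> G"
    and zero_unique: "(\<zero>\<^bsub>C\<^esub>, y) \<in> G \<Longrightarrow> y = \<zero>\<^bsub>E\<^esub>"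
begin

lemma carr: "(x, y) \<in> G \<Longrightarrow> x \<in> carrier C \<and> y \<in> carrier E"
  using sub by auto

lemma uminus: "(x, y) \<in> G \<Longrightarrow> (\<ominus>\<^bsub>C\<^esub> x, \<ominus>\<^bsub>E\<^esub> y) \<in> G"
  using smult[of "\<ominus>\<^bsub>R\<^esub> \<one>\<^bsub>R\<^esub>" x y] carr[of x y]
  by (simp add: C.uminus_eq_smult E.uminus_eq_smult)

lemma unique: assumes "(x, y) \<in> G" "(x, y') \<in> G" shows "y = y'"
proof -
  have "(\<zero>\<^bsub>C\<^esub>, y \<ominus>\<^bsub>E\<^esub> y') \<in> G"
    using add[OF assms(1) uminus[OF assms(2)]] carr[OF assms(1)]
    by (simp add: a_minus_def C.M.r_neg)
  then have "y \<ominus>\<^bsub>E\<^esub> y' = \<zero>\<^bsub>E\<^esub>" by (rule zero_unique)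
  then show ?thesis using carr assms E.M.minus_eq_zero_iff by metis
qed

lemma mod_hom_of_total:
  assumes tot: "\<And>x. x \<in> carrier C \<Longrightarrow> \<exists>y. (x, y) \<in> G"
  shows "\<exists>h\<in>mod_hom R C E. \<forall>x y. (x, y) \<in> G \<longrightarrow> h x = y"
proof -
  define h where "h x = (THE y. (x, y) \<in> G)" for x
  have h: "h x = y" if "(x, y) \<in> G" for x y
    unfolding h_def using that unique by blast
  have "h \<in> mod_hom R C E"
  proof (rule mod_homI)
    show "h x \<in> carrier E" if x: "x \<in> carrier C" for x
    proof -
      obtain y where "(x, y) \<in> G" using tot[OF x] by blast
      then show ?thesis using h carr by auto
    qed
    show "h (x \<oplus>\<^bsub>C\<^esub> x') = h x \<oplus>\<^bsub>E\<^esub> h x'" if x: "x \<in> carrier C" "x' \<in> carrier C" for x x'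
    proof -
      obtain y y' where "(x, y) \<in> G" "(x', y') \<in> G" using tot x by blast
      then show ?thesis using h add by simp
    qed
    show "h (a \<odot>\<^bsub>C\<^esub> x) = a \<odot>\<^bsub>E\<^esub> h x" if x: "x \<in> carrier C" "a \<in> carrier R" for x a
    proof -
      obtain y where "(x, y) \<in> G" using tot[OF x(1)] by blast
      then show ?thesis using h smult x by simp
    qed
  qed
  then show ?thesis using h by blast
qed

text \<open>A value \<open>e\<close> at \<open>c\<close> is compatible with \<open>G\<close> if
  \<open>a e\<close> is the value at \<open>a c\<close> whenever \<open>a c\<close> is already in
  the domain. Those \<open>a\<close> form the ideal \<open>I\<close>, and the ideal case of
  injectivity yields one \<open>e\<close> that serves all of them.\<close>

lemma extend:
  assumes inj: "injective_module R E" and c: "c \<in> carrier C"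
  obtains G' y where "partial_hom R C E G'" "G \<subseteq> G'" "(c, y) \<in> G'"
proof -
  define I where "I = {a \<in> carrier R. \<exists>y. (a \<odot>\<^bsub>C\<^esub> c, y) \<in> G}"
  define g where "g a = (THE y. (a \<odot>\<^bsub>C\<^esub> c, y) \<in> G)" for a
  have g: "g a = y" if "(a \<odot>\<^bsub>C\<^esub> c, y) \<in> G" for a y
    unfolding g_def using that unique by blast
  interpret reg: module R "regular_module R" by (rule C.R.module_regular_module)
  have gsum: "((a \<oplus>\<^bsub>R\<^esub> b) \<odot>\<^bsub>C\<^esub> c, y \<oplus>\<^bsub>E\<^esub> z) \<in> G"
    if "a \<in> carrier R" "b \<in> carrier R" "(a \<odot>\<^bsub>C\<^esub> c, y) \<in> G" "(b \<odot>\<^bsub>C\<^esub> c, z) \<in> G" for a b y z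
    using add[OF that(3,4)] that c by (simp add: C.smult_l_distr)
  have gmul: "((a \<otimes>\<^bsub>R\<^esub> b) \<odot>\<^bsub>C\<^esub> c, a \<odot>\<^bsub>E\<^esub> y) \<in> G"
    if "a \<in> carrier R" "b \<in> carrier R" "(b \<odot>\<^bsub>C\<^esub> c, y) \<in> G" for a b y
    using smult[OF that(1,3)] that c by (simp add: C.smult_assoc1)
  have "submodule I R (regular_module R)"
  proof (rule reg.submoduleI')
    show "\<zero>\<^bsub>regular_module R\<^esub> \<in> I" using zero c by (auto simp: I_def)
    show "a \<oplus>\<^bsub>regular_module R\<^esub> b \<in> I" if "a \<in> I" "b \<in> I" for a b
      using that gsum unfolding I_def by (auto, blast)
    show "a \<odot>\<^bsub>regular_module R\<^esub> b \<in> I" if "a \<in> carrier R" "b \<in> I" for a b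
      using that gmul unfolding I_def by auto
  qed (auto simp: I_def)
  moreover have "g \<in> mod_hom R ((regular_module R)\<lparr>carrier := I\<rparr>) E"
  proof (rule mod_homI)
    fix a assume "a \<in> carrier ((regular_module R)\<lparr>carrier := I\<rparr>)"
    then obtain y where y: "a \<in> carrier R" "(a \<odot>\<^bsub>C\<^esub> c, y) \<in> G" by (auto simp: I_def)
    show "g a \<in> carrier E" using g[OF y(2)] carr[OF y(2)] by simp
    fix r assume "r \<in> carrier R"
    then show "g (r \<odot>\<^bsub>regular_module R\<lparr>carrier := I\<rparr>\<^esub> a) = r \<odot>\<^bsub>E\<^esub> g a"
      using g[OF y(2)] g[OF gmul[OF _ y]] by simp
  next
    fix a b assume "a \<in> carrier ((regular_module R)\<lparr>carrier := I\<rparr>)"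
      "b \<in> carrier ((regular_module R)\<lparr>carrier := I\<rparr>)"
    then obtain y z where y: "a \<in> carrier R" "(a \<odot>\<^bsub>C\<^esub> c, y) \<in> G"
      and z: "b \<in> carrier R" "(b \<odot>\<^bsub>C\<^esub> c, z) \<in> G" by (auto simp: I_def)
    show "g (a \<oplus>\<^bsub>regular_module R\<lparr>carrier := I\<rparr>\<^esub> b) = g a \<oplus>\<^bsub>E\<^esub> g b"
      using g[OF y(2)] g[OF z(2)] g[OF gsum[OF y(1) z(1) y(2) z(2)]] by simp
  qed
  ultimately obtain e where e: "e \<in> carrier E" "\<And>a. a \<in> I \<Longrightarrow> g a = a \<odot>\<^bsub>E\<^esub> e"
    by (rule injective_moduleD_ideal[OF inj]) blast
  \<comment> \<open>The new domain is the old one plus the multiples of \<open>c\<close>, with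
    \<open>c\<close> sent to \<open>e\<close>.\<close>
  define G' where "G' = {(x \<oplus>\<^bsub>C\<^esub> a \<odot>\<^bsub>C\<^esub> c, y \<oplus>\<^bsub>E\<^esub> a \<odot>\<^bsub>E\<^esub> e) | x y a. (x, y) \<in> G \<and> a \<in> carrier R}"
  have G'I: "(x', y') \<in> G'" if "(x, y) \<in> G" "a \<in> carrier R"
    "x' = x \<oplus>\<^bsub>C\<^esub> a \<odot>\<^bsub>C\<^esub> c" "y' = y \<oplus>\<^bsub>E\<^esub> a \<odot>\<^bsub>E\<^esub> e" for x y a x' y'
    unfolding G'_def using that by blast
  have "partial_hom R C E G'"
  proof unfold_locales
    show "G' \<subseteq> carrier C \<times> carrier E" using carr e c by (auto simp: G'_def)
    show "(\<zero>\<^bsub>C\<^esub>, \<zero>\<^bsub>E\<^esub>) \<in> G'" by (rule G'I[OF zero C.R.zero_closed]) (use c e in auto)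
  next
    fix x y x' y' assume "(x, y) \<in> G'" "(x', y') \<in> G'"
    then obtain u v a u' v' a' where
      1: "(u, v) \<in> G" "a \<in> carrier R" "x = u \<oplus>\<^bsub>C\<^esub> a \<odot>\<^bsub>C\<^esub> c" "y = v \<oplus>\<^bsub>E\<^esub> a \<odot>\<^bsub>E\<^esub> e"
      and 2: "(u', v') \<in> G" "a' \<in> carrier R" "x' = u' \<oplus>\<^bsub>C\<^esub> a' \<odot>\<^bsub>C\<^esub> c" "y' = v' \<oplus>\<^bsub>E\<^esub> a' \<odot>\<^bsub>E\<^esub> e"
      unfolding G'_def by blast
    show "(x \<oplus>\<^bsub>C\<^esub> x', y \<oplus>\<^bsub>E\<^esub> y') \<in> G'"
      by (rule G'I[OF add[OF 1(1) 2(1)], of "a \<oplus>\<^bsub>R\<^esub> a'"])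
        (use 1 2 carr[OF 1(1)] carr[OF 2(1)] c e in
          \<open>simp_all add: C.smult_l_distr E.smult_l_distr C.M.a_ac E.M.a_ac\<close>)
  next
    fix r x y assume "(x, y) \<in> G'" and r: "r \<in> carrier R"
    then obtain u v a where
      1: "(u, v) \<in> G" "a \<in> carrier R" "x = u \<oplus>\<^bsub>C\<^esub> a \<odot>\<^bsub>C\<^esub> c" "y = v \<oplus>\<^bsub>E\<^esub> a \<odot>\<^bsub>E\<^esub> e"
      unfolding G'_def by blast
    show "(r \<odot>\<^bsub>C\<^esub> x, r \<odot>\<^bsub>E\<^esub> y) \<in> G'"
      by (rule G'I[OF smult[OF r 1(1)], of "r \<otimes>\<^bsub>R\<^esub> a"])
        (use 1 r carr[OF 1(1)] c e in
          \<open>simp_all add: C.smult_r_distr E.smult_r_distr C.smult_assoc1 E.smult_assoc1\<close>)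
  next
    fix z assume "(\<zero>\<^bsub>C\<^esub>, z) \<in> G'"
    then obtain u v a where
      1: "(u, v) \<in> G" "a \<in> carrier R" "\<zero>\<^bsub>C\<^esub> = u \<oplus>\<^bsub>C\<^esub> a \<odot>\<^bsub>C\<^esub> c" "z = v \<oplus>\<^bsub>E\<^esub> a \<odot>\<^bsub>E\<^esub> e"
      unfolding G'_def by blast
    \<comment> \<open>Single-valuedness at zero: the relation \<open>u + a c = 0\<close> puts
      \<open>a\<close> into \<open>I\<close> with \<open>g a = -v\<close>, so \<open>a e\<close>
      cancels \<open>v\<close>.\<close>
    have "a \<odot>\<^bsub>C\<^esub> c = \<ominus>\<^bsub>C\<^esub> u"
      using 1 carr[OF 1(1)] c by (metis C.M.minus_equality C.M.a_comm C.smult_closed)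
    then have ac: "(a \<odot>\<^bsub>C\<^esub> c, \<ominus>\<^bsub>E\<^esub> v) \<in> G" using uminus[OF 1(1)] by simp
    then have "a \<in> I" using 1 by (auto simp: I_def)
    then have "a \<odot>\<^bsub>E\<^esub> e = \<ominus>\<^bsub>E\<^esub> v" using e(2) g[OF ac] by simp
    then show "z = \<zero>\<^bsub>E\<^esub>" using 1 carr[OF 1(1)] by (simp add: E.M.r_neg)
  qed
  moreover have "G \<subseteq> G'"
  proof clarify
    fix x y assume xy: "(x, y) \<in> G"
    show "(x, y) \<in> G'"
      by (rule G'I[OF xy C.R.zero_closed]) (use carr[OF xy] c e in auto)
  qed
  moreover have "(c, e) \<in> G'"
    by (rule G'I[OF zero C.R.one_closed]) (use c e in auto)
  ultimately show ?thesis by (rule that)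
qed

end

text \<open>
  Baer's criterion: a maximal partial homomorphism is total, because injectivity applied to the
  ideal \<open>{a. a c \<in> domain}\<close> provides a value at a new element \<open>c\<close>.
\<close>

lemma injective_module_factor:
  assumes E: "injective_module R E" and B: "module R B" and C: "module R C"
    and d: "d \<in> mod_hom R B C" and u: "u \<in> mod_hom R B E"
    and ker: "\<And>x. x \<in> carrier B \<Longrightarrow> d x = \<zero>\<^bsub>C\<^esub> \<Longrightarrow> u x = \<zero>\<^bsub>E\<^esub>"
  shows "\<exists>h\<in>mod_hom R C E. \<forall>x\<in>carrier B. h (d x) = u x"
proof -
  have mE: "module R E" using E by (simp add: injective_module_def)
  interpret B: module R B by fact
  interpret C: module R C by fact
  interpret E: module R E by fact
  \<comment> \<open>The assignment \<open>d x \<mapsto> u x\<close> on the image of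
    \<open>d\<close>; the kernel hypothesis is its single-valuedness at zero.\<close>
  define G0 where "G0 = (\<lambda>x. (d x, u x)) ` carrier B"
  have G0: "partial_hom R C E G0"
  proof unfold_locales
    show "G0 \<subseteq> carrier C \<times> carrier E"
      using mod_hom_closed[OF d] mod_hom_closed[OF u] by (auto simp: G0_def)
    show "(\<zero>\<^bsub>C\<^esub>, \<zero>\<^bsub>E\<^esub>) \<in> G0"
      using mod_hom_zero[OF B C d] mod_hom_zero[OF B mE u]
      by (auto simp: G0_def intro!: image_eqI[of _ _ "\<zero>\<^bsub>B\<^esub>"])
  next
    fix x y x' y' assume "(x, y) \<in> G0" "(x', y') \<in> G0"
    then show "(x \<oplus>\<^bsub>C\<^esub> x', y \<oplus>\<^bsub>E\<^esub> y') \<in> G0"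
      by (auto simp: G0_def simp flip: mod_hom_add[OF d] mod_hom_add[OF u])
  next
    fix a x y assume "a \<in> carrier R" "(x, y) \<in> G0"
    then show "(a \<odot>\<^bsub>C\<^esub> x, a \<odot>\<^bsub>E\<^esub> y) \<in> G0"
      by (auto simp: G0_def simp flip: mod_hom_smult[OF d] mod_hom_smult[OF u])
  next
    fix y assume "(\<zero>\<^bsub>C\<^esub>, y) \<in> G0"
    then obtain x where x: "x \<in> carrier B" "d x = \<zero>\<^bsub>C\<^esub>" "y = u x" by (auto simp: G0_def)
    then show "y = \<zero>\<^bsub>E\<^esub>" using ker by simp
  qed
  define \<A> where "\<A> = {G. partial_hom R C E G \<and> G0 \<subseteq> G}"
  have "\<exists>G\<in>\<A>. \<forall>X\<in>\<A>. G \<subseteq> X \<longrightarrow> X = G"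
  proof (rule subset_Zorn_nonempty)
    show "\<A> \<noteq> {}" using G0 by (auto simp: \<A>_def)
    fix \<C> assume ne: "\<C> \<noteq> {}" and chain: "subset.chain \<A> \<C>"
    have ph: "partial_hom R C E G" "G0 \<subseteq> G" if "G \<in> \<C>" for G
      using chain that by (auto simp: \<A>_def subset.chain_def)
    have "partial_hom R C E (\<Union>\<C>)"
    proof unfold_locales
      show "\<Union>\<C> \<subseteq> carrier C \<times> carrier E" by (rule Union_least) (rule partial_hom.sub[OF ph(1)])
      obtain G where "G \<in> \<C>" using ne by blast
      then show "(\<zero>\<^bsub>C\<^esub>, \<zero>\<^bsub>E\<^esub>) \<in> \<Union>\<C>" using partial_hom.zero[OF ph(1)] by blast
    next
      fix x y x' y' assume "(x, y) \<in> \<Union>\<C>" "(x', y') \<in> \<Union>\<C>"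
      then obtain G where "G \<in> \<C>" "(x, y) \<in> G" "(x', y') \<in> G"
        using chain unfolding subset_chain_def by blast
      then show "(x \<oplus>\<^bsub>C\<^esub> x', y \<oplus>\<^bsub>E\<^esub> y') \<in> \<Union>\<C>" using partial_hom.add[OF ph(1)] by blast
    next
      fix a x y assume "a \<in> carrier R" "(x, y) \<in> \<Union>\<C>"
      then show "(a \<odot>\<^bsub>C\<^esub> x, a \<odot>\<^bsub>E\<^esub> y) \<in> \<Union>\<C>" using partial_hom.smult[OF ph(1)] by blast
    next
      fix y assume "(\<zero>\<^bsub>C\<^esub>, y) \<in> \<Union>\<C>"
      then show "y = \<zero>\<^bsub>E\<^esub>" using partial_hom.zero_unique[OF ph(1)] by blast
    qed
    then show "\<Union>\<C> \<in> \<A>" using ph(2) ne by (auto simp: \<A>_def)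
  qed
  then obtain G where G: "partial_hom R C E G" "G0 \<subseteq> G"
    and max: "\<And>X. partial_hom R C E X \<Longrightarrow> G \<subseteq> X \<Longrightarrow> X = G"
    by (auto simp: \<A>_def)
  interpret G: partial_hom R C E G by fact
  \<comment> \<open>Extending \<open>G\<close> through \<open>x\<close> gives back \<open>G\<close>
    by maximality, so \<open>x\<close> was in the domain already.\<close>
  have "\<exists>y. (x, y) \<in> G" if "x \<in> carrier C" for x
    using G.extend[OF E that] max by metis
  then obtain h where h: "h \<in> mod_hom R C E" "\<And>x y. (x, y) \<in> G \<Longrightarrow> h x = y"
    using G.mod_hom_of_total by blast
  show ?thesis by (intro bexI[OF _ h(1)] ballI h(2)) (use G(2) in \<open>auto simp: G0_def\<close>)
qed

text \<open>Multiplication by \<open>a\<close> on \<open>R\<close> is injective in a domain, so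
  \<open>r \<mapsto> r x\<close> factors through it by some \<open>h\<close>; then
  \<open>a h(1) = h(a) = x\<close>.\<close>

lemma injective_module_divisible:
  assumes "domain R" and E: "injective_module R E"
    and a: "a \<in> carrier R" "a \<noteq> \<zero>\<^bsub>R\<^esub>" and x: "x \<in> carrier E"
  obtains y where "y \<in> carrier E" "a \<odot>\<^bsub>E\<^esub> y = x"
proof -
  have mE: "module R E" using E by (simp add: injective_module_def)
  interpret R: domain R by fact
  interpret E: module R E by fact
  let ?R = "regular_module R"
  have reg: "module R ?R" by (rule R.module_regular_module)
  have d: "(\<lambda>r. a \<otimes>\<^bsub>R\<^esub> r) \<in> mod_hom R ?R ?R"
    by (rule mod_homI) (use a in \<open>auto simp: R.r_distr R.m_ac\<close>)
  have u: "(\<lambda>r. r \<odot>\<^bsub>E\<^esub> x) \<in> mod_hom R ?R E"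
    by (rule mod_homI) (use x in \<open>auto simp: E.smult_l_distr E.smult_assoc1\<close>)
  obtain h where h: "h \<in> mod_hom R ?R E" "\<And>r. r \<in> carrier R \<Longrightarrow> h (a \<otimes>\<^bsub>R\<^esub> r) = r \<odot>\<^bsub>E\<^esub> x"
    using injective_module_factor[OF E reg reg d u] a x R.integral by fastforce
  have "a \<odot>\<^bsub>E\<^esub> h \<one>\<^bsub>R\<^esub> = x"
    using h(2)[of "\<one>\<^bsub>R\<^esub>"] mod_hom_smult[OF h(1), of a "\<one>\<^bsub>R\<^esub>"] a x by simp
  then show ?thesis using that[of "h \<one>\<^bsub>R\<^esub>"] mod_hom_closed[OF h(1), of "\<one>\<^bsub>R\<^esub>"] by simp
qed

section \<open>Comparison of injective resolutions\<close>

lemma injective_resolutionD: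
  assumes "injective_resolution R M e E d"
  shows "module R M" "injective_module R (E i)" "module R (E i)"
    and "e \<in> mod_hom R M (E 0)" "inj_on e (carrier M)"
    and "d i \<in> mod_hom R (E i) (E (Suc i))"
    and "x \<in> carrier M \<Longrightarrow> d 0 (e x) = \<zero>\<^bsub>E 1\<^esub>"
    and "y \<in> carrier (E i) \<Longrightarrow> d (Suc i) (d i y) = \<zero>\<^bsub>E (Suc (Suc i))\<^esub>"
proof -
  note res = assms[unfolded injective_resolution_def]
  show "module R M" "e \<in> mod_hom R M (E 0)" "inj_on e (carrier M)" using res by simp_all
  show inj: "injective_module R (E i)" and "d i \<in> mod_hom R (E i) (E (Suc i))" using res by simp_all
  show "module R (E i)" using inj by (simp add: injective_module_def)
  show "d 0 (e x) = \<zero>\<^bsub>E 1\<^esub>" if "x \<in> carrier M"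
  proof -
    have "e ` carrier M = {x \<in> carrier (E 0). d 0 x = \<zero>\<^bsub>E 1\<^esub>}" using res by simp
    then show ?thesis using that by blast
  qed
  show "d (Suc i) (d i y) = \<zero>\<^bsub>E (Suc (Suc i))\<^esub>" if "y \<in> carrier (E i)"
  proof -
    have "d i ` carrier (E i) = {x \<in> carrier (E (Suc i)). d (Suc i) x = \<zero>\<^bsub>E (Suc (Suc i))\<^esub>}"
      using res by simp
    then show ?thesis using that by blast
  qed
qed

lemma injective_resolution_exact_0:
  assumes "injective_resolution R M e E d" "x \<in> carrier (E 0)" "d 0 x = \<zero>\<^bsub>E 1\<^esub>"
  obtains y where "y \<in> carrier M" "x = e y"
proof -
  have "e ` carrier M = {x \<in> carrier (E 0). d 0 x = \<zero>\<^bsub>E 1\<^esub>}"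
    using assms(1) by (simp add: injective_resolution_def)
  then show ?thesis using assms(2,3) that by blast
qed

lemma injective_resolution_exact:
  assumes "injective_resolution R M e E d" "x \<in> carrier (E (Suc i))"
    "d (Suc i) x = \<zero>\<^bsub>E (Suc (Suc i))\<^esub>"
  obtains y where "y \<in> carrier (E i)" "x = d i y"
proof -
  have "d i ` carrier (E i) = {x \<in> carrier (E (Suc i)). d (Suc i) x = \<zero>\<^bsub>E (Suc (Suc i))\<^esub>}"
    using assms(1) by (simp add: injective_resolution_def)
  then show ?thesis using assms(2,3) that by blast
qed

section \<open>Chain maps and homotopies between resolutions\<close>

text \<open>A chain map lifting the identity of \<open>M\<close>. The two resolutions may have
  different element types.\<close>

definition resolution_map ::
    "('a, 'r) ring_scheme \<Rightarrow> ('a, 'b, 'm) module_scheme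
      \<Rightarrow> ('b \<Rightarrow> 'c) \<Rightarrow> (nat \<Rightarrow> ('a, 'c) module) \<Rightarrow> (nat \<Rightarrow> 'c \<Rightarrow> 'c)
      \<Rightarrow> ('b \<Rightarrow> 'd) \<Rightarrow> (nat \<Rightarrow> ('a, 'd) module) \<Rightarrow> (nat \<Rightarrow> 'd \<Rightarrow> 'd) \<Rightarrow> (nat \<Rightarrow> 'c \<Rightarrow> 'd) \<Rightarrow> bool" where
  "resolution_map R M e E d e' E' d' \<phi> \<longleftrightarrow>
     (\<forall>i. \<phi> i \<in> mod_hom R (E i) (E' i)) \<and>
     (\<forall>x\<in>carrier M. \<phi> 0 (e x) = e' x) \<and>
     (\<forall>i. \<forall>x\<in>carrier (E i). \<phi> (Suc i) (d i x) = d' i (\<phi> i x))"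

lemma resolution_map_exists:
  assumes E: "injective_resolution R M e E d" and E': "injective_resolution R M e' E' d'"
  shows "\<exists>\<phi>. resolution_map R M e E d e' E' d' \<phi>"
proof -
  note D = injective_resolutionD[OF E] and D' = injective_resolutionD[OF E']
  \<comment> \<open>The second clause is what the recursion must carry along: it says that
    \<open>d' n\<close> after \<open>f\<close> vanishes on the kernel of \<open>d n\<close>, which
    is the condition for the next map to exist as a factor through \<open>d n\<close>.\<close>
  define P where "P n f \<longleftrightarrow> f \<in> mod_hom R (E n) (E' n) \<and>
      (\<forall>x\<in>carrier (E n). d n x = \<zero>\<^bsub>E (Suc n)\<^esub> \<longrightarrow> d' n (f x) = \<zero>\<^bsub>E' (Suc n)\<^esub>) \<and>
      (n = 0 \<longrightarrow> (\<forall>x\<in>carrier M. f (e x) = e' x))" for n f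
  have "\<exists>\<phi>. \<forall>n. P n (\<phi> n) \<and> (\<forall>x\<in>carrier (E n). \<phi> (Suc n) (d n x) = d' n (\<phi> n x))"
  proof (rule dependent_nat_choice)
    \<comment> \<open>Since \<open>e\<close> is injective, \<open>e'\<close> vanishes on its kernel,
      so \<open>e'\<close> factors through \<open>e\<close>.\<close>
    have "e' x = \<zero>\<^bsub>E' 0\<^esub>" if x: "x \<in> carrier M" "e x = \<zero>\<^bsub>E 0\<^esub>" for x
    proof -
      interpret M: module R M by (rule D(1))
      have "x = \<zero>\<^bsub>M\<^esub>"
        using x mod_hom_zero[OF D(1) D(3) D(4)] inj_onD[OF D(5), of x "\<zero>\<^bsub>M\<^esub>"] by auto
      then show ?thesis using mod_hom_zero[OF D'(1,3,4)] by simp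
    qed
    then obtain f where f: "f \<in> mod_hom R (E 0) (E' 0)" "\<And>x. x \<in> carrier M \<Longrightarrow> f (e x) = e' x"
      using injective_module_factor[OF D'(2)[of 0] D(1) D(3)[of 0] D(4) D'(4)] by blast
    have "d' 0 (f x) = \<zero>\<^bsub>E' 1\<^esub>" if x: "x \<in> carrier (E 0)" "d 0 x = \<zero>\<^bsub>E 1\<^esub>" for x
    proof -
      obtain y where "y \<in> carrier M" "x = e y" using injective_resolution_exact_0[OF E x] .
      then show ?thesis using f(2) D'(7) by simp
    qed
    then show "\<exists>f. P 0 f" using f by (auto simp: P_def)
  next
    fix f n assume "P n f"
    then have f: "f \<in> mod_hom R (E n) (E' n)"
      "\<And>x. x \<in> carrier (E n) \<Longrightarrow> d n x = \<zero>\<^bsub>E (Suc n)\<^esub> \<Longrightarrow> d' n (f x) = \<zero>\<^bsub>E' (Suc n)\<^esub>"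
      by (auto simp: P_def)
    obtain g where g: "g \<in> mod_hom R (E (Suc n)) (E' (Suc n))"
      "\<And>x. x \<in> carrier (E n) \<Longrightarrow> g (d n x) = d' n (f x)"
      using injective_module_factor[OF D'(2)[of "Suc n"] D(3)[of n] D(3)[of "Suc n"] D(6)
          mod_hom_comp[OF f(1) D'(6)] f(2)] by blast
    \<comment> \<open>By exactness \<open>x = d n y\<close>, so \<open>g x = d' n (f y)\<close> is
      itself a boundary.\<close>
    have "d' (Suc n) (g x) = \<zero>\<^bsub>E' (Suc (Suc n))\<^esub>"
      if x: "x \<in> carrier (E (Suc n))" "d (Suc n) x = \<zero>\<^bsub>E (Suc (Suc n))\<^esub>" for x
    proof -
      obtain y where "y \<in> carrier (E n)" "x = d n y" using injective_resolution_exact[OF E x] .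
      then show ?thesis using g(2) D'(8) mod_hom_closed[OF f(1)] by simp
    qed
    then show "\<exists>g. P (Suc n) g \<and> (\<forall>x\<in>carrier (E n). g (d n x) = d' n (f x))"
      using g by (auto simp: P_def)
  qed
  then obtain \<phi> where "\<forall>n. P n (\<phi> n) \<and> (\<forall>x\<in>carrier (E n). \<phi> (Suc n) (d n x) = d' n (\<phi> n x))" ..
  then have "resolution_map R M e E d e' E' d' \<phi>"
    unfolding resolution_map_def P_def by metis
  then show ?thesis by blast
qed

text \<open>Each \<open>t (Suc i)\<close> is obtained by factoring
  \<open>\<delta> (Suc i) - d i t i\<close> through \<open>d (Suc i)\<close>. By exactness it
  suffices that this difference vanishes on the image of \<open>d i\<close>, where it equals
  \<open>d i (\<delta> i y - t i (d i y))\<close>.\<close>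

lemma resolution_null_homotopy:
  assumes E: "injective_resolution R M e E d"
    and \<delta>: "\<And>i. \<delta> i \<in> mod_hom R (E i) (E i)"
    and \<delta>e: "\<And>x. x \<in> carrier M \<Longrightarrow> \<delta> 0 (e x) = \<zero>\<^bsub>E 0\<^esub>"
    and \<delta>d: "\<And>i x. x \<in> carrier (E i) \<Longrightarrow> \<delta> (Suc i) (d i x) = d i (\<delta> i x)"
  shows "\<exists>t. (\<forall>i. t i \<in> mod_hom R (E (Suc i)) (E i)) \<and>
    (\<forall>x\<in>carrier (E 0). t 0 (d 0 x) = \<delta> 0 x) \<and>
    (\<forall>i. \<forall>x\<in>carrier (E (Suc i)).
      t (Suc i) (d (Suc i) x) = \<delta> (Suc i) x \<ominus>\<^bsub>E (Suc i)\<^esub> d i (t i x))"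
proof -
  note D = injective_resolutionD[OF E]
  \<comment> \<open>The middle clause is the homotopy equation in degree \<open>n\<close> after
    applying \<open>d n\<close>, which kills its term \<open>d t\<close>. It is all the next step
    needs, and it can be stated for one \<open>s\<close> without its predecessor; the full equation
    involves two consecutive maps and is kept in \<open>Q\<close>.\<close>
  define P where "P n s \<longleftrightarrow> s \<in> mod_hom R (E (Suc n)) (E n) \<and>
      (\<forall>x\<in>carrier (E n). d n (s (d n x)) = d n (\<delta> n x)) \<and>
      (n = 0 \<longrightarrow> (\<forall>x\<in>carrier (E 0). s (d 0 x) = \<delta> 0 x))" for n s
  define Q where "Q n s s' \<longleftrightarrow> (\<forall>x\<in>carrier (E (Suc n)).
      s' (d (Suc n) x) = \<delta> (Suc n) x \<ominus>\<^bsub>E (Suc n)\<^esub> d n (s x))" for n s s'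
  have "\<exists>t. \<forall>n. P n (t n) \<and> Q n (t n) (t (Suc n))"
  proof (rule dependent_nat_choice)
    have "\<delta> 0 x = \<zero>\<^bsub>E 0\<^esub>" if x: "x \<in> carrier (E 0)" "d 0 x = \<zero>\<^bsub>E (Suc 0)\<^esub>" for x
    proof -
      obtain y where "y \<in> carrier M" "x = e y"
        using injective_resolution_exact_0[OF E] x by auto
      then show ?thesis using \<delta>e by simp
    qed
    then obtain s where s: "s \<in> mod_hom R (E (Suc 0)) (E 0)"
      "\<And>x. x \<in> carrier (E 0) \<Longrightarrow> s (d 0 x) = \<delta> 0 x"
      using injective_module_factor[OF D(2)[of 0] D(3)[of 0] D(3)[of "Suc 0"] D(6)[of 0] \<delta>[of 0]]
      by blast
    then show "\<exists>s. P 0 s" by (auto simp: P_def)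
  next
    fix s n assume "P n s"
    then have s: "s \<in> mod_hom R (E (Suc n)) (E n)"
      "\<And>x. x \<in> carrier (E n) \<Longrightarrow> d n (s (d n x)) = d n (\<delta> n x)"
      by (auto simp: P_def)
    interpret E1: module R "E (Suc n)" by (rule D(3))
    interpret E2: module R "E (Suc (Suc n))" by (rule D(3))
    have cl: "d n (s x) \<in> carrier (E (Suc n))" "\<delta> (Suc n) x \<in> carrier (E (Suc n))"
      if "x \<in> carrier (E (Suc n))" for x
      using mod_hom_closed[OF D(6) mod_hom_closed[OF s(1) that]] mod_hom_closed[OF \<delta> that] .
    have "\<delta> (Suc n) x \<ominus>\<^bsub>E (Suc n)\<^esub> d n (s x) = \<zero>\<^bsub>E (Suc n)\<^esub>"
      if x: "x \<in> carrier (E (Suc n))" "d (Suc n) x = \<zero>\<^bsub>E (Suc (Suc n))\<^esub>" for x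
    proof -
      obtain y where y: "y \<in> carrier (E n)" "x = d n y"
        using injective_resolution_exact[OF E x] .
      then show ?thesis
        using cl[OF x(1)] \<delta>d[OF y(1)] s(2)[OF y(1)] by (simp add: E1.M.minus_eq_zero_iff)
    qed
    then obtain s' where s': "s' \<in> mod_hom R (E (Suc (Suc n))) (E (Suc n))"
      "\<And>x. x \<in> carrier (E (Suc n)) \<Longrightarrow>
        s' (d (Suc n) x) = \<delta> (Suc n) x \<ominus>\<^bsub>E (Suc n)\<^esub> d n (s x)"
      using injective_module_factor[OF D(2)[of "Suc n"] D(3)[of "Suc n"] D(3)[of "Suc (Suc n)"]
          D(6)[of "Suc n"] mod_hom_diff[OF D(3) \<delta>[of "Suc n"] mod_hom_comp[OF s(1) D(6)]]]
      by blast
    have "d (Suc n) (s' (d (Suc n) x)) = d (Suc n) (\<delta> (Suc n) x)" if x: "x \<in> carrier (E (Suc n))" for x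
      using mod_hom_minus[OF D(3) D(3) D(6) cl(2)[OF x] cl(1)[OF x]] D(8)[OF mod_hom_closed[OF s(1) x]]
        mod_hom_closed[OF D(6) cl(2)[OF x]]
      by (simp add: s'(2)[OF x] a_minus_def E2.M.minus_of_zero)
    then show "\<exists>s'. P (Suc n) s' \<and> Q n s s'"
      using s' by (auto simp: P_def Q_def)
  qed
  then obtain t where t: "\<And>n. P n (t n)" "\<And>n. Q n (t n) (t (Suc n))" by blast
  show ?thesis
  proof (intro exI[of _ t] conjI allI ballI)
    show "t i \<in> mod_hom R (E (Suc i)) (E i)" for i using t(1)[of i] by (simp add: P_def)
    show "t 0 (d 0 x) = \<delta> 0 x" if "x \<in> carrier (E 0)" for x
      using t(1)[of 0] that by (simp add: P_def)
    show "t (Suc i) (d (Suc i) x) = \<delta> (Suc i) x \<ominus>\<^bsub>E (Suc i)\<^esub> d i (t i x)"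
      if "x \<in> carrier (E (Suc i))" for i x
      using t(2)[of i] that by (simp add: Q_def)
  qed
qed

section \<open>The subcomplex killed by an ideal\<close>

text \<open>The colon submodule \<open>(0 : I)\<close> in \<open>M\<close>, a model of
  \<open>Hom(R/I, M)\<close> that consists of elements of \<open>M\<close>. Linear maps preserve it,
  so complexes and homotopies restrict to it.\<close>

definition annihilated :: "('a, 'b, 'm) module_scheme \<Rightarrow> 'a set \<Rightarrow> 'b set" where
  "annihilated M I = {x \<in> carrier M. \<forall>a\<in>I. a \<odot>\<^bsub>M\<^esub> x = \<zero>\<^bsub>M\<^esub>}"

lemma (in module) annihilated_submodule:
  assumes "I \<subseteq> carrier R"
  shows "submodule (annihilated M I) R M"
proof (rule submoduleI')
  show "b \<odot>\<^bsub>M\<^esub> x \<in> annihilated M I" if b: "b \<in> carrier R" and x: "x \<in> annihilated M I" for b x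
  proof -
    have "a \<odot>\<^bsub>M\<^esub> (b \<odot>\<^bsub>M\<^esub> x) = \<zero>\<^bsub>M\<^esub>" if a: "a \<in> I" for a
    proof -
      have "a \<in> carrier R" "x \<in> carrier M" "a \<odot>\<^bsub>M\<^esub> x = \<zero>\<^bsub>M\<^esub>"
        using a x assms by (auto simp: annihilated_def)
      then show ?thesis using b by (metis smult_assoc1 R.m_comm smult_r_null)
    qed
    then show ?thesis using b x by (auto simp: annihilated_def)
  qed
qed (use assms in \<open>auto simp: annihilated_def smult_r_distr subset_iff\<close>)

lemma mod_hom_annihilated:
  assumes "module R M" "module R N" "h \<in> mod_hom R M N" "I \<subseteq> carrier R" "x \<in> annihilated M I"
  shows "h x \<in> annihilated N I"
proof -
  have "a \<odot>\<^bsub>N\<^esub> h x = \<zero>\<^bsub>N\<^esub>" if "a \<in> I" for a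
    using mod_hom_smult[OF assms(3), of a x] mod_hom_zero[OF assms(1-3)] that assms(4,5)
    by (auto simp: annihilated_def)
  then show ?thesis using mod_hom_closed[OF assms(3)] assms(5) by (auto simp: annihilated_def)
qed

definition annihilated_complex ::
    "(nat \<Rightarrow> ('a, 'c) module) \<Rightarrow> 'a set \<Rightarrow> nat \<Rightarrow> ('a, 'c) module" where
  "annihilated_complex E I j = (E j)\<lparr>carrier := annihilated (E j) I\<rparr>"

text \<open>Stated inside the full \<open>E i\<close>, because the differences compared later are
  formed there.\<close>

lemma coboundaries_annihilated_submodule:
  assumes E: "injective_resolution R M e E d" and I: "I \<subseteq> carrier R"
  shows "submodule (coboundaries (annihilated_complex E I) d i) R (E i)"
proof (cases i)
  case 0
  interpret E: module R "E 0" by (rule injective_resolutionD(3)[OF E])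
  show ?thesis using 0
    by (auto simp: coboundaries_def annihilated_complex_def intro!: E.submoduleI')
next
  case (Suc j)
  note D = injective_resolutionD[OF E]
  show ?thesis
    using mod_hom_image_submodule[OF D(3) D(3) D(6) module.annihilated_submodule[OF D(3) I, of j]] Suc
    by (simp add: coboundaries_def annihilated_complex_def)
qed

lemma resolution_map_coboundaries:
  assumes E: "injective_resolution R M e E d" and E': "injective_resolution R M e' E' d'"
    and \<phi>: "resolution_map R M e E d e' E' d' \<phi>" and I: "I \<subseteq> carrier R"
    and x: "x \<in> coboundaries (annihilated_complex E I) d i"
  shows "\<phi> i x \<in> coboundaries (annihilated_complex E' I) d' i"
proof (cases i)
  case 0
  then show ?thesis
    using x \<phi> mod_hom_zero[OF injective_resolutionD(3)[OF E] injective_resolutionD(3)[OF E'], of "\<phi> 0" 0 0]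
    by (simp add: coboundaries_def annihilated_complex_def resolution_map_def)
next
  case (Suc j)
  then obtain y where y: "y \<in> annihilated (E j) I" "x = d j y"
    using x by (auto simp: coboundaries_def annihilated_complex_def)
  have "\<phi> i x = d' j (\<phi> j y)"
    using y \<phi> Suc by (auto simp: resolution_map_def annihilated_def)
  moreover have "\<phi> j y \<in> annihilated (E' j) I"
    using mod_hom_annihilated[OF injective_resolutionD(3)[OF E] injective_resolutionD(3)[OF E'] _ I y(1)]
      \<phi> by (simp add: resolution_map_def)
  ultimately show ?thesis using Suc by (auto simp: coboundaries_def annihilated_complex_def)
qed

text \<open>The chain map \<open>\<psi> \<phi> - id\<close> vanishes on \<open>M\<close>, hence has
  a homotopy \<open>t\<close> on all of \<open>E\<close>. On a cocycle the term of the homotopy that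
  starts with \<open>d\<close> drops out, leaving \<open>d (t x)\<close> in positive degree and 0 in
  degree 0. Linearity of \<open>t\<close> keeps \<open>t x\<close> killed by
  \<open>I\<close>.\<close>

lemma resolution_map_roundtrip:
  assumes E: "injective_resolution R M e E d" and E': "injective_resolution R M e' E' d'"
    and \<phi>: "resolution_map R M e E d e' E' d' \<phi>" and \<psi>: "resolution_map R M e' E' d' e E d \<psi>"
    and I: "I \<subseteq> carrier R"
    and x: "x \<in> annihilated (E i) I" "d i x = \<zero>\<^bsub>E (Suc i)\<^esub>"
  shows "\<psi> i (\<phi> i x) \<ominus>\<^bsub>E i\<^esub> x \<in> coboundaries (annihilated_complex E I) d i"
proof -
  note D = injective_resolutionD[OF E] and D' = injective_resolutionD[OF E']
  have \<phi>h: "\<phi> i \<in> mod_hom R (E i) (E' i)" and \<psi>h: "\<psi> i \<in> mod_hom R (E' i) (E i)"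
    and \<phi>e: "y \<in> carrier M \<Longrightarrow> \<phi> 0 (e y) = e' y" and \<psi>e: "y \<in> carrier M \<Longrightarrow> \<psi> 0 (e' y) = e y"
    and \<phi>d: "z \<in> carrier (E i) \<Longrightarrow> \<phi> (Suc i) (d i z) = d' i (\<phi> i z)"
    and \<psi>d: "w \<in> carrier (E' i) \<Longrightarrow> \<psi> (Suc i) (d' i w) = d i (\<psi> i w)" for i y z w
    using \<phi> \<psi> by (auto simp: resolution_map_def)
  define \<delta> where "\<delta> i z = \<psi> i (\<phi> i z) \<ominus>\<^bsub>E i\<^esub> z" for i z
  have cl: "\<psi> i (\<phi> i z) \<in> carrier (E i)" if "z \<in> carrier (E i)" for i z
    using mod_hom_closed[OF \<psi>h mod_hom_closed[OF \<phi>h that]] .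
  have id: "(\<lambda>z. z) \<in> mod_hom R (E i) (E i)" for i by (rule mod_homI) auto
  have \<delta>: "\<delta> i \<in> mod_hom R (E i) (E i)" for i
    unfolding \<delta>_def using mod_hom_diff[OF D(3) mod_hom_comp[OF \<phi>h \<psi>h] id] .
  have \<delta>e: "\<delta> 0 (e y) = \<zero>\<^bsub>E 0\<^esub>" if "y \<in> carrier M" for y
    using \<phi>e[OF that] \<psi>e[OF that] mod_hom_closed[OF D(4) that]
      abelian_group.minus_eq_zero_iff[OF module.axioms(2)[OF D(3)[of 0]]]
    by (simp add: \<delta>_def)
  have \<delta>d: "\<delta> (Suc i) (d i z) = d i (\<delta> i z)" if z: "z \<in> carrier (E i)" for i z
    using mod_hom_minus[OF D(3) D(3) D(6) cl[OF z] z] \<phi>d[OF z] \<psi>d[OF mod_hom_closed[OF \<phi>h z]]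
    by (simp add: \<delta>_def)
  obtain t where t: "\<And>i. t i \<in> mod_hom R (E (Suc i)) (E i)"
    "\<And>x. x \<in> carrier (E 0) \<Longrightarrow> t 0 (d 0 x) = \<delta> 0 x"
    "\<And>i x. x \<in> carrier (E (Suc i)) \<Longrightarrow>
      t (Suc i) (d (Suc i) x) = \<delta> (Suc i) x \<ominus>\<^bsub>E (Suc i)\<^esub> d i (t i x)"
    using resolution_null_homotopy[of R M e E d \<delta>, OF E \<delta> \<delta>e \<delta>d] by blast
  have xc: "x \<in> carrier (E i)" using x(1) by (simp add: annihilated_def)
  have "\<delta> i x \<in> coboundaries (annihilated_complex E I) d i"
  proof (cases i)
    case 0
    have "\<delta> 0 x = \<zero>\<^bsub>E 0\<^esub>"
      using t(2)[of x] xc x(2) mod_hom_zero[OF D(3) D(3) t(1)[of 0]] 0 by simp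
    then show ?thesis using 0 by (simp add: coboundaries_def annihilated_complex_def)
  next
    case (Suc j)
    \<comment> \<open>The left side is \<open>t i\<close> applied to \<open>d i x\<close>, which is
      zero since \<open>x\<close> is a cocycle.\<close>
    have "\<zero>\<^bsub>E i\<^esub> = \<delta> i x \<ominus>\<^bsub>E i\<^esub> d j (t j x)"
      using t(3)[of x j] xc x(2) mod_hom_zero[OF D(3) D(3) t(1)[of i]] Suc by simp
    moreover have "t j x \<in> annihilated (E j) I"
      using mod_hom_annihilated[OF D(3) D(3) t(1)[of j] I] x Suc by simp
    moreover have "d j (t j x) \<in> carrier (E i)"
      using mod_hom_closed[OF D(6) mod_hom_closed[OF t(1)[of j], of x]] xc Suc by simp
    ultimately show ?thesis
      using Suc abelian_group.minus_eq_zero_iff[OF module.axioms(2)[OF D(3)[of i]]] mod_hom_closed[OF \<delta> xc]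
      by (auto simp: coboundaries_def annihilated_complex_def)
  qed
  then show ?thesis by (simp add: \<delta>_def)
qed

section \<open>Ext of a residue ring\<close>

lemma Hom_module_simps [simp]:
  "carrier (Hom_module R A N) = mod_hom R A N \<inter> extensional (carrier A)"
  "zero (Hom_module R A N) = (\<lambda>x\<in>carrier A. \<zero>\<^bsub>N\<^esub>)"
  "add (Hom_module R A N) = (\<lambda>g h. \<lambda>x\<in>carrier A. g x \<oplus>\<^bsub>N\<^esub> h x)"
  "smult (Hom_module R A N) = (\<lambda>a h. \<lambda>x\<in>carrier A. a \<odot>\<^bsub>N\<^esub> h x)"
  by (simp_all add: Hom_module_def)

lemma mod_hom_restrict:
  assumes "module R A" "h \<in> mod_hom R A N"
  shows "restrict h (carrier A) \<in> mod_hom R A N"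
proof -
  interpret A: module R A by fact
  show ?thesis
    by (rule mod_homI)
      (auto simp: mod_hom_closed[OF assms(2)] mod_hom_add[OF assms(2)] mod_hom_smult[OF assms(2)])
qed

text \<open>Every axiom holds pointwise in \<open>N\<close>; extensionality off the carrier of
  \<open>A\<close> turns pointwise agreement into equality of functions.\<close>

lemma module_Hom_module:
  assumes A: "module R A" and N: "module R N"
  shows "module R (Hom_module R A N)"
proof -
  interpret A: module R A by fact
  interpret N: module R N by fact
  have cl: "h \<in> mod_hom R A N \<Longrightarrow> x \<in> carrier A \<Longrightarrow> h x \<in> carrier N" for h x
    by (rule mod_hom_closed)
  have add: "(\<lambda>x. g x \<oplus>\<^bsub>N\<^esub> h x) \<in> mod_hom R A N" if "g \<in> mod_hom R A N" "h \<in> mod_hom R A N" for g h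
    by (rule mod_homI) (use that in \<open>auto simp: cl mod_hom_add[OF that(1)] mod_hom_add[OF that(2)]
        mod_hom_smult[OF that(1)] mod_hom_smult[OF that(2)] N.smult_r_distr N.M.a_ac\<close>)
  \<comment> \<open>Linearity of \<open>a h\<close> is where commutativity of \<open>R\<close>
    enters: \<open>a\<close> and the scalar from the argument change places.\<close>
  have smult: "(\<lambda>x. a \<odot>\<^bsub>N\<^esub> h x) \<in> mod_hom R A N" if "a \<in> carrier R" "h \<in> mod_hom R A N" for a h
    by (rule mod_homI) (use that in \<open>auto simp: cl mod_hom_add[OF that(2)] mod_hom_smult[OF that(2)]
        N.smult_r_distr A.R.m_comm simp flip: N.smult_assoc1\<close>)
  have zero: "(\<lambda>x. \<zero>\<^bsub>N\<^esub>) \<in> mod_hom R A N" by (rule mod_homI) auto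
  let ?H = "Hom_module R A N"
  have add': "g \<oplus>\<^bsub>?H\<^esub> h \<in> carrier ?H" if "g \<in> carrier ?H" "h \<in> carrier ?H" for g h
    using that by (simp add: mod_hom_restrict[OF A] add)
  have smult': "a \<odot>\<^bsub>?H\<^esub> h \<in> carrier ?H" if "a \<in> carrier R" "h \<in> carrier ?H" for a h
    using that by (simp add: mod_hom_restrict[OF A] smult)
  have zero': "\<zero>\<^bsub>?H\<^esub> \<in> carrier ?H" by (simp add: mod_hom_restrict[OF A] zero)
  have eqI: "g = h" if "g \<in> carrier ?H" "h \<in> carrier ?H" "\<And>x. x \<in> carrier A \<Longrightarrow> g x = h x" for g h
    using that by (auto intro: extensionalityI)
  have cl': "h x \<in> carrier N" if "h \<in> carrier ?H" "x \<in> carrier A" for h x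
    using that cl by simp
  note simps = Hom_module_simps(2-4) restrict_apply' cl'
  show ?thesis
  proof (rule moduleI)
    show "cring R" by (rule A.R.is_cring)
    show "abelian_group ?H"
    proof (rule abelian_groupI)
      show "g \<oplus>\<^bsub>?H\<^esub> h \<oplus>\<^bsub>?H\<^esub> k = g \<oplus>\<^bsub>?H\<^esub> (h \<oplus>\<^bsub>?H\<^esub> k)"
        if g: "g \<in> carrier ?H" and h: "h \<in> carrier ?H" and k: "k \<in> carrier ?H" for g h k
        by (rule eqI[OF add'[OF add'[OF g h] k] add'[OF g add'[OF h k]]])
          (use g h k in \<open>simp only: simps N.M.a_assoc\<close>)
      show "g \<oplus>\<^bsub>?H\<^esub> h = h \<oplus>\<^bsub>?H\<^esub> g"
        if g: "g \<in> carrier ?H" and h: "h \<in> carrier ?H" for g h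
        by (rule eqI[OF add'[OF g h] add'[OF h g]]) (use g h in \<open>simp only: simps N.M.a_comm\<close>)
      show "\<zero>\<^bsub>?H\<^esub> \<oplus>\<^bsub>?H\<^esub> h = h"
        if h: "h \<in> carrier ?H" for h
        by (rule eqI[OF add'[OF zero' h] h]) (use h in \<open>simp only: simps N.M.l_zero\<close>)
      show "\<exists>g\<in>carrier ?H. g \<oplus>\<^bsub>?H\<^esub> h = \<zero>\<^bsub>?H\<^esub>"
        if h: "h \<in> carrier ?H" for h
      proof (rule bexI)
        have one: "\<ominus>\<^bsub>R\<^esub> \<one>\<^bsub>R\<^esub> \<in> carrier R" by simp
        show neg: "(\<ominus>\<^bsub>R\<^esub> \<one>\<^bsub>R\<^esub>) \<odot>\<^bsub>?H\<^esub> h \<in> carrier ?H" by (rule smult'[OF one h])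
        show "(\<ominus>\<^bsub>R\<^esub> \<one>\<^bsub>R\<^esub>) \<odot>\<^bsub>?H\<^esub> h \<oplus>\<^bsub>?H\<^esub> h = \<zero>\<^bsub>?H\<^esub>"
          by (rule eqI[OF add'[OF neg h] zero'])
            (use h in \<open>simp only: simps N.uminus_eq_smult[symmetric] N.M.l_neg\<close>)
      qed
    qed (fact add' zero')+
  next
    show "(a \<oplus>\<^bsub>R\<^esub> b) \<odot>\<^bsub>?H\<^esub> g = a \<odot>\<^bsub>?H\<^esub> g \<oplus>\<^bsub>?H\<^esub> b \<odot>\<^bsub>?H\<^esub> g"
        if a: "a \<in> carrier R" and b: "b \<in> carrier R" and g: "g \<in> carrier ?H" for a b g
      by (rule eqI[OF smult'[OF A.R.a_closed[OF a b] g] add'[OF smult'[OF a g] smult'[OF b g]]])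
        (use a b g in \<open>simp only: simps N.smult_l_distr\<close>)
    show "a \<odot>\<^bsub>?H\<^esub> (g \<oplus>\<^bsub>?H\<^esub> h) = a \<odot>\<^bsub>?H\<^esub> g \<oplus>\<^bsub>?H\<^esub> a \<odot>\<^bsub>?H\<^esub> h"
        if a: "a \<in> carrier R" and g: "g \<in> carrier ?H" and h: "h \<in> carrier ?H" for a g h
      by (rule eqI[OF smult'[OF a add'[OF g h]] add'[OF smult'[OF a g] smult'[OF a h]]])
        (use a g h in \<open>simp only: simps N.smult_r_distr\<close>)
    show "(a \<otimes>\<^bsub>R\<^esub> b) \<odot>\<^bsub>?H\<^esub> g = a \<odot>\<^bsub>?H\<^esub> (b \<odot>\<^bsub>?H\<^esub> g)"
        if a: "a \<in> carrier R" and b: "b \<in> carrier R" and g: "g \<in> carrier ?H" for a b g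
      by (rule eqI[OF smult'[OF A.R.m_closed[OF a b] g] smult'[OF a smult'[OF b g]]])
        (use a b g in \<open>simp only: simps N.smult_assoc1\<close>)
    show "\<one>\<^bsub>R\<^esub> \<odot>\<^bsub>?H\<^esub> g = g"
        if g: "g \<in> carrier ?H" for g
      by (rule eqI[OF smult'[OF A.R.one_closed g] g]) (use g in \<open>simp only: simps N.smult_one\<close>)
  qed (fact smult')
qed

lemma Hom_module_map:
  assumes A: "module R A" and d: "d \<in> mod_hom R N P"
  shows "compose (carrier A) d \<in> mod_hom R (Hom_module R A N) (Hom_module R A P)"
proof -
  interpret A: module R A by fact
  show ?thesis
    by (rule mod_homI)
      (auto simp: compose_def restrict_def fun_eq_iff extensional_def mod_hom_add[OF d] mod_hom_smult[OF d]
        mod_hom_closed intro!: mod_hom_restrict[OF A, unfolded restrict_def] mod_hom_comp[OF _ d])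
qed

section \<open>Homomorphisms out of R/I\<close>

lemma residue_module_simps [simp]:
  "carrier (residue_module R I) = a_rcosets\<^bsub>R\<^esub> I"
  "zero (residue_module R I) = I"
  "add (residue_module R I) = set_add R"
  by (simp_all add: residue_module_def FactRing_def)

lemma (in ideal) residue_module_smult:
  "a \<in> carrier R \<Longrightarrow> b \<in> carrier R \<Longrightarrow> a \<odot>\<^bsub>residue_module R I\<^esub> (I +> b) = I +> (a \<otimes> b)"
  by (simp add: residue_module_def FactRing_def rcoset_mult_add)

lemma (in ideal) residue_module_elem:
  assumes "X \<in> a_rcosets I"
  obtains a where "a \<in> carrier R" "X = I +> a"
  using assms by (auto simp: A_RCOSETS_def')

lemma (in ideal) module_residue_module:
  assumes "cring R"
  shows "module R (residue_module R I)"
proof (rule moduleI)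
  show "cring R" by fact
  interpret Q: ring "R Quot I" by (rule quotient_is_ring)
  show "abelian_group (residue_module R I)"
  proof (rule abelian_groupI)
    show "\<exists>Y\<in>carrier (residue_module R I). Y \<oplus>\<^bsub>residue_module R I\<^esub> X = \<zero>\<^bsub>residue_module R I\<^esub>"
      if "X \<in> carrier (residue_module R I)" for X
      using that Q.l_neg[of X] Q.a_inv_closed[of X]
      by (intro bexI[of _ "\<ominus>\<^bsub>R Quot I\<^esub> X"]) (simp_all add: FactRing_def)
  qed (use Q.a_closed Q.zero_closed Q.a_assoc Q.a_comm Q.l_zero in \<open>simp_all add: FactRing_def\<close>)
qed (auto elim!: residue_module_elem simp: residue_module_smult a_rcos_sum l_distr r_distr m_assoc
    a_rcosetsI[OF a_subset])

text \<open>Evaluation at the class of \<open>1\<close> identifies \<open>Hom(R / I, N)\<close> with the part of \<open>N\<close> killed by \<open>I\<close>.\<close>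

lemma (in ideal) Hom_residue_eval:
  assumes "cring R" and N: "module R N" and h: "h \<in> mod_hom R (residue_module R I) N"
  shows "h (I +> \<one>) \<in> annihilated N I"
    and "a \<in> carrier R \<Longrightarrow> h (I +> a) = a \<odot>\<^bsub>N\<^esub> h (I +> \<one>)"
proof -
  show sm: "h (I +> a) = a \<odot>\<^bsub>N\<^esub> h (I +> \<one>)" if "a \<in> carrier R" for a
    using mod_hom_smult[OF h, of a "I +> \<one>"] that
    by (simp add: residue_module_smult a_rcosetsI[OF a_subset])
  have "a \<odot>\<^bsub>N\<^esub> h (I +> \<one>) = \<zero>\<^bsub>N\<^esub>" if "a \<in> I" for a
    using sm[of a] mod_hom_zero[OF module_residue_module[OF assms(1)] N h] that
    by (simp add: a_rcos_const)
  moreover have "h (I +> \<one>) \<in> carrier N"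
    using mod_hom_closed[OF h] by (simp add: a_rcosetsI[OF a_subset])
  ultimately show "h (I +> \<one>) \<in> annihilated N I" by (simp add: annihilated_def)
qed

text \<open>\<open>R / I\<close> is cyclic, generated by the class of 1, so one value fixes a
  homomorphism; equality of functions then follows by extensionality.\<close>

lemma (in ideal) Hom_residue_eqI:
  assumes "cring R" "module R N"
    and "g \<in> carrier (Hom_module R (residue_module R I) N)"
    and "h \<in> carrier (Hom_module R (residue_module R I) N)"
    and "g (I +> \<one>) = h (I +> \<one>)"
  shows "g = h"
proof (rule extensionalityI[of _ "a_rcosets I"])
  show "g X = h X" if "X \<in> a_rcosets I" for X
    using that
  proof (rule residue_module_elem)
    fix a assume "a \<in> carrier R" "X = I +> a"
    then show "g X = h X"
      using assms Hom_residue_eval(2)[OF assms(1,2), of g a] Hom_residue_eval(2)[OF assms(1,2), of h a] by simp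
  qed
qed (use assms in auto)

text \<open>Sending the class of \<open>a\<close> to \<open>a y\<close> is well defined because
  \<open>I\<close> kills \<open>y\<close>. The graph goes through \<open>partial_hom\<close>, which
  extracts a function without choosing coset representatives.\<close>

lemma (in ideal) Hom_residue_exists:
  assumes R: "cring R" and N: "module R N" and y: "y \<in> annihilated N I"
  obtains h where "h \<in> carrier (Hom_module R (residue_module R I) N)" "h (I +> \<one>) = y"
proof -
  let ?K = "residue_module R I"
  have K: "module R ?K" by (rule module_residue_module[OF R])
  interpret K: module R ?K by fact
  interpret N: module R N by fact
  have yc: "y \<in> carrier N" using y by (simp add: annihilated_def)
  define G where "G = (\<lambda>a. (I +> a, a \<odot>\<^bsub>N\<^esub> y)) ` carrier R"
  have "partial_hom R ?K N G"
  proof unfold_locales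
    show "G \<subseteq> carrier ?K \<times> carrier N" using yc by (auto simp: G_def a_rcosetsI[OF a_subset])
    show "(\<zero>\<^bsub>?K\<^esub>, \<zero>\<^bsub>N\<^esub>) \<in> G"
      using yc by (auto simp: G_def a_rcos_const intro!: image_eqI[of _ _ \<zero>])
  next
    fix x z x' z' assume "(x, z) \<in> G" "(x', z') \<in> G"
    then obtain a b where "a \<in> carrier R" "x = I +> a" "z = a \<odot>\<^bsub>N\<^esub> y"
      "b \<in> carrier R" "x' = I +> b" "z' = b \<odot>\<^bsub>N\<^esub> y" by (auto simp: G_def)
    then show "(x \<oplus>\<^bsub>?K\<^esub> x', z \<oplus>\<^bsub>N\<^esub> z') \<in> G"
      using yc by (auto simp: G_def a_rcos_sum N.smult_l_distr intro!: image_eqI[of _ _ "a \<oplus> b"])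
  next
    fix r x z assume "r \<in> carrier R" "(x, z) \<in> G"
    then obtain a where "a \<in> carrier R" "x = I +> a" "z = a \<odot>\<^bsub>N\<^esub> y" by (auto simp: G_def)
    with \<open>r \<in> carrier R\<close> show "(r \<odot>\<^bsub>?K\<^esub> x, r \<odot>\<^bsub>N\<^esub> z) \<in> G"
      using yc by (auto simp: G_def residue_module_smult N.smult_assoc1 intro!: image_eqI[of _ _ "r \<otimes> a"])
  next
    fix z assume "(\<zero>\<^bsub>?K\<^esub>, z) \<in> G"
    then obtain a where a: "a \<in> carrier R" "I = I +> a" "z = a \<odot>\<^bsub>N\<^esub> y" by (auto simp: G_def)
    then have "a \<in> I" using a_rcos_self[of a] by simp
    then show "z = \<zero>\<^bsub>N\<^esub>" using y a by (simp add: annihilated_def)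
  qed
  then interpret G: partial_hom R ?K N G .
  have "\<exists>z. (X, z) \<in> G" if "X \<in> carrier ?K" for X
    using that by (auto simp: G_def elim!: residue_module_elem)
  then obtain h where h: "h \<in> mod_hom R ?K N" "\<And>X z. (X, z) \<in> G \<Longrightarrow> h X = z"
    using G.mod_hom_of_total by blast
  have "h (I +> \<one>) = y" by (rule h(2)) (use yc in \<open>auto simp: G_def intro!: image_eqI[of _ _ \<one>]\<close>)
  then show ?thesis
    using that[of "restrict h (carrier ?K)"] mod_hom_restrict[OF K h(1)] a_rcosetsI[OF a_subset, of \<one>] by simp
qed

text \<open>Carries coboundaries of the Hom complex over to the subcomplex killed by
  \<open>I\<close>: a preimage of the value at the class of 1 extends to a homomorphism, whose image
  agrees with \<open>h\<close> at the generator and hence everywhere.\<close>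

lemma (in ideal) Hom_residue_coboundaries:
  assumes R: "cring R" and E: "injective_resolution R M e E d"
    and h: "h \<in> carrier (Hom_module R (residue_module R I) (E i))"
  shows "h \<in> coboundaries (\<lambda>j. Hom_module R (residue_module R I) (E j))
             (\<lambda>j. compose (carrier (residue_module R I)) (d j)) i
    \<longleftrightarrow> h (I +> \<one>) \<in> coboundaries (annihilated_complex E I) d i"
proof (cases i)
  note D = injective_resolutionD[OF E]
  let ?K = "residue_module R I"
  have K: "module R ?K" by (rule module_residue_module[OF R])
  have one: "I +> \<one> \<in> a_rcosets I" by (simp add: a_rcosetsI[OF a_subset])
  case 0
  interpret H: module R "Hom_module R ?K (E i)" by (rule module_Hom_module[OF K D(3)])
  have "h = \<zero>\<^bsub>Hom_module R ?K (E 0)\<^esub> \<longleftrightarrow> h (I +> \<one>) = \<zero>\<^bsub>E 0\<^esub>"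
    using Hom_residue_eqI[OF R D(3) h H.M.zero_closed] one 0 by auto
  then show ?thesis using 0 by (simp add: coboundaries_def annihilated_complex_def)
next
  note D = injective_resolutionD[OF E]
  let ?K = "residue_module R I"
  have K: "module R ?K" by (rule module_residue_module[OF R])
  have one: "I +> \<one> \<in> a_rcosets I" by (simp add: a_rcosetsI[OF a_subset])
  case (Suc j)
  have dh: "compose (carrier ?K) (d j) \<in> mod_hom R (Hom_module R ?K (E j)) (Hom_module R ?K (E (Suc j)))"
    by (rule Hom_module_map[OF K D(6)])
  have "h \<in> compose (carrier ?K) (d j) ` carrier (Hom_module R ?K (E j))
    \<longleftrightarrow> h (I +> \<one>) \<in> d j ` annihilated (E j) I"
  proof
    assume "h \<in> compose (carrier ?K) (d j) ` carrier (Hom_module R ?K (E j))"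
    then obtain g where g: "g \<in> carrier (Hom_module R ?K (E j))" "h = compose (carrier ?K) (d j) g"
      by blast
    then show "h (I +> \<one>) \<in> d j ` annihilated (E j) I"
      using Hom_residue_eval(1)[OF R D(3)] one by (simp add: compose_def)
  next
    assume "h (I +> \<one>) \<in> d j ` annihilated (E j) I"
    then obtain y where y: "y \<in> annihilated (E j) I" "h (I +> \<one>) = d j y" by blast
    obtain g where g: "g \<in> carrier (Hom_module R ?K (E j))" "g (I +> \<one>) = y"
      by (rule Hom_residue_exists[OF R D(3) y(1)])
    have "h = compose (carrier ?K) (d j) g"
      by (rule Hom_residue_eqI[OF R D(3) h])
        (use mod_hom_closed[OF dh g(1)] y g one Suc in \<open>simp_all add: compose_def\<close>)
    then show "h \<in> compose (carrier ?K) (d j) ` carrier (Hom_module R ?K (E j))" using g by blast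
  qed
  then show ?thesis using Suc by (simp add: coboundaries_def annihilated_complex_def)
qed

text \<open>The composite is again a homomorphism on the cyclic module \<open>R / I\<close>, so its
  vanishing can be tested at the generator.\<close>

lemma (in ideal) Hom_residue_cocycle_iff:
  assumes R: "cring R" and E: "injective_resolution R M e E d"
    and h: "h \<in> carrier (Hom_module R (residue_module R I) (E i))"
  shows "compose (carrier (residue_module R I)) (d i) h = \<zero>\<^bsub>Hom_module R (residue_module R I) (E (Suc i))\<^esub>
    \<longleftrightarrow> d i (h (I +> \<one>)) = \<zero>\<^bsub>E (Suc i)\<^esub>"
proof -
  note D = injective_resolutionD[OF E]
  let ?K = "residue_module R I"
  have K: "module R ?K" by (rule module_residue_module[OF R])
  have one: "I +> \<one> \<in> a_rcosets I" by (simp add: a_rcosetsI[OF a_subset])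
  interpret H: module R "Hom_module R ?K (E (Suc i))" by (rule module_Hom_module[OF K D(3)])
  let ?c = "compose (carrier ?K) (d i) h" and ?z = "\<zero>\<^bsub>Hom_module R ?K (E (Suc i))\<^esub>"
  have "?c = ?z \<longleftrightarrow> ?c (I +> \<one>) = ?z (I +> \<one>)"
    using Hom_residue_eqI[OF R D(3)[of "Suc i"] mod_hom_closed[OF Hom_module_map[OF K D(6)] h] H.M.zero_closed]
    by metis
  also have "\<dots> \<longleftrightarrow> d i (h (I +> \<one>)) = \<zero>\<^bsub>E (Suc i)\<^esub>" using one by (simp add: compose_def)
  finally show ?thesis .
qed

text \<open>Evaluation at the class of 1 moves the Hom complex into \<open>E'\<close>, and
  \<open>\<phi>\<close> moves \<open>E\<close> there too. The round trip through \<open>E'\<close>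
  gives surjectivity, the one through \<open>E\<close> the kernel. The ideal \<open>I\<close> is
  arbitrary here.\<close>

theorem (in ideal) annihilated_cohomology_iso_Ext:
  assumes R: "cring R" and E: "injective_resolution R M e E d"
    and E': "injective_resolution R M e' E' d'"
  shows "mod_isomorphic R (cohomology (annihilated_complex E I) d i)
           (Ext_module R (residue_module R I) E' d' i)"
proof -
  note D = injective_resolutionD[OF E] and D' = injective_resolutionD[OF E']
  let ?K = "residue_module R I" and ?B = "coboundaries (annihilated_complex E I) d i"
    and ?B' = "coboundaries (annihilated_complex E' I) d' i"
  let ?H = "\<lambda>j. Hom_module R ?K (E' j)" and ?c = "\<lambda>j. compose (carrier ?K) (d' j)"
  let ?Z = "{x \<in> annihilated (E i) I. d i x = \<zero>\<^bsub>E (Suc i)\<^esub>}"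
  let ?W = "{h \<in> carrier (?H i). ?c i h = \<zero>\<^bsub>?H (Suc i)\<^esub>}"
  have K: "module R ?K" by (rule module_residue_module[OF R])
  interpret E: module R "E i" by (rule D(3))
  interpret E': module R "E' i" by (rule D'(3))
  interpret H: module R "?H i" by (rule module_Hom_module[OF K D'(3)])
  have one: "I +> \<one> \<in> a_rcosets I" by (simp add: a_rcosetsI[OF a_subset])
  have IR: "I \<subseteq> carrier R" by (rule a_subset)
  obtain \<phi> where \<phi>: "resolution_map R M e E d e' E' d' \<phi>" using resolution_map_exists[OF E E'] by blast
  obtain \<psi> where \<psi>: "resolution_map R M e' E' d' e E d \<psi>" using resolution_map_exists[OF E' E] by blast
  have \<phi>h: "\<phi> i \<in> mod_hom R (E i) (E' i)" and \<psi>h: "\<psi> i \<in> mod_hom R (E' i) (E i)"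
    and \<phi>d: "z \<in> carrier (E i) \<Longrightarrow> \<phi> (Suc i) (d i z) = d' i (\<phi> i z)"
    and \<psi>d: "w \<in> carrier (E' i) \<Longrightarrow> \<psi> (Suc i) (d' i w) = d i (\<psi> i w)" for i z w
    using \<phi> \<psi> by (auto simp: resolution_map_def)
  have Zc: "x \<in> carrier (E i)" if "x \<in> ?Z" for x using that by (simp add: annihilated_def)
  have Wc: "h (I +> \<one>) \<in> carrier (E' i)" if "h \<in> ?W" for h
    using that Hom_residue_eval(1)[OF R D'(3)] by (auto simp: annihilated_def)
  have BZ: "?B \<subseteq> ?Z"
  proof (cases i)
    case 0
    have "submodule (annihilated (E 0) I) R (E 0)" by (rule module.annihilated_submodule[OF D(3) IR])
    then show ?thesis using 0 E.submodule_zero mod_hom_zero[OF D(3) D(3) D(6)]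
      by (auto simp: coboundaries_def annihilated_complex_def)
  next
    case (Suc j)
    then show ?thesis using mod_hom_annihilated[OF D(3) D(3) D(6) IR] D(8)
      by (auto simp: coboundaries_def annihilated_complex_def annihilated_def[of "E j"])
  qed
  have subZ: "submodule ?Z R (E i)"
  proof -
    have "?Z = annihilated (E i) I \<inter> {x \<in> carrier (E i). d i x = \<zero>\<^bsub>E (Suc i)\<^esub>}"
      by (auto simp: annihilated_def)
    moreover have "submodule (annihilated (E i) I) R (E i)" by (rule E.annihilated_submodule[OF IR])
    moreover have "submodule {x \<in> carrier (E i). d i x = \<zero>\<^bsub>E (Suc i)\<^esub>} R (E i)"
      by (rule E.submodule_kernel[OF D(3) D(6)])
    ultimately show ?thesis using E.submodule_Int by simp
  qed
  have subW: "submodule ?W R (?H i)"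
    using H.submodule_kernel[OF module_Hom_module[OF K D'(3)] Hom_module_map[OF K D'(6)]] .
  have subB': "submodule ?B' R (E' i)" by (rule coboundaries_annihilated_submodule[OF E' IR])
  have subB: "submodule ?B R (E i)" by (rule coboundaries_annihilated_submodule[OF E IR])
  \<comment> \<open>\<open>x\<close> and \<open>h\<close> are related when \<open>\<phi> i x\<close>
    and the value of \<open>h\<close> at the class of 1 are cohomologous among the elements of
    \<open>E'\<close> killed by \<open>I\<close>.\<close>
  define P where "P x h \<longleftrightarrow> x \<in> ?Z \<and> h \<in> ?W \<and> \<phi> i x \<ominus>\<^bsub>E' i\<^esub> h (I +> \<one>) \<in> ?B'" for x h
  have "mod_isomorphic R (quotient_module ((E i)\<lparr>carrier := ?Z\<rparr>) ?B)
      (quotient_module ((?H i)\<lparr>carrier := ?W\<rparr>) (coboundaries ?H ?c i))"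
  proof (rule quotient_iso_of_relation[where P = P])
    show "module R ((E i)\<lparr>carrier := ?Z\<rparr>)" by (rule submodule.submodule_is_module[OF subZ D(3)])
    show "module R ((?H i)\<lparr>carrier := ?W\<rparr>)"
      by (rule submodule.submodule_is_module[OF subW module_Hom_module[OF K D'(3)]])
  next
    show "x \<in> carrier ((E i)\<lparr>carrier := ?Z\<rparr>) \<and> h \<in> carrier ((?H i)\<lparr>carrier := ?W\<rparr>)" if "P x h" for x h
      using that by (simp add: P_def)
  next
    fix x h x' h' assume P: "P x h" "P x' h'"
    then have Z: "x \<in> ?Z" "x' \<in> ?Z" and W: "h \<in> ?W" "h' \<in> ?W" by (auto simp: P_def)
    have "(\<phi> i x \<ominus>\<^bsub>E' i\<^esub> h (I +> \<one>)) \<oplus>\<^bsub>E' i\<^esub> (\<phi> i x' \<ominus>\<^bsub>E' i\<^esub> h' (I +> \<one>)) \<in> ?B'"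
      using P E'.submoduleE(5)[OF subB'] by (auto simp: P_def)
    also have "(\<phi> i x \<ominus>\<^bsub>E' i\<^esub> h (I +> \<one>)) \<oplus>\<^bsub>E' i\<^esub> (\<phi> i x' \<ominus>\<^bsub>E' i\<^esub> h' (I +> \<one>))
      = \<phi> i (x \<oplus>\<^bsub>E i\<^esub> x') \<ominus>\<^bsub>E' i\<^esub> (h (I +> \<one>) \<oplus>\<^bsub>E' i\<^esub> h' (I +> \<one>))"
      using mod_hom_closed[OF \<phi>h Zc[OF Z(1)]] mod_hom_closed[OF \<phi>h Zc[OF Z(2)]] Wc[OF W(1)] Wc[OF W(2)]
      by (simp add: mod_hom_add[OF \<phi>h Zc[OF Z(1)] Zc[OF Z(2)]] a_minus_def E'.M.minus_add E'.M.a_ac)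
    finally have "\<phi> i (x \<oplus>\<^bsub>E i\<^esub> x') \<ominus>\<^bsub>E' i\<^esub> (h \<oplus>\<^bsub>?H i\<^esub> h') (I +> \<one>) \<in> ?B'"
      using one by simp
    then show "P (x \<oplus>\<^bsub>(E i)\<lparr>carrier := ?Z\<rparr>\<^esub> x') (h \<oplus>\<^bsub>(?H i)\<lparr>carrier := ?W\<rparr>\<^esub> h')"
      using E.submoduleE(5)[OF subZ Z] H.submoduleE(5)[OF subW W] by (simp add: P_def)
  next
    fix r x h assume r: "r \<in> carrier R" and P: "P x h"
    then have Z: "x \<in> ?Z" and W: "h \<in> ?W" by (auto simp: P_def)
    have "r \<odot>\<^bsub>E' i\<^esub> (\<phi> i x \<ominus>\<^bsub>E' i\<^esub> h (I +> \<one>)) \<in> ?B'"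
      using P r E'.submoduleE(4)[OF subB'] by (auto simp: P_def)
    also have "r \<odot>\<^bsub>E' i\<^esub> (\<phi> i x \<ominus>\<^bsub>E' i\<^esub> h (I +> \<one>))
        = \<phi> i (r \<odot>\<^bsub>E i\<^esub> x) \<ominus>\<^bsub>E' i\<^esub> (r \<odot>\<^bsub>E' i\<^esub> h (I +> \<one>))"
      using mod_hom_closed[OF \<phi>h Zc[OF Z]] Wc[OF W] r
      by (simp add: mod_hom_smult[OF \<phi>h r Zc[OF Z]] a_minus_def E'.smult_r_distr E'.smult_r_minus)
    finally have "\<phi> i (r \<odot>\<^bsub>E i\<^esub> x) \<ominus>\<^bsub>E' i\<^esub> (r \<odot>\<^bsub>?H i\<^esub> h) (I +> \<one>) \<in> ?B'"
      using one by simp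
    then show "P (r \<odot>\<^bsub>(E i)\<lparr>carrier := ?Z\<rparr>\<^esub> x) (r \<odot>\<^bsub>(?H i)\<lparr>carrier := ?W\<rparr>\<^esub> h)"
      using E.submoduleE(4)[OF subZ r Z] H.submoduleE(4)[OF subW r W] by (simp add: P_def)
  next
    fix x assume "x \<in> carrier ((E i)\<lparr>carrier := ?Z\<rparr>)"
    then have x: "x \<in> ?Z" by simp
    have y: "\<phi> i x \<in> annihilated (E' i) I" using mod_hom_annihilated[OF D(3) D'(3) \<phi>h IR] x by simp
    obtain h where h: "h \<in> carrier (?H i)" "h (I +> \<one>) = \<phi> i x"
      by (rule Hom_residue_exists[OF R D'(3) y])
    have "d' i (\<phi> i x) = \<zero>\<^bsub>E' (Suc i)\<^esub>"
      using \<phi>d[OF Zc[OF x]] x mod_hom_zero[OF D(3) D'(3) \<phi>h] by simp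
    then have "h \<in> ?W" using Hom_residue_cocycle_iff[OF R E' h(1)] h by simp
    moreover have "\<phi> i x \<ominus>\<^bsub>E' i\<^esub> h (I +> \<one>) = \<zero>\<^bsub>E' i\<^esub>"
      using h(2) y E'.M.minus_eq_zero_iff by (simp add: annihilated_def)
    ultimately have "P x h" using x E'.submodule_zero[OF subB'] by (simp add: P_def)
    then show "\<exists>h. P x h" by blast
  next
    fix h assume "h \<in> carrier ((?H i)\<lparr>carrier := ?W\<rparr>)"
    then have h: "h \<in> ?W" by simp
    let ?y = "h (I +> \<one>)"
    have y: "?y \<in> annihilated (E' i) I" "d' i ?y = \<zero>\<^bsub>E' (Suc i)\<^esub>"
      using h Hom_residue_eval(1)[OF R D'(3)] Hom_residue_cocycle_iff[OF R E'] by auto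
    have "\<psi> i ?y \<in> ?Z"
      using mod_hom_annihilated[OF D'(3) D(3) \<psi>h IR y(1)] \<psi>d[OF Wc[OF h]] y(2)
        mod_hom_zero[OF D'(3) D(3) \<psi>h] by simp
    moreover have "\<phi> i (\<psi> i ?y) \<ominus>\<^bsub>E' i\<^esub> ?y \<in> ?B'"
      by (rule resolution_map_roundtrip[OF E' E \<psi> \<phi> IR y])
    ultimately have "P (\<psi> i ?y) h" using h by (simp add: P_def)
    then show "\<exists>x. P x h" by blast
  next
    fix x
    show "x \<in> ?B \<longleftrightarrow> P x \<zero>\<^bsub>(?H i)\<lparr>carrier := ?W\<rparr>\<^esub>"
    proof
      assume x: "x \<in> ?B"
      then have xZ: "x \<in> ?Z" using BZ by blast
      have "\<phi> i x \<ominus>\<^bsub>E' i\<^esub> \<zero>\<^bsub>E' i\<^esub> \<in> ?B'"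
        using E'.submodule_minus[OF subB' resolution_map_coboundaries[OF E E' \<phi> IR x] E'.submodule_zero[OF subB']] .
      then show "P x \<zero>\<^bsub>(?H i)\<lparr>carrier := ?W\<rparr>\<^esub>"
        using H.submodule_zero[OF subW] xZ one by (simp add: P_def)
    next
      assume "P x \<zero>\<^bsub>(?H i)\<lparr>carrier := ?W\<rparr>\<^esub>"
      then have x: "x \<in> ?Z" and "\<phi> i x \<ominus>\<^bsub>E' i\<^esub> \<zero>\<^bsub>E' i\<^esub> \<in> ?B'"
        using one by (auto simp: P_def)
      then have "\<phi> i x \<in> ?B'"
        using mod_hom_closed[OF \<phi>h Zc[OF x]] by (simp add: a_minus_def E'.M.minus_of_zero)
      \<comment> \<open>Both \<open>\<psi> (\<phi> x)\<close> and
        \<open>\<psi> (\<phi> x) - x\<close> are coboundaries, hence so is their difference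
        \<open>x\<close>.\<close>
      then have 1: "\<psi> i (\<phi> i x) \<in> ?B" by (rule resolution_map_coboundaries[OF E' E \<psi> IR])
      have 2: "\<psi> i (\<phi> i x) \<ominus>\<^bsub>E i\<^esub> x \<in> ?B"
        using resolution_map_roundtrip[OF E E' \<phi> \<psi> IR] x by simp
      have "\<psi> i (\<phi> i x) \<ominus>\<^bsub>E i\<^esub> (\<psi> i (\<phi> i x) \<ominus>\<^bsub>E i\<^esub> x) = x"
        using mod_hom_closed[OF \<psi>h mod_hom_closed[OF \<phi>h Zc[OF x]]] Zc[OF x]
        by (simp add: a_minus_def E.M.minus_add E.M.r_neg1 E.M.a_ac E.M.r_neg2 E.M.r_neg)
      then show "x \<in> ?B" using E.submodule_minus[OF subB 1 2] by simp
    qed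
  next
    fix h
    show "h \<in> coboundaries ?H ?c i \<longleftrightarrow> P \<zero>\<^bsub>(E i)\<lparr>carrier := ?Z\<rparr>\<^esub> h"
    proof
      assume hB: "h \<in> coboundaries ?H ?c i"
      have hW: "h \<in> ?W"
      proof (cases i)
        case 0
        then show ?thesis using hB H.submodule_zero[OF subW] by (simp add: coboundaries_def)
      next
        case (Suc j)
        then obtain g where g: "g \<in> carrier (?H j)" "h = ?c j g" using hB by (auto simp: coboundaries_def)
        have hc: "h \<in> carrier (?H i)" using g mod_hom_closed[OF Hom_module_map[OF K D'(6)] g(1)] Suc by simp
        have "g (I +> \<one>) \<in> carrier (E' j)"
          using Hom_residue_eval(1)[OF R D'(3)] g by (auto simp: annihilated_def)
        then have "d' i (h (I +> \<one>)) = \<zero>\<^bsub>E' (Suc i)\<^esub>"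
          using g D'(8) one Suc by (simp add: compose_def)
        then show ?thesis using Hom_residue_cocycle_iff[OF R E' hc] hc by simp
      qed
      then have "h (I +> \<one>) \<in> ?B'" using hB Hom_residue_coboundaries[OF R E'] by auto
      then have "\<phi> i \<zero>\<^bsub>E i\<^esub> \<ominus>\<^bsub>E' i\<^esub> h (I +> \<one>) \<in> ?B'"
        using E'.submodule_minus[OF subB' E'.submodule_zero[OF subB']]
        by (simp add: mod_hom_zero[OF D(3) D'(3) \<phi>h])
      then show "P \<zero>\<^bsub>(E i)\<lparr>carrier := ?Z\<rparr>\<^esub> h" using hW E.submodule_zero[OF subZ] by (simp add: P_def)
    next
      assume P: "P \<zero>\<^bsub>(E i)\<lparr>carrier := ?Z\<rparr>\<^esub> h"
      then have W: "h \<in> ?W" and "\<zero>\<^bsub>E' i\<^esub> \<ominus>\<^bsub>E' i\<^esub> h (I +> \<one>) \<in> ?B'"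
        by (auto simp: P_def mod_hom_zero[OF D(3) D'(3) \<phi>h])
      then have "\<ominus>\<^bsub>E' i\<^esub> (\<zero>\<^bsub>E' i\<^esub> \<ominus>\<^bsub>E' i\<^esub> h (I +> \<one>)) \<in> ?B'" using E'.submoduleE(3)[OF subB'] by blast
      then have "h (I +> \<one>) \<in> ?B'" using Wc[OF W] by (simp add: a_minus_def)
      then show "h \<in> coboundaries ?H ?c i" using Hom_residue_coboundaries[OF R E'] W by auto
    qed
  qed
  then show ?thesis
    by (simp add: cohomology_def Ext_module_def cocycles_def annihilated_complex_def)
qed

section \<open>Localization\<close>

locale module_mult_set = module R M
  for R :: "('a, 'r) ring_scheme" and M :: "('a, 'b, 'm) module_scheme" +
  fixes S :: "'a set"
  assumes S_sub: "S \<subseteq> carrier R" and S_one: "\<one>\<^bsub>R\<^esub> \<in> S"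
    and S_mult: "\<And>s t. s \<in> S \<Longrightarrow> t \<in> S \<Longrightarrow> s \<otimes>\<^bsub>R\<^esub> t \<in> S"
begin

lemma S_carr: "s \<in> S \<Longrightarrow> s \<in> carrier R"
  using S_sub by blast

lemma smult_mono_eq:
  assumes "a \<odot>\<^bsub>M\<^esub> x = b \<odot>\<^bsub>M\<^esub> y" "a \<in> carrier R" "b \<in> carrier R" "c \<in> carrier R"
    "x \<in> carrier M" "y \<in> carrier M"
  shows "(c \<otimes>\<^bsub>R\<^esub> a) \<odot>\<^bsub>M\<^esub> x = (c \<otimes>\<^bsub>R\<^esub> b) \<odot>\<^bsub>M\<^esub> y"
  using assms by (simp add: smult_assoc1)

text \<open>Collects all scalars into one factor in front of the module element, so that
  rearrangements become commutative ring identities.\<close>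

lemma loc_rel_iff:
  "((x, s), (y, t)) \<in> loc_rel M S \<longleftrightarrow> x \<in> carrier M \<and> s \<in> S \<and> y \<in> carrier M \<and> t \<in> S \<and>
     (\<exists>u\<in>S. (u \<otimes>\<^bsub>R\<^esub> t) \<odot>\<^bsub>M\<^esub> x = (u \<otimes>\<^bsub>R\<^esub> s) \<odot>\<^bsub>M\<^esub> y)"
  using S_carr by (auto simp: loc_rel_def smult_assoc1)

lemma equiv_loc_rel: "equiv (carrier M \<times> S) (loc_rel M S)"
proof (rule equivI)
  show "loc_rel M S \<subseteq> (carrier M \<times> S) \<times> (carrier M \<times> S)" by (auto simp: loc_rel_def)
  show "refl_on (carrier M \<times> S) (loc_rel M S)"
    using S_one by (auto simp: loc_rel_iff refl_on_def)
  show "sym (loc_rel M S)" by (rule symI) (auto simp: loc_rel_def, metis)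
  show "trans (loc_rel M S)"
  proof (rule transI)
    fix p q r assume "(p, q) \<in> loc_rel M S" "(q, r) \<in> loc_rel M S"
    moreover obtain x s y t z w where [simp]: "p = (x, s)" "q = (y, t)" "r = (z, w)"
      by (metis surj_pair)
    ultimately obtain u v where c: "x \<in> carrier M" "s \<in> S" "y \<in> carrier M" "t \<in> S" "z \<in> carrier M" "w \<in> S"
      and u: "u \<in> S" "(u \<otimes>\<^bsub>R\<^esub> t) \<odot>\<^bsub>M\<^esub> x = (u \<otimes>\<^bsub>R\<^esub> s) \<odot>\<^bsub>M\<^esub> y"
      and v: "v \<in> S" "(v \<otimes>\<^bsub>R\<^esub> w) \<odot>\<^bsub>M\<^esub> y = (v \<otimes>\<^bsub>R\<^esub> t) \<odot>\<^bsub>M\<^esub> z"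
      by (auto simp: loc_rel_iff)
    note cr = c(1,3,5) c(2,4,6)[THEN S_carr] u(1)[THEN S_carr] v(1)[THEN S_carr]
    \<comment> \<open>The equation for \<open>u\<close> is scaled by \<open>v w\<close> and the one
      for \<open>v\<close> by \<open>u s\<close>; they meet at \<open>y\<close>, and the witness for
      the composite is \<open>u v t\<close>.\<close>
    have "((v \<otimes>\<^bsub>R\<^esub> w) \<otimes>\<^bsub>R\<^esub> (u \<otimes>\<^bsub>R\<^esub> t)) \<odot>\<^bsub>M\<^esub> x = ((v \<otimes>\<^bsub>R\<^esub> w) \<otimes>\<^bsub>R\<^esub> (u \<otimes>\<^bsub>R\<^esub> s)) \<odot>\<^bsub>M\<^esub> y"
      by (rule smult_mono_eq[OF u(2)]) (use cr in auto)
    also have "\<dots> = ((u \<otimes>\<^bsub>R\<^esub> s) \<otimes>\<^bsub>R\<^esub> (v \<otimes>\<^bsub>R\<^esub> w)) \<odot>\<^bsub>M\<^esub> y"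
      using cr by (simp add: R.m_comm)
    also have "\<dots> = ((u \<otimes>\<^bsub>R\<^esub> s) \<otimes>\<^bsub>R\<^esub> (v \<otimes>\<^bsub>R\<^esub> t)) \<odot>\<^bsub>M\<^esub> z"
      by (rule smult_mono_eq[OF v(2)]) (use cr in auto)
    finally have "((u \<otimes>\<^bsub>R\<^esub> v \<otimes>\<^bsub>R\<^esub> t) \<otimes>\<^bsub>R\<^esub> w) \<odot>\<^bsub>M\<^esub> x = ((u \<otimes>\<^bsub>R\<^esub> v \<otimes>\<^bsub>R\<^esub> t) \<otimes>\<^bsub>R\<^esub> s) \<odot>\<^bsub>M\<^esub> z"
      using cr by (simp add: R.m_ac)
    then show "(p, r) \<in> loc_rel M S" using c S_mult u(1) v(1) by (auto simp: loc_rel_iff)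
  qed
qed

lemma loc_frac_eq_iff:
  assumes "x \<in> carrier M" "s \<in> S" "y \<in> carrier M" "t \<in> S"
  shows "loc_frac M S x s = loc_frac M S y t
    \<longleftrightarrow> (\<exists>u\<in>S. (u \<otimes>\<^bsub>R\<^esub> t) \<odot>\<^bsub>M\<^esub> x = (u \<otimes>\<^bsub>R\<^esub> s) \<odot>\<^bsub>M\<^esub> y)"
  using eq_equiv_class_iff[OF equiv_loc_rel, of "(x, s)" "(y, t)"] assms
  by (simp add: loc_frac_def loc_rel_iff)

lemma loc_frac_eqI:
  assumes "x \<in> carrier M" "s \<in> S" "y \<in> carrier M" "t \<in> S" "t \<odot>\<^bsub>M\<^esub> x = s \<odot>\<^bsub>M\<^esub> y"
  shows "loc_frac M S x s = loc_frac M S y t"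
  using assms S_one S_carr by (auto simp: loc_frac_eq_iff intro!: bexI[of _ "\<one>\<^bsub>R\<^esub>"])

lemma mem_loc_frac:
  "(y, t) \<in> loc_frac M S x s \<longleftrightarrow> x \<in> carrier M \<and> s \<in> S \<and> y \<in> carrier M \<and> t \<in> S \<and>
     (\<exists>u\<in>S. (u \<otimes>\<^bsub>R\<^esub> t) \<odot>\<^bsub>M\<^esub> x = (u \<otimes>\<^bsub>R\<^esub> s) \<odot>\<^bsub>M\<^esub> y)"
  by (simp add: loc_frac_def loc_rel_iff)

lemma loc_frac_self: "x \<in> carrier M \<Longrightarrow> s \<in> S \<Longrightarrow> (x, s) \<in> loc_frac M S x s"
  using S_one by (auto simp: mem_loc_frac)

abbreviation (input) "L \<equiv> localization_module R S M"

lemma localization_carrier: "carrier L = {loc_frac M S x s | x s. x \<in> carrier M \<and> s \<in> S}"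
  by (auto simp: localization_module_def quotient_def loc_frac_def)

lemma localization_closed: "x \<in> carrier M \<Longrightarrow> s \<in> S \<Longrightarrow> loc_frac M S x s \<in> carrier L"
  by (auto simp: localization_carrier)

lemma localization_zero: "\<zero>\<^bsub>L\<^esub> = loc_frac M S \<zero>\<^bsub>M\<^esub> \<one>\<^bsub>R\<^esub>"
  by (simp add: localization_module_def)

text \<open>The record defines the sum as a union over all representatives; all members of that
  union are the same fraction, so any one of them may be used.\<close>

lemma localization_add:
  assumes x: "x \<in> carrier M" "s \<in> S" and y: "y \<in> carrier M" "t \<in> S"
  shows "loc_frac M S x s \<oplus>\<^bsub>L\<^esub> loc_frac M S y t
    = loc_frac M S (t \<odot>\<^bsub>M\<^esub> x \<oplus>\<^bsub>M\<^esub> s \<odot>\<^bsub>M\<^esub> y) (s \<otimes>\<^bsub>R\<^esub> t)"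
proof -
  have "loc_frac M S (t' \<odot>\<^bsub>M\<^esub> x' \<oplus>\<^bsub>M\<^esub> s' \<odot>\<^bsub>M\<^esub> y') (s' \<otimes>\<^bsub>R\<^esub> t')
      = loc_frac M S (t \<odot>\<^bsub>M\<^esub> x \<oplus>\<^bsub>M\<^esub> s \<odot>\<^bsub>M\<^esub> y) (s \<otimes>\<^bsub>R\<^esub> t)"
    if mem: "(x', s') \<in> loc_frac M S x s" "(y', t') \<in> loc_frac M S y t" for x' s' y' t'
  proof -
    obtain u v where x': "x' \<in> carrier M" "s' \<in> S" and y': "y' \<in> carrier M" "t' \<in> S"
      and u: "u \<in> S" "(u \<otimes>\<^bsub>R\<^esub> s') \<odot>\<^bsub>M\<^esub> x = (u \<otimes>\<^bsub>R\<^esub> s) \<odot>\<^bsub>M\<^esub> x'"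
      and v: "v \<in> S" "(v \<otimes>\<^bsub>R\<^esub> t') \<odot>\<^bsub>M\<^esub> y = (v \<otimes>\<^bsub>R\<^esub> t) \<odot>\<^bsub>M\<^esub> y'"
      using mem by (auto simp: mem_loc_frac)
    note cr = x(1) y(1) x'(1) y'(1) x(2)[THEN S_carr] y(2)[THEN S_carr] x'(2)[THEN S_carr]
      y'(2)[THEN S_carr] u(1)[THEN S_carr] v(1)[THEN S_carr]
    have 1: "((v \<otimes>\<^bsub>R\<^esub> t \<otimes>\<^bsub>R\<^esub> t') \<otimes>\<^bsub>R\<^esub> (u \<otimes>\<^bsub>R\<^esub> s')) \<odot>\<^bsub>M\<^esub> x = ((v \<otimes>\<^bsub>R\<^esub> t \<otimes>\<^bsub>R\<^esub> t') \<otimes>\<^bsub>R\<^esub> (u \<otimes>\<^bsub>R\<^esub> s)) \<odot>\<^bsub>M\<^esub> x'"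
      by (rule smult_mono_eq[OF u(2)]) (use cr in auto)
    have 2: "((u \<otimes>\<^bsub>R\<^esub> s \<otimes>\<^bsub>R\<^esub> s') \<otimes>\<^bsub>R\<^esub> (v \<otimes>\<^bsub>R\<^esub> t')) \<odot>\<^bsub>M\<^esub> y = ((u \<otimes>\<^bsub>R\<^esub> s \<otimes>\<^bsub>R\<^esub> s') \<otimes>\<^bsub>R\<^esub> (v \<otimes>\<^bsub>R\<^esub> t)) \<odot>\<^bsub>M\<^esub> y'"
      by (rule smult_mono_eq[OF v(2)]) (use cr in auto)
    \<comment> \<open>The witness for equality of the two sums is \<open>u v\<close>; scaling the
      given equations by \<open>v t t'\<close> and \<open>u s s'\<close> matches the summands one by
      one.\<close>
    have "((u \<otimes>\<^bsub>R\<^esub> v) \<otimes>\<^bsub>R\<^esub> (s \<otimes>\<^bsub>R\<^esub> t)) \<odot>\<^bsub>M\<^esub> (t' \<odot>\<^bsub>M\<^esub> x' \<oplus>\<^bsub>M\<^esub> s' \<odot>\<^bsub>M\<^esub> y')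
      = ((v \<otimes>\<^bsub>R\<^esub> t \<otimes>\<^bsub>R\<^esub> t') \<otimes>\<^bsub>R\<^esub> (u \<otimes>\<^bsub>R\<^esub> s)) \<odot>\<^bsub>M\<^esub> x' \<oplus>\<^bsub>M\<^esub> ((u \<otimes>\<^bsub>R\<^esub> s \<otimes>\<^bsub>R\<^esub> s') \<otimes>\<^bsub>R\<^esub> (v \<otimes>\<^bsub>R\<^esub> t)) \<odot>\<^bsub>M\<^esub> y'"
      using cr by (simp add: smult_r_distr R.m_ac flip: smult_assoc1)
    also have "\<dots> = ((u \<otimes>\<^bsub>R\<^esub> v) \<otimes>\<^bsub>R\<^esub> (s' \<otimes>\<^bsub>R\<^esub> t')) \<odot>\<^bsub>M\<^esub> (t \<odot>\<^bsub>M\<^esub> x \<oplus>\<^bsub>M\<^esub> s \<odot>\<^bsub>M\<^esub> y)"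
      unfolding 1[symmetric] 2[symmetric] using cr
      by (simp add: smult_r_distr R.m_ac flip: smult_assoc1)
    finally show ?thesis
      using cr S_mult[OF u(1) v(1)] S_mult[OF x(2) y(2)] S_mult[OF x'(2) y'(2)]
      by (subst loc_frac_eq_iff) auto
  qed
  then have "(case p of (x', s') \<Rightarrow> \<Union>(y', t')\<in>loc_frac M S y t.
        loc_frac M S (t' \<odot>\<^bsub>M\<^esub> x' \<oplus>\<^bsub>M\<^esub> s' \<odot>\<^bsub>M\<^esub> y') (s' \<otimes>\<^bsub>R\<^esub> t'))
      = loc_frac M S (t \<odot>\<^bsub>M\<^esub> x \<oplus>\<^bsub>M\<^esub> s \<odot>\<^bsub>M\<^esub> y) (s \<otimes>\<^bsub>R\<^esub> t)" if "p \<in> loc_frac M S x s" for p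
    using that by (cases p) (auto intro!: UN_constant_eq[OF loc_frac_self[OF y]])
  from UN_constant_eq[OF loc_frac_self[OF x] ballI[OF this]] show ?thesis
    by (simp add: localization_module_def)
qed

lemma localization_smult:
  assumes a: "a \<in> carrier R" and x: "x \<in> carrier M" "s \<in> S"
  shows "a \<odot>\<^bsub>L\<^esub> loc_frac M S x s = loc_frac M S (a \<odot>\<^bsub>M\<^esub> x) s"
proof -
  have "loc_frac M S (a \<odot>\<^bsub>M\<^esub> x') s' = loc_frac M S (a \<odot>\<^bsub>M\<^esub> x) s"
    if mem: "(x', s') \<in> loc_frac M S x s" for x' s'
  proof -
    obtain u where x': "x' \<in> carrier M" "s' \<in> S"
      and u: "u \<in> S" "(u \<otimes>\<^bsub>R\<^esub> s') \<odot>\<^bsub>M\<^esub> x = (u \<otimes>\<^bsub>R\<^esub> s) \<odot>\<^bsub>M\<^esub> x'"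
      using mem by (auto simp: mem_loc_frac)
    note cr = a x(1) x'(1) x(2)[THEN S_carr] x'(2)[THEN S_carr] u(1)[THEN S_carr]
    have "(a \<otimes>\<^bsub>R\<^esub> (u \<otimes>\<^bsub>R\<^esub> s')) \<odot>\<^bsub>M\<^esub> x = (a \<otimes>\<^bsub>R\<^esub> (u \<otimes>\<^bsub>R\<^esub> s)) \<odot>\<^bsub>M\<^esub> x'"
      by (rule smult_mono_eq[OF u(2)]) (use cr in auto)
    then have "(u \<otimes>\<^bsub>R\<^esub> s) \<odot>\<^bsub>M\<^esub> (a \<odot>\<^bsub>M\<^esub> x') = (u \<otimes>\<^bsub>R\<^esub> s') \<odot>\<^bsub>M\<^esub> (a \<odot>\<^bsub>M\<^esub> x)"
      using cr by (simp add: R.m_ac flip: smult_assoc1)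
    then show ?thesis using cr x x' u(1) by (subst loc_frac_eq_iff) auto
  qed
  then have "(case p of (x', s') \<Rightarrow> loc_frac M S (a \<odot>\<^bsub>M\<^esub> x') s') = loc_frac M S (a \<odot>\<^bsub>M\<^esub> x) s"
    if "p \<in> loc_frac M S x s" for p
    using that by (cases p) auto
  from UN_constant_eq[OF loc_frac_self[OF x] ballI[OF this]] show ?thesis
    by (simp add: localization_module_def)
qed

lemma localizationE:
  assumes "X \<in> carrier L"
  obtains x s where "x \<in> carrier M" "s \<in> S" "X = loc_frac M S x s"
  using assms by (auto simp: localization_carrier)

lemmas localization_ops =
  localization_closed localization_add localization_smult localization_zero S_mult S_one S_carr

lemma module_localization: "module R L"
proof (rule moduleI)
  show "cring R" by (rule R.is_cring)
  show "abelian_group L"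
  proof (rule abelian_groupI)
    fix X Y assume "X \<in> carrier L" "Y \<in> carrier L"
    then show "X \<oplus>\<^bsub>L\<^esub> Y \<in> carrier L" by (elim localizationE) (simp add: localization_ops)
  next
    show "\<zero>\<^bsub>L\<^esub> \<in> carrier L" by (simp add: localization_ops)
  next
    fix X Y Z assume "X \<in> carrier L" "Y \<in> carrier L" "Z \<in> carrier L"
    then show "X \<oplus>\<^bsub>L\<^esub> Y \<oplus>\<^bsub>L\<^esub> Z = X \<oplus>\<^bsub>L\<^esub> (Y \<oplus>\<^bsub>L\<^esub> Z)"
      by (elim localizationE)
        (simp add: localization_ops smult_r_distr R.m_ac M.a_ac flip: smult_assoc1)
  next
    fix X Y assume "X \<in> carrier L" "Y \<in> carrier L"
    then show "X \<oplus>\<^bsub>L\<^esub> Y = Y \<oplus>\<^bsub>L\<^esub> X"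
      by (elim localizationE) (simp add: localization_ops R.m_ac M.a_ac)
  next
    fix X assume "X \<in> carrier L"
    then show "\<zero>\<^bsub>L\<^esub> \<oplus>\<^bsub>L\<^esub> X = X" by (elim localizationE) (simp add: localization_ops)
  next
    fix X assume "X \<in> carrier L"
    then obtain x s where x: "x \<in> carrier M" "s \<in> S" "X = loc_frac M S x s" by (rule localizationE)
    show "\<exists>Y\<in>carrier L. Y \<oplus>\<^bsub>L\<^esub> X = \<zero>\<^bsub>L\<^esub>"
    proof (rule bexI)
      have "loc_frac M S (\<ominus>\<^bsub>M\<^esub> x) s \<oplus>\<^bsub>L\<^esub> X = loc_frac M S \<zero>\<^bsub>M\<^esub> (s \<otimes>\<^bsub>R\<^esub> s)"
        using x by (simp add: localization_ops smult_r_minus M.l_neg)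
      also have "\<dots> = \<zero>\<^bsub>L\<^esub>"
        unfolding localization_zero by (rule loc_frac_eqI) (use x in \<open>auto simp: localization_ops\<close>)
      finally show "loc_frac M S (\<ominus>\<^bsub>M\<^esub> x) s \<oplus>\<^bsub>L\<^esub> X = \<zero>\<^bsub>L\<^esub>" .
    qed (use x in \<open>simp add: localization_ops\<close>)
  qed
next
  fix a X assume "a \<in> carrier R" "X \<in> carrier L"
  then show "a \<odot>\<^bsub>L\<^esub> X \<in> carrier L" by (elim localizationE) (simp add: localization_ops)
next
  fix a b X assume ab: "a \<in> carrier R" "b \<in> carrier R" and "X \<in> carrier L"
  then obtain x s where x: "x \<in> carrier M" "s \<in> S" "X = loc_frac M S x s" by (elim localizationE)
  \<comment> \<open>The sum on the right has denominator \<open>s s\<close>, so the two sides agree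
    only as fractions, after cross-multiplication.\<close>
  show "(a \<oplus>\<^bsub>R\<^esub> b) \<odot>\<^bsub>L\<^esub> X = a \<odot>\<^bsub>L\<^esub> X \<oplus>\<^bsub>L\<^esub> b \<odot>\<^bsub>L\<^esub> X"
    using ab x by (simp add: localization_ops, intro loc_frac_eqI)
      (simp_all add: localization_ops smult_l_distr smult_r_distr R.m_ac flip: smult_assoc1)
  show "(a \<otimes>\<^bsub>R\<^esub> b) \<odot>\<^bsub>L\<^esub> X = a \<odot>\<^bsub>L\<^esub> (b \<odot>\<^bsub>L\<^esub> X)"
    using ab x by (simp add: localization_ops smult_assoc1)
next
  fix a X Y assume "a \<in> carrier R" "X \<in> carrier L" "Y \<in> carrier L"
  then show "a \<odot>\<^bsub>L\<^esub> (X \<oplus>\<^bsub>L\<^esub> Y) = a \<odot>\<^bsub>L\<^esub> X \<oplus>\<^bsub>L\<^esub> a \<odot>\<^bsub>L\<^esub> Y"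
    by (elim localizationE) (simp add: localization_ops smult_r_distr R.m_ac flip: smult_assoc1)
next
  fix X assume "X \<in> carrier L"
  then show "\<one>\<^bsub>R\<^esub> \<odot>\<^bsub>L\<^esub> X = X" by (elim localizationE) (simp add: localization_smult)
qed

end

lemma (in module) module_mult_set_powers:
  assumes "f \<in> carrier R"
  shows "module_mult_set R M (powers_of R f)"
proof
  show "powers_of R f \<subseteq> carrier R" "\<one> \<in> powers_of R f"
    using assms by (auto simp: powers_of_def intro: image_eqI[of _ _ 0])
  show "s \<otimes> t \<in> powers_of R f" if "s \<in> powers_of R f" "t \<in> powers_of R f" for s t
    using that assms by (auto simp: powers_of_def R.nat_pow_mult)
qed

section \<open>Torsion over a valuation ring\<close>

lemma (in cring) ideals_set_pow_Suc:
  assumes "ideal I R"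
  shows "I [^]\<^bsub>ideals_set R\<^esub> Suc n = ideal_prod R (I [^]\<^bsub>ideals_set R\<^esub> n) I"
proof -
  interpret S: semiring "ideals_set R" by (rule ideals_set_is_semiring)
  show ?thesis by (simp add: S.nat_pow_Suc) (simp add: ideals_set_def)
qed

text \<open>Maximality gives \<open>1 = c + r a\<close> with \<open>c\<close> in \<mm>.
  Comparability then absorbs \<open>c\<close>: since \<open>a\<close> is outside \<mm>,
  \<open>c\<close> cannot divide \<open>a\<close>, so \<open>c = a k\<close> and
  \<open>k + r\<close> is an inverse of \<open>a\<close>.\<close>

lemma valuation_ring_inverse_mod_maximal:
  assumes V: "valuation_ring V" and m: "maximalideal \<mm> V"
    and a: "a \<in> carrier V" "a \<notin> \<mm>"
  obtains b where "b \<in> carrier V" "b \<otimes>\<^bsub>V\<^esub> a = \<one>\<^bsub>V\<^esub>"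
proof -
  interpret V: domain V using V by (simp add: valuation_ring_def)
  interpret m: maximalideal \<mm> V by fact
  let ?J = "\<mm> <+>\<^bsub>V\<^esub> PIdl\<^bsub>V\<^esub> a"
  have J: "ideal ?J V" by (rule V.add_ideals[OF m.is_ideal V.cgenideal_ideal[OF a(1)]])
  have "\<zero>\<^bsub>V\<^esub> \<oplus>\<^bsub>V\<^esub> a \<in> ?J"
    unfolding set_add_def' using m.zero_closed V.cgenideal_self[OF a(1)] by blast
  then have aJ: "a \<in> ?J" using a(1) by simp
  have mJ: "\<mm> \<subseteq> ?J"
  proof
    fix c assume c: "c \<in> \<mm>"
    have "\<zero>\<^bsub>V\<^esub> \<in> PIdl\<^bsub>V\<^esub> a" using a by (auto simp: cgenideal_def intro!: exI[of _ "\<zero>\<^bsub>V\<^esub>"])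
    then have "c \<oplus>\<^bsub>V\<^esub> \<zero>\<^bsub>V\<^esub> \<in> ?J" unfolding set_add_def' using c by blast
    then show "c \<in> ?J" using c by simp
  qed
  have "?J \<subseteq> carrier V" using J by (simp add: ideal.Icarr subsetI)
  then have "?J = carrier V" using m.I_maximal[OF J mJ] aJ a(2) by blast
  then have "\<one>\<^bsub>V\<^esub> \<in> ?J" using V.one_closed by simp
  then obtain c r where c: "c \<in> \<mm>" "r \<in> carrier V" "\<one>\<^bsub>V\<^esub> = c \<oplus>\<^bsub>V\<^esub> r \<otimes>\<^bsub>V\<^esub> a"
    by (auto simp: set_add_def' cgenideal_def)
  have cc: "c \<in> carrier V" using c(1) by simp
  have "\<not> c divides\<^bsub>V\<^esub> a" using m.I_r_closed[OF c(1)] a by (auto simp: factor_def)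
  then have "a divides\<^bsub>V\<^esub> c" using V cc a by (auto simp: valuation_ring_def)
  then obtain k where k: "k \<in> carrier V" "c = a \<otimes>\<^bsub>V\<^esub> k" by (auto simp: factor_def)
  have "(k \<oplus>\<^bsub>V\<^esub> r) \<otimes>\<^bsub>V\<^esub> a = \<one>\<^bsub>V\<^esub>"
    unfolding V.l_distr[OF k(1) c(2) a(1)] c(3) using k a by (simp add: V.m_comm)
  then show ?thesis using that[of "k \<oplus>\<^bsub>V\<^esub> r"] k c by simp
qed

lemma nonprincipal_maximal_idempotent:
  assumes V: "valuation_ring V" and m: "maximalideal \<mm> V" and np: "\<not> principalideal \<mm> V"
  shows "ideal_prod V \<mm> \<mm> = \<mm>"
proof (intro equalityI subsetI)
  interpret V: domain V using V by (simp add: valuation_ring_def)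
  interpret m: maximalideal \<mm> V by fact
  show "x \<in> \<mm>" if "x \<in> ideal_prod V \<mm> \<mm>" for x
    using V.ideal_prod_inter[OF m.is_ideal m.is_ideal] that by blast
  fix x assume x: "x \<in> \<mm>"
  have xc: "x \<in> carrier V" using x by simp
  have "PIdl\<^bsub>V\<^esub> x \<subseteq> \<mm>" by (rule V.cgenideal_minimal[OF m.is_ideal x])
  moreover have "PIdl\<^bsub>V\<^esub> x \<noteq> \<mm>" using np V.cgenideal_is_principalideal[OF xc] by auto
  ultimately obtain y where y: "y \<in> \<mm>" "y \<notin> PIdl\<^bsub>V\<^esub> x" by blast
  have yc: "y \<in> carrier V" using y by simp
  have "\<not> x divides\<^bsub>V\<^esub> y" using y(2) xc by (auto simp: factor_def cgenideal_def V.m_comm)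
  then have "y divides\<^bsub>V\<^esub> x" using V xc yc by (auto simp: valuation_ring_def)
  then obtain z where z: "z \<in> carrier V" "x = y \<otimes>\<^bsub>V\<^esub> z" by (auto simp: factor_def)
  \<comment> \<open>Otherwise \<open>z\<close> is a unit and \<open>y\<close> is a multiple of
    \<open>x\<close>, against the choice of \<open>y\<close>.\<close>
  have "z \<in> \<mm>"
  proof (rule ccontr)
    assume "z \<notin> \<mm>"
    then obtain b where b: "b \<in> carrier V" "b \<otimes>\<^bsub>V\<^esub> z = \<one>\<^bsub>V\<^esub>"
      using valuation_ring_inverse_mod_maximal[OF V m z(1)] by blast
    have "b \<otimes>\<^bsub>V\<^esub> x = y \<otimes>\<^bsub>V\<^esub> (b \<otimes>\<^bsub>V\<^esub> z)" using b(1) z yc by (simp add: V.m_ac)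
    then have "y = b \<otimes>\<^bsub>V\<^esub> x" using b yc by simp
    then show False using y(2) b(1) by (auto simp: cgenideal_def)
  qed
  then show "x \<in> ideal_prod V \<mm> \<mm>" using ideal_prod.prod[OF y(1), of z \<mm> V] z(2) by simp
qed

lemma (in cring) torsion_idempotent:
  assumes I: "ideal I R" and II: "ideal_prod R I I = I"
  shows "torsion R I M = annihilated M I"
proof -
  \<comment> \<open>The zeroth power is the whole ring, so only positive powers equal
    \<open>I\<close>; this matches the condition \<open>n \<ge> 1\<close> in
    \<open>torsion\<close>.\<close>
  have "I [^]\<^bsub>ideals_set R\<^esub> Suc n = I" for n
  proof (induction n)
    case 0
    interpret S: semiring "ideals_set R" by (rule ideals_set_is_semiring)
    show ?case
      using I ideal_prod_commute[OF oneideal I] ideal_prod_one[OF I] by (simp add: ideals_set_def)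
  next
    case (Suc n)
    then show ?case using II ideals_set_pow_Suc[OF I, of "Suc n"] by simp
  qed
  then have pow: "I [^]\<^bsub>ideals_set R\<^esub> n = I" if "n \<ge> 1" for n :: nat
    using that by (cases n) auto
  have "(\<exists>n::nat. n \<ge> 1 \<and> (\<forall>a\<in>I [^]\<^bsub>ideals_set R\<^esub> n. a \<odot>\<^bsub>M\<^esub> x = \<zero>\<^bsub>M\<^esub>))
      \<longleftrightarrow> (\<forall>a\<in>I. a \<odot>\<^bsub>M\<^esub> x = \<zero>\<^bsub>M\<^esub>)" for x
    using pow by (metis order_refl)
  then show ?thesis by (simp only: torsion_def annihilated_def)
qed

section \<open>The socle over a valuation ring\<close>

lemma (in module) cyclic_submodule:
  assumes "x \<in> carrier M"
  shows "submodule ((\<lambda>a. a \<odot>\<^bsub>M\<^esub> x) ` carrier R) R M"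
proof (rule submoduleI')
  show "\<zero>\<^bsub>M\<^esub> \<in> (\<lambda>a. a \<odot>\<^bsub>M\<^esub> x) ` carrier R" using assms by (auto intro!: image_eqI[of _ _ \<zero>])
qed (use assms in \<open>auto simp flip: smult_l_distr smult_assoc1\<close>)

text \<open>Elements outside \<mm> are units. If \<mm> kills \<open>x\<close>, a nonzero multiple of
  \<open>x\<close> has a unit coefficient and generates \<open>x\<close> back, so \<open>x\<close>
  spans a simple submodule or is zero. Conversely, simple submodules are killed by \<mm>, by a
  Nakayama argument.\<close>

lemma socle_valuation_ring:
  assumes V: "valuation_ring V" and m: "maximalideal \<mm> V" and M: "module V M"
  shows "socle V M = annihilated M \<mm>"
proof -
  interpret V: domain V using V by (simp add: valuation_ring_def)
  interpret m: maximalideal \<mm> V by fact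
  interpret M: module V M by fact
  have simple_cyclic: "simple_submodule V M ((\<lambda>a. a \<odot>\<^bsub>M\<^esub> x) ` carrier V)" (is "simple_submodule V M ?S")
    if x: "x \<in> annihilated M \<mm>" "x \<noteq> \<zero>\<^bsub>M\<^esub>" for x
  proof -
    have xc: "x \<in> carrier M" using x by (simp add: annihilated_def)
    have xS: "x \<in> ?S" using xc by (auto intro!: image_eqI[of _ _ "\<one>\<^bsub>V\<^esub>"])
    have "T = {\<zero>\<^bsub>M\<^esub>} \<or> T = ?S" if T: "submodule T V M" "T \<subseteq> ?S" for T
    proof (cases "T = {\<zero>\<^bsub>M\<^esub>}")
      case False
      then obtain t where "t \<in> T" "t \<noteq> \<zero>\<^bsub>M\<^esub>" using M.submodule_zero[OF T(1)] by blast
      then obtain a where a: "a \<in> carrier V" "a \<odot>\<^bsub>M\<^esub> x \<in> T" "a \<odot>\<^bsub>M\<^esub> x \<noteq> \<zero>\<^bsub>M\<^esub>"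
        using T(2) by blast
      have "a \<notin> \<mm>" using a(3) x by (auto simp: annihilated_def)
      then obtain b where b: "b \<in> carrier V" "b \<otimes>\<^bsub>V\<^esub> a = \<one>\<^bsub>V\<^esub>"
        using valuation_ring_inverse_mod_maximal[OF V m a(1)] by blast
      have "x = b \<odot>\<^bsub>M\<^esub> (a \<odot>\<^bsub>M\<^esub> x)" using a b xc by (simp flip: M.smult_assoc1)
      then have "x \<in> T" using M.submoduleE(4)[OF T(1) b(1) a(2)] by simp
      then have "?S \<subseteq> T" using M.submoduleE(4)[OF T(1)] by blast
      then show ?thesis using T(2) by blast
    qed simp
    moreover have "?S \<noteq> {\<zero>\<^bsub>M\<^esub>}" using xS x(2) by blast
    ultimately show ?thesis using M.cyclic_submodule[OF xc] by (simp add: simple_submodule_def)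
  qed
  have simple_killed: "S \<subseteq> annihilated M \<mm>" if S: "simple_submodule V M S" for S
  proof
    fix x assume xS: "x \<in> S"
    have sub: "submodule S V M"
      and min: "\<And>T. submodule T V M \<Longrightarrow> T \<subseteq> S \<Longrightarrow> T \<noteq> {\<zero>\<^bsub>M\<^esub>} \<Longrightarrow> T = S"
      using S by (auto simp: simple_submodule_def)
    have xc: "x \<in> carrier M" using xS M.submoduleE(1)[OF sub] by blast
    have "a \<odot>\<^bsub>M\<^esub> x = \<zero>\<^bsub>M\<^esub>" if a: "a \<in> \<mm>" for a
    proof (rule ccontr)
      assume nz: "a \<odot>\<^bsub>M\<^esub> x \<noteq> \<zero>\<^bsub>M\<^esub>"
      have ac: "a \<in> carrier V" using a by simp
      let ?T = "(\<lambda>b. b \<odot>\<^bsub>M\<^esub> (a \<odot>\<^bsub>M\<^esub> x)) ` carrier V"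
      have axS: "a \<odot>\<^bsub>M\<^esub> x \<in> S" by (rule M.submoduleE(4)[OF sub ac xS])
      have "a \<odot>\<^bsub>M\<^esub> x \<in> ?T" using ac xc by (auto intro!: image_eqI[of _ _ "\<one>\<^bsub>V\<^esub>"])
      then have "?T \<noteq> {\<zero>\<^bsub>M\<^esub>}" using nz by blast
      moreover have "?T \<subseteq> S" using M.submoduleE(4)[OF sub _ axS] by blast
      moreover have "submodule ?T V M" by (rule M.cyclic_submodule) (use ac xc in simp)
      ultimately have "?T = S" using min by blast
      then obtain b where b: "b \<in> carrier V" "x = b \<odot>\<^bsub>M\<^esub> (a \<odot>\<^bsub>M\<^esub> x)" using xS by blast
      \<comment> \<open>Simplicity gave \<open>x = b a x\<close>, so \<open>1 - b a\<close> kills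
        \<open>x\<close>. It lies outside \<mm> because \<open>b a\<close> is in \<mm>, hence it is
        a unit and \<open>x = 0\<close>.\<close>
      let ?u = "\<one>\<^bsub>V\<^esub> \<ominus>\<^bsub>V\<^esub> b \<otimes>\<^bsub>V\<^esub> a"
      have uc: "?u \<in> carrier V" using b ac by simp
      have ba: "b \<otimes>\<^bsub>V\<^esub> a \<in> \<mm>" by (rule m.I_l_closed[OF a b(1)])
      have "?u \<notin> \<mm>"
      proof
        assume "?u \<in> \<mm>"
        then have "?u \<oplus>\<^bsub>V\<^esub> b \<otimes>\<^bsub>V\<^esub> a \<in> \<mm>" using ba by simp
        then have "\<one>\<^bsub>V\<^esub> \<in> \<mm>" using b ac by (simp add: a_minus_def V.a_assoc V.l_neg)
        then show False using m.one_imp_carrier m.I_notcarr by blast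
      qed
      then obtain v where v: "v \<in> carrier V" "v \<otimes>\<^bsub>V\<^esub> ?u = \<one>\<^bsub>V\<^esub>"
        using valuation_ring_inverse_mod_maximal[OF V m uc] by blast
      have "?u \<odot>\<^bsub>M\<^esub> x = x \<oplus>\<^bsub>M\<^esub> \<ominus>\<^bsub>M\<^esub> (b \<odot>\<^bsub>M\<^esub> (a \<odot>\<^bsub>M\<^esub> x))"
        using b(1) ac xc by (simp add: a_minus_def M.smult_l_distr M.smult_l_minus M.smult_assoc1)
      also have "\<dots> = \<zero>\<^bsub>M\<^esub>" using b(2) xc M.M.r_neg[OF xc] by metis
      finally have "(v \<otimes>\<^bsub>V\<^esub> ?u) \<odot>\<^bsub>M\<^esub> x = \<zero>\<^bsub>M\<^esub>" using v(1) uc xc by (simp add: M.smult_assoc1)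
      then have "x = \<zero>\<^bsub>M\<^esub>" using v(2) xc by simp
      then show False using nz ac by simp
    qed
    then show "x \<in> annihilated M \<mm>" using xc by (simp add: annihilated_def)
  qed
  have sub: "submodule (annihilated M \<mm>) V M" by (rule M.annihilated_submodule[OF m.a_subset])
  show ?thesis
  proof (intro equalityI subsetI)
    show "x \<in> annihilated M \<mm>" if "x \<in> socle V M" for x
      using that sub simple_killed unfolding socle_def by blast
    fix x assume x: "x \<in> annihilated M \<mm>"
    show "x \<in> socle V M" unfolding socle_def
    proof clarify
      fix N assume N: "submodule N V M" "\<forall>S. simple_submodule V M S \<longrightarrow> S \<subseteq> N"
      show "x \<in> N"
      proof (cases "x = \<zero>\<^bsub>M\<^esub>")
        case True then show ?thesis using M.submodule_zero[OF N(1)] by simp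
      next
        case False
        have "x \<in> (\<lambda>a. a \<odot>\<^bsub>M\<^esub> x) ` carrier V"
          using x by (auto simp: annihilated_def intro!: image_eqI[of _ _ "\<one>\<^bsub>V\<^esub>"])
        then show ?thesis using N(2) simple_cyclic[OF x False] by blast
      qed
    qed
  qed
qed

section \<open>Torsion for a principal ideal\<close>

lemma (in "domain") nat_pow_nonzero:
  "f \<in> carrier R \<Longrightarrow> f \<noteq> \<zero> \<Longrightarrow> f [^] (n :: nat) \<noteq> \<zero>"
  by (induction n) (auto simp: integral_iff)

text \<open>The kernel of \<open>M \<rightarrow> M_f\<close>. The exponent 0 adds nothing, since
  \<open>f^0\<close> kills only zero.\<close>

definition power_torsion :: "('a, 'r) ring_scheme \<Rightarrow> 'a \<Rightarrow> ('a, 'b, 'm) module_scheme \<Rightarrow> 'b set" where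
  "power_torsion R f M = {x \<in> carrier M. \<exists>n::nat. (f [^]\<^bsub>R\<^esub> n) \<odot>\<^bsub>M\<^esub> x = \<zero>\<^bsub>M\<^esub>}"

lemma (in module) power_torsion_submodule:
  assumes f: "f \<in> carrier R"
  shows "submodule (power_torsion R f M) R M"
proof (rule submoduleI')
  show "power_torsion R f M \<subseteq> carrier M" "\<zero>\<^bsub>M\<^esub> \<in> power_torsion R f M"
    using f by (auto simp: power_torsion_def)
next
  fix x y assume "x \<in> power_torsion R f M" "y \<in> power_torsion R f M"
  then obtain n k :: nat where xy: "x \<in> carrier M" "(f [^] n) \<odot>\<^bsub>M\<^esub> x = \<zero>\<^bsub>M\<^esub>"
    "y \<in> carrier M" "(f [^] k) \<odot>\<^bsub>M\<^esub> y = \<zero>\<^bsub>M\<^esub>" by (auto simp: power_torsion_def)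
  have "(f [^] (n + k)) \<odot>\<^bsub>M\<^esub> x = (f [^] k) \<odot>\<^bsub>M\<^esub> ((f [^] n) \<odot>\<^bsub>M\<^esub> x)"
    "(f [^] (n + k)) \<odot>\<^bsub>M\<^esub> y = (f [^] n) \<odot>\<^bsub>M\<^esub> ((f [^] k) \<odot>\<^bsub>M\<^esub> y)"
    using xy(1,3) f by (simp_all add: R.nat_pow_mult add.commute flip: smult_assoc1)
  then have "(f [^] (n + k)) \<odot>\<^bsub>M\<^esub> (x \<oplus>\<^bsub>M\<^esub> y) = \<zero>\<^bsub>M\<^esub>"
    using xy f by (simp add: smult_r_distr)
  then show "x \<oplus>\<^bsub>M\<^esub> y \<in> power_torsion R f M" using xy by (auto simp: power_torsion_def)
next
  fix a x assume a: "a \<in> carrier R" and "x \<in> power_torsion R f M"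
  then obtain n :: nat where x: "x \<in> carrier M" "(f [^] n) \<odot>\<^bsub>M\<^esub> x = \<zero>\<^bsub>M\<^esub>"
    by (auto simp: power_torsion_def)
  have "(f [^] n) \<odot>\<^bsub>M\<^esub> (a \<odot>\<^bsub>M\<^esub> x) = a \<odot>\<^bsub>M\<^esub> ((f [^] n) \<odot>\<^bsub>M\<^esub> x)"
    using x(1) a f by (simp add: R.m_comm flip: smult_assoc1)
  then show "a \<odot>\<^bsub>M\<^esub> x \<in> power_torsion R f M" using x a by (auto simp: power_torsion_def)
qed

lemma mod_hom_power_torsion:
  assumes "module R M" "module R N" "h \<in> mod_hom R M N" "f \<in> carrier R" "x \<in> power_torsion R f M"
  shows "h x \<in> power_torsion R f N"
proof -
  interpret M: module R M by fact
  obtain n :: nat where x: "x \<in> carrier M" "(f [^]\<^bsub>R\<^esub> n) \<odot>\<^bsub>M\<^esub> x = \<zero>\<^bsub>M\<^esub>"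
    using assms(5) by (auto simp: power_torsion_def)
  then have "(f [^]\<^bsub>R\<^esub> n) \<odot>\<^bsub>N\<^esub> h x = \<zero>\<^bsub>N\<^esub>"
    using mod_hom_smult[OF assms(3), of "f [^]\<^bsub>R\<^esub> n" x] mod_hom_zero[OF assms(1-3)] assms(4) by simp
  then show ?thesis using x mod_hom_closed[OF assms(3)] by (auto simp: power_torsion_def)
qed

text \<open>The n-th power of \<open>(f)\<close> consists of the multiples of \<open>f^n\<close>:
  \<open>pow\<close> gives the generator, \<open>div\<close> the converse. Killing the power of the
  ideal is therefore killing by \<open>f^n\<close>.\<close>

lemma torsion_principal:
  assumes M: "module R M" and f: "f \<in> carrier R"
  shows "torsion R (Idl\<^bsub>R\<^esub> {f}) M = {x \<in> carrier M. \<exists>n::nat. (f [^]\<^bsub>R\<^esub> n) \<odot>\<^bsub>M\<^esub> x = \<zero>\<^bsub>M\<^esub>}"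
proof -
  interpret M: module R M by fact
  let ?I = "Idl\<^bsub>R\<^esub> {f}"
  have I: "ideal ?I R" using M.R.genideal_ideal f by simp
  have fI: "f \<in> ?I" using M.R.genideal_self' f by simp
  have pow: "f [^]\<^bsub>R\<^esub> n \<in> ?I [^]\<^bsub>ideals_set R\<^esub> n" for n :: nat
  proof (induction n)
    case 0 then show ?case by (simp add: ideals_set_def)
  next
    case (Suc n)
    then show ?case using ideal_prod.prod[OF Suc fI, of R] unfolding M.R.ideals_set_pow_Suc[OF I] by simp
  qed
  have div: "\<exists>r\<in>carrier R. a = r \<otimes>\<^bsub>R\<^esub> f [^]\<^bsub>R\<^esub> n" if "a \<in> ?I [^]\<^bsub>ideals_set R\<^esub> n" for a and n :: nat
    using that
  proof (induction n arbitrary: a)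
    case 0 then show ?case by (auto simp: ideals_set_def)
  next
    case (Suc n)
    \<comment> \<open>The product ideal is generated inductively by products and sums, and the
      multiples of \<open>f^(n+1)\<close> absorb both.\<close>
    have "a \<in> ideal_prod R (?I [^]\<^bsub>ideals_set R\<^esub> n) ?I"
      using Suc.prems unfolding M.R.ideals_set_pow_Suc[OF I] .
    then show ?case
    proof (induction rule: ideal_prod.induct)
      case (prod i j)
      obtain r where r: "r \<in> carrier R" "i = r \<otimes>\<^bsub>R\<^esub> f [^]\<^bsub>R\<^esub> n" using Suc.IH[OF prod(1)] by blast
      obtain s where s: "s \<in> carrier R" "j = s \<otimes>\<^bsub>R\<^esub> f"
        using prod(2) f by (auto simp flip: M.R.cgenideal_eq_genideal simp: cgenideal_def)
      show ?case by (rule bexI[of _ "r \<otimes>\<^bsub>R\<^esub> s"]) (use r s f in \<open>simp_all add: M.R.m_ac\<close>)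
    next
      case (sum a b)
      then obtain r s where "r \<in> carrier R" "a = r \<otimes>\<^bsub>R\<^esub> f [^]\<^bsub>R\<^esub> Suc n"
        "s \<in> carrier R" "b = s \<otimes>\<^bsub>R\<^esub> f [^]\<^bsub>R\<^esub> Suc n" by blast
      then show ?case using f by (intro bexI[of _ "r \<oplus>\<^bsub>R\<^esub> s"]) (simp_all add: M.R.l_distr)
    qed
  qed
  show ?thesis
  proof (intro equalityI subsetI)
    fix x assume "x \<in> torsion R ?I M"
    then show "x \<in> {x \<in> carrier M. \<exists>n::nat. (f [^]\<^bsub>R\<^esub> n) \<odot>\<^bsub>M\<^esub> x = \<zero>\<^bsub>M\<^esub>}"
      using pow by (auto simp: torsion_def)
  next
    fix x assume "x \<in> {x \<in> carrier M. \<exists>n::nat. (f [^]\<^bsub>R\<^esub> n) \<odot>\<^bsub>M\<^esub> x = \<zero>\<^bsub>M\<^esub>}"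
    then obtain n :: nat where x: "x \<in> carrier M" "(f [^]\<^bsub>R\<^esub> n) \<odot>\<^bsub>M\<^esub> x = \<zero>\<^bsub>M\<^esub>" by blast
    \<comment> \<open>\<open>n\<close> may be 0, whereas \<open>torsion\<close> asks for a positive
      exponent; hence \<open>Suc n\<close>.\<close>
    have "a \<odot>\<^bsub>M\<^esub> x = \<zero>\<^bsub>M\<^esub>" if aI: "a \<in> ?I [^]\<^bsub>ideals_set R\<^esub> Suc n" for a
    proof -
      obtain r where r: "r \<in> carrier R" "a = r \<otimes>\<^bsub>R\<^esub> f [^]\<^bsub>R\<^esub> Suc n" using div[OF aI] by blast
      have "a = (r \<otimes>\<^bsub>R\<^esub> f) \<otimes>\<^bsub>R\<^esub> f [^]\<^bsub>R\<^esub> n"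
        using r f by (simp add: M.R.m_ac)
      then show ?thesis using x r(1) f by (simp add: M.smult_assoc1)
    qed
    then show "x \<in> torsion R ?I M" using x(1) unfolding torsion_def by (auto intro!: exI[of _ "Suc n"])
  qed
qed

text \<open>The obstruction to correcting \<open>y\<close> is that the preimage \<open>z\<close> of
  \<open>f^n y\<close> must be divided by \<open>f^n\<close>. In degree at least 2 this
  \<open>z\<close> lies in an injective module, where division by a nonzero ring element is
  possible.\<close>

lemma power_torsion_cohomology_vanishes:
  assumes R: "domain R" and f: "f \<in> carrier R" "f \<noteq> \<zero>\<^bsub>R\<^esub>"
    and E: "injective_resolution R M e E d" and i: "i \<ge> 2"
  shows "zero_module (cohomology (\<lambda>j. (E j)\<lparr>carrier := power_torsion R f (E j)\<rparr>) d i)"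
proof -
  note D = injective_resolutionD[OF E]
  interpret R: domain R by fact
  obtain j where i_eq: "i = Suc (Suc j)" using i by (metis Suc_le_D numeral_2_eq_2 Suc_le_mono)
  interpret E0: module R "E j" by (rule D(3))
  interpret E1: module R "E (Suc j)" by (rule D(3))
  interpret E2: module R "E i" by (rule D(3))
  let ?Z = "{x \<in> power_torsion R f (E i). d i x = \<zero>\<^bsub>E (Suc i)\<^esub>}"
  let ?B = "d (Suc j) ` power_torsion R f (E (Suc j))"
  have fn: "f [^]\<^bsub>R\<^esub> n \<in> carrier R" "f [^]\<^bsub>R\<^esub> n \<noteq> \<zero>\<^bsub>R\<^esub>" for n :: nat
    using f R.nat_pow_nonzero by auto
  have "?Z = ?B"
  proof (intro equalityI subsetI)
    fix x assume "x \<in> ?B"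
    then show "x \<in> ?Z"
      using mod_hom_power_torsion[OF D(3) D(3) D(6)[of "Suc j"] f(1)] D(8)[of _ "Suc j"]
      by (auto simp: i_eq power_torsion_def[of _ _ "E (Suc j)"])
  next
    fix x assume x: "x \<in> ?Z"
    then obtain n :: nat where n: "x \<in> carrier (E i)" "(f [^]\<^bsub>R\<^esub> n) \<odot>\<^bsub>E i\<^esub> x = \<zero>\<^bsub>E i\<^esub>" "d i x = \<zero>\<^bsub>E (Suc i)\<^esub>"
      by (auto simp: power_torsion_def)
    let ?g = "f [^]\<^bsub>R\<^esub> n"
    obtain y where y: "y \<in> carrier (E (Suc j))" "x = d (Suc j) y"
      using injective_resolution_exact[OF E, of x "Suc j"] n by (auto simp: i_eq)
    have gy: "?g \<odot>\<^bsub>E (Suc j)\<^esub> y \<in> carrier (E (Suc j))" using fn(1) y(1) by simp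
    have "d (Suc j) (?g \<odot>\<^bsub>E (Suc j)\<^esub> y) = \<zero>\<^bsub>E (Suc (Suc j))\<^esub>"
      using n(2) mod_hom_smult[OF D(6) fn(1) y(1)] y(2) by (simp add: i_eq)
    then obtain z where z: "z \<in> carrier (E j)" "?g \<odot>\<^bsub>E (Suc j)\<^esub> y = d j z"
      using injective_resolution_exact[OF E gy] by blast
    obtain w where w: "w \<in> carrier (E j)" "?g \<odot>\<^bsub>E j\<^esub> w = z"
      by (rule injective_module_divisible[OF R D(2) fn z(1)])
    have dw: "d j w \<in> carrier (E (Suc j))" by (rule mod_hom_closed[OF D(6) w(1)])
    let ?v = "y \<ominus>\<^bsub>E (Suc j)\<^esub> d j w"
    \<comment> \<open>\<open>d j\<close> commutes with \<open>f^n\<close>, so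
      \<open>f^n d w = d z = f^n y\<close>; thus \<open>f^n\<close> kills
      \<open>y - d w\<close>.\<close>
    have "?g \<odot>\<^bsub>E (Suc j)\<^esub> d j w = ?g \<odot>\<^bsub>E (Suc j)\<^esub> y"
      unfolding mod_hom_smult[OF D(6) fn(1) w(1), symmetric] w(2) z(2) ..
    then have "?g \<odot>\<^bsub>E (Suc j)\<^esub> ?v = \<zero>\<^bsub>E (Suc j)\<^esub>"
      using y(1) dw fn(1) by (simp add: a_minus_def E1.smult_r_distr E1.smult_r_minus E1.M.r_neg)
    then have "?v \<in> power_torsion R f (E (Suc j))" using y(1) dw by (auto simp: power_torsion_def)
    moreover have "d (Suc j) ?v = x"
      using mod_hom_minus[OF D(3) D(3) D(6) y(1) dw] D(8)[OF w(1)] y(2) n(1)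
      by (simp add: a_minus_def E2.M.minus_of_zero i_eq[symmetric])
    ultimately show "x \<in> ?B" by blast
  qed
  moreover have "submodule ?B R (E i)"
    using mod_hom_image_submodule[OF D(3) D(3) D(6) E1.power_torsion_submodule[OF f(1)]] by (simp add: i_eq)
  ultimately have "zero_module (quotient_module ((E i)\<lparr>carrier := ?Z\<rparr>) ?B)"
    by (intro zero_quotient_module[OF submodule.submodule_is_module]) (use D(3) in auto)
  then show ?thesis
    by (simp add: cohomology_def cocycles_def coboundaries_def i_eq)
qed

lemma power_torsion_cohomology_1:
  assumes R: "domain R" and f: "f \<in> carrier R" "f \<noteq> \<zero>\<^bsub>R\<^esub>"
    and E: "injective_resolution R M e E d"
  shows "mod_isomorphic R (cohomology (\<lambda>j. (E j)\<lparr>carrier := power_torsion R f (E j)\<rparr>) d 1)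
    (cokernel M (localization_away R f M) (localization_away_map R f M))"
proof -
  note D = injective_resolutionD[OF E]
  interpret R: domain R by fact
  interpret M: module R M by (rule D(1))
  let ?S = "powers_of R f"
  interpret S: module_mult_set R M ?S by (rule M.module_mult_set_powers[OF f(1)])
  let ?L = "localization_module R ?S M"
  interpret L: module R ?L by (rule S.module_localization)
  interpret E0: module R "E 0" by (rule D(3))
  interpret E1: module R "E 1" by (rule D(3))
  let ?Z = "{x \<in> power_torsion R f (E 1). d 1 x = \<zero>\<^bsub>E (Suc 1)\<^esub>}"
  let ?B = "d 0 ` power_torsion R f (E 0)"
  have d0: "d 0 \<in> mod_hom R (E 0) (E 1)" using D(6)[of 0] by simp
  have fn: "f [^]\<^bsub>R\<^esub> n \<in> carrier R" "f [^]\<^bsub>R\<^esub> n \<noteq> \<zero>\<^bsub>R\<^esub>" "f [^]\<^bsub>R\<^esub> n \<in> ?S" for n :: nat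
    using f R.nat_pow_nonzero by (auto simp: powers_of_def)
  have powS: "\<exists>n::nat. s = f [^]\<^bsub>R\<^esub> n" if "s \<in> ?S" for s using that by (auto simp: powers_of_def)
  have e_eqD: "x = y" if "e x = e y" "x \<in> carrier M" "y \<in> carrier M" for x y
    using inj_onD[OF D(5)] that by blast
  have ec: "z \<in> carrier M \<Longrightarrow> e z \<in> carrier (E 0)" for z by (rule mod_hom_closed[OF D(4)])
  have e0: "e \<zero>\<^bsub>M\<^esub> = \<zero>\<^bsub>E 0\<^esub>" by (rule mod_hom_zero[OF D(1) D(3) D(4)])
  have subZ: "submodule ?Z R (E 1)"
  proof -
    have "?Z = power_torsion R f (E 1) \<inter> {x \<in> carrier (E 1). d 1 x = \<zero>\<^bsub>E (Suc 1)\<^esub>}"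
      by (auto simp: power_torsion_def)
    then show ?thesis
      using E1.submodule_Int[OF E1.power_torsion_submodule[OF f(1)] E1.submodule_kernel[OF D(3) D(6)]]
      by simp
  qed
  \<comment> \<open>All ways of writing \<open>x = d y\<close> with \<open>f^n y\<close> coming from
    \<open>M\<close> are allowed at once. Every \<open>x\<close> is reached by exactness at
    \<open>E 1\<close> and \<open>E 0\<close>, every fraction by dividing \<open>e z\<close> by
    \<open>f^n\<close> in \<open>E 0\<close>.\<close>
  define P where "P x w \<longleftrightarrow> x \<in> ?Z \<and> (\<exists>y z n. y \<in> carrier (E 0) \<and> z \<in> carrier M \<and> x = d 0 y \<and>
    (f [^]\<^bsub>R\<^esub> (n::nat)) \<odot>\<^bsub>E 0\<^esub> y = e z \<and> w = loc_frac M ?S z (f [^]\<^bsub>R\<^esub> n))" for x w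
  have PI: "P x w" if "y \<in> carrier (E 0)" "z \<in> carrier M" "x = d 0 y"
    "(f [^]\<^bsub>R\<^esub> n) \<odot>\<^bsub>E 0\<^esub> y = e z" "w = loc_frac M ?S z (f [^]\<^bsub>R\<^esub> n)" for x w y z and n :: nat
  proof -
    \<comment> \<open>The torsion condition on \<open>x\<close> is automatic:
      \<open>f^n x = d (f^n y) = d (e z) = 0\<close>.\<close>
    have "(f [^]\<^bsub>R\<^esub> n) \<odot>\<^bsub>E 1\<^esub> x = \<zero>\<^bsub>E 1\<^esub>"
      unfolding that(3) mod_hom_smult[OF d0 fn(1) that(1), symmetric] that(4) by (rule D(7)[OF that(2)])
    then have "x \<in> ?Z"
      using D(8)[OF that(1)] mod_hom_closed[OF d0 that(1)] that(3) by (auto simp: power_torsion_def)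
    then show ?thesis using that unfolding P_def by blast
  qed
  have "mod_isomorphic R (quotient_module ((E 1)\<lparr>carrier := ?Z\<rparr>) ?B)
     (quotient_module ?L (localization_away_map R f M ` carrier M))"
  proof (rule quotient_iso_of_relation[where P = P])
    show "module R ((E 1)\<lparr>carrier := ?Z\<rparr>)" by (rule submodule.submodule_is_module[OF subZ D(3)])
    show "module R ?L" by (rule S.module_localization)
    show "x \<in> carrier ((E 1)\<lparr>carrier := ?Z\<rparr>) \<and> w \<in> carrier ?L" if "P x w" for x w
      using that S.localization_closed fn(3) by (auto simp: P_def)
  next
    fix x w x' w' assume "P x w" "P x' w'"
    then obtain y z y' z' and n k :: nat where
      1: "y \<in> carrier (E 0)" "z \<in> carrier M" "x = d 0 y" "(f [^]\<^bsub>R\<^esub> n) \<odot>\<^bsub>E 0\<^esub> y = e z"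
         "w = loc_frac M ?S z (f [^]\<^bsub>R\<^esub> n)" and
      2: "y' \<in> carrier (E 0)" "z' \<in> carrier M" "x' = d 0 y'" "(f [^]\<^bsub>R\<^esub> k) \<odot>\<^bsub>E 0\<^esub> y' = e z'"
         "w' = loc_frac M ?S z' (f [^]\<^bsub>R\<^esub> k)"
      unfolding P_def by blast
    have "P (x \<oplus>\<^bsub>E 1\<^esub> x') (w \<oplus>\<^bsub>?L\<^esub> w')"
    proof (rule PI)
      let ?z = "(f [^]\<^bsub>R\<^esub> k) \<odot>\<^bsub>M\<^esub> z \<oplus>\<^bsub>M\<^esub> (f [^]\<^bsub>R\<^esub> n) \<odot>\<^bsub>M\<^esub> z'"
      show "y \<oplus>\<^bsub>E 0\<^esub> y' \<in> carrier (E 0)" using 1 2 by simp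
      show "?z \<in> carrier M" using 1 2 fn(1) by simp
      show "x \<oplus>\<^bsub>E 1\<^esub> x' = d 0 (y \<oplus>\<^bsub>E 0\<^esub> y')" using 1 2 by (simp add: mod_hom_add[OF d0])
      show "w \<oplus>\<^bsub>?L\<^esub> w' = loc_frac M ?S ?z (f [^]\<^bsub>R\<^esub> (n + k))"
        using 1 2 fn f(1) by (simp add: S.localization_add R.nat_pow_mult)
      have "e ?z = (f [^]\<^bsub>R\<^esub> k) \<odot>\<^bsub>E 0\<^esub> ((f [^]\<^bsub>R\<^esub> n) \<odot>\<^bsub>E 0\<^esub> y) \<oplus>\<^bsub>E 0\<^esub> (f [^]\<^bsub>R\<^esub> n) \<odot>\<^bsub>E 0\<^esub> ((f [^]\<^bsub>R\<^esub> k) \<odot>\<^bsub>E 0\<^esub> y')"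
        using 1 2 fn(1) by (simp add: mod_hom_add[OF D(4)] mod_hom_smult[OF D(4)])
      also have "\<dots> = (f [^]\<^bsub>R\<^esub> (n + k)) \<odot>\<^bsub>E 0\<^esub> (y \<oplus>\<^bsub>E 0\<^esub> y')"
        using 1(1) 2(1) fn(1) f(1)
        by (simp add: E0.smult_r_distr R.nat_pow_mult add.commute flip: E0.smult_assoc1)
      finally show "(f [^]\<^bsub>R\<^esub> (n + k)) \<odot>\<^bsub>E 0\<^esub> (y \<oplus>\<^bsub>E 0\<^esub> y') = e ?z" by simp
    qed
    then show "P (x \<oplus>\<^bsub>(E 1)\<lparr>carrier := ?Z\<rparr>\<^esub> x') (w \<oplus>\<^bsub>?L\<^esub> w')" by simp
  next
    fix r x w assume r: "r \<in> carrier R" and "P x w"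
    then obtain y z and n :: nat where
      1: "y \<in> carrier (E 0)" "z \<in> carrier M" "x = d 0 y" "(f [^]\<^bsub>R\<^esub> n) \<odot>\<^bsub>E 0\<^esub> y = e z"
         "w = loc_frac M ?S z (f [^]\<^bsub>R\<^esub> n)"
      unfolding P_def by blast
    have "P (r \<odot>\<^bsub>E 1\<^esub> x) (r \<odot>\<^bsub>?L\<^esub> w)"
    proof (rule PI)
      show "r \<odot>\<^bsub>E 0\<^esub> y \<in> carrier (E 0)" "r \<odot>\<^bsub>M\<^esub> z \<in> carrier M" using 1 r by simp_all
      show "r \<odot>\<^bsub>E 1\<^esub> x = d 0 (r \<odot>\<^bsub>E 0\<^esub> y)" using 1 r by (simp add: mod_hom_smult[OF d0])
      show "r \<odot>\<^bsub>?L\<^esub> w = loc_frac M ?S (r \<odot>\<^bsub>M\<^esub> z) (f [^]\<^bsub>R\<^esub> n)"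
        using 1 r fn(3) by (simp add: S.localization_smult)
      have "(f [^]\<^bsub>R\<^esub> n) \<odot>\<^bsub>E 0\<^esub> (r \<odot>\<^bsub>E 0\<^esub> y) = r \<odot>\<^bsub>E 0\<^esub> ((f [^]\<^bsub>R\<^esub> n) \<odot>\<^bsub>E 0\<^esub> y)"
        using 1(1) r fn(1) by (simp add: R.m_comm flip: E0.smult_assoc1)
      then show "(f [^]\<^bsub>R\<^esub> n) \<odot>\<^bsub>E 0\<^esub> (r \<odot>\<^bsub>E 0\<^esub> y) = e (r \<odot>\<^bsub>M\<^esub> z)"
        using 1 r by (simp add: mod_hom_smult[OF D(4)])
    qed
    then show "P (r \<odot>\<^bsub>(E 1)\<lparr>carrier := ?Z\<rparr>\<^esub> x) (r \<odot>\<^bsub>?L\<^esub> w)" by simp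
  next
    fix x assume "x \<in> carrier ((E 1)\<lparr>carrier := ?Z\<rparr>)"
    then obtain n :: nat where x: "x \<in> carrier (E 1)" "(f [^]\<^bsub>R\<^esub> n) \<odot>\<^bsub>E 1\<^esub> x = \<zero>\<^bsub>E 1\<^esub>" "d 1 x = \<zero>\<^bsub>E (Suc 1)\<^esub>"
      by (auto simp: power_torsion_def)
    obtain y where y: "y \<in> carrier (E 0)" "x = d 0 y"
      using injective_resolution_exact[OF E, of x 0] x by auto
    have gy: "(f [^]\<^bsub>R\<^esub> n) \<odot>\<^bsub>E 0\<^esub> y \<in> carrier (E 0)" using fn(1) y(1) by simp
    have "d 0 ((f [^]\<^bsub>R\<^esub> n) \<odot>\<^bsub>E 0\<^esub> y) = \<zero>\<^bsub>E 1\<^esub>"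
      using mod_hom_smult[OF d0 fn(1) y(1)] x(2) y(2) by simp
    then obtain z where "z \<in> carrier M" "(f [^]\<^bsub>R\<^esub> n) \<odot>\<^bsub>E 0\<^esub> y = e z"
      using injective_resolution_exact_0[OF E gy] by blast
    then show "\<exists>w. P x w" using PI[OF y(1) _ y(2)] by blast
  next
    fix w assume "w \<in> carrier ?L"
    then obtain z s where "z \<in> carrier M" "s \<in> ?S" "w = loc_frac M ?S z s" by (rule S.localizationE)
    then obtain n :: nat where z: "z \<in> carrier M" "w = loc_frac M ?S z (f [^]\<^bsub>R\<^esub> n)" using powS by blast
    obtain y where "y \<in> carrier (E 0)" "(f [^]\<^bsub>R\<^esub> n) \<odot>\<^bsub>E 0\<^esub> y = e z"
      by (rule injective_module_divisible[OF R D(2) fn(1,2) ec[OF z(1)]])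
    then show "\<exists>x. P x w" using PI[OF _ z(1) refl _ z(2)] by blast
  next
    fix x
    show "x \<in> ?B \<longleftrightarrow> P x \<zero>\<^bsub>?L\<^esub>"
    proof
      assume "x \<in> ?B"
      then obtain y and n :: nat where y: "y \<in> carrier (E 0)" "x = d 0 y" "(f [^]\<^bsub>R\<^esub> n) \<odot>\<^bsub>E 0\<^esub> y = \<zero>\<^bsub>E 0\<^esub>"
        by (auto simp: power_torsion_def)
      show "P x \<zero>\<^bsub>?L\<^esub>"
      proof (rule PI[OF y(1) M.M.zero_closed y(2)])
        show "(f [^]\<^bsub>R\<^esub> n) \<odot>\<^bsub>E 0\<^esub> y = e \<zero>\<^bsub>M\<^esub>" using y(3) e0 by simp
        show "\<zero>\<^bsub>?L\<^esub> = loc_frac M ?S \<zero>\<^bsub>M\<^esub> (f [^]\<^bsub>R\<^esub> n)"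
          unfolding S.localization_zero by (rule S.loc_frac_eqI) (use fn S.S_one in auto)
      qed
    next
      assume "P x \<zero>\<^bsub>?L\<^esub>"
      then obtain y z and n :: nat where
        1: "y \<in> carrier (E 0)" "z \<in> carrier M" "x = d 0 y" "(f [^]\<^bsub>R\<^esub> n) \<odot>\<^bsub>E 0\<^esub> y = e z"
           "\<zero>\<^bsub>?L\<^esub> = loc_frac M ?S z (f [^]\<^bsub>R\<^esub> n)"
        unfolding P_def by blast
      then obtain u where u: "u \<in> ?S" "(u \<otimes>\<^bsub>R\<^esub> f [^]\<^bsub>R\<^esub> n) \<odot>\<^bsub>M\<^esub> \<zero>\<^bsub>M\<^esub> = (u \<otimes>\<^bsub>R\<^esub> \<one>\<^bsub>R\<^esub>) \<odot>\<^bsub>M\<^esub> z"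
        using S.loc_frac_eq_iff[OF M.M.zero_closed S.S_one 1(2) fn(3)] by (auto simp: S.localization_zero)
      then obtain k :: nat where k: "u = f [^]\<^bsub>R\<^esub> k" using powS by blast
      \<comment> \<open>If \<open>z / f^n\<close> is zero, some \<open>f^k\<close> kills
        \<open>z\<close>, so \<open>f^(k+n)\<close> kills \<open>y\<close> and \<open>x\<close> is
        the boundary of a torsion element.\<close>
      have "(f [^]\<^bsub>R\<^esub> k) \<odot>\<^bsub>M\<^esub> z = \<zero>\<^bsub>M\<^esub>" using u fn(1) by (simp add: k)
      then have "(f [^]\<^bsub>R\<^esub> k) \<odot>\<^bsub>E 0\<^esub> ((f [^]\<^bsub>R\<^esub> n) \<odot>\<^bsub>E 0\<^esub> y) = \<zero>\<^bsub>E 0\<^esub>"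
        using mod_hom_smult[OF D(4) fn(1)[of k] 1(2)] 1(4) e0 by simp
      then have "(f [^]\<^bsub>R\<^esub> (k + n)) \<odot>\<^bsub>E 0\<^esub> y = \<zero>\<^bsub>E 0\<^esub>"
        using 1(1) fn(1) f(1) by (simp add: R.nat_pow_mult flip: E0.smult_assoc1)
      then have "y \<in> power_torsion R f (E 0)" using 1(1) by (auto simp: power_torsion_def)
      then show "x \<in> ?B" using 1(3) by blast
    qed
  next
    fix w
    show "w \<in> localization_away_map R f M ` carrier M \<longleftrightarrow> P \<zero>\<^bsub>(E 1)\<lparr>carrier := ?Z\<rparr>\<^esub> w"
    proof
      assume "w \<in> localization_away_map R f M ` carrier M"
      then obtain z where z: "z \<in> carrier M" "w = loc_frac M ?S z \<one>\<^bsub>R\<^esub>"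
        by (auto simp: localization_away_map_def)
      \<comment> \<open>Here \<open>y = e z\<close> and \<open>n = 0\<close>, for which
        \<open>d y\<close> is zero.\<close>
      have "P \<zero>\<^bsub>E 1\<^esub> w"
        by (rule PI[OF ec[OF z(1)] z(1), of _ 0]) (use z ec[OF z(1)] D(7)[OF z(1)] in simp_all)
      then show "P \<zero>\<^bsub>(E 1)\<lparr>carrier := ?Z\<rparr>\<^esub> w" by simp
    next
      assume "P \<zero>\<^bsub>(E 1)\<lparr>carrier := ?Z\<rparr>\<^esub> w"
      then obtain y z and n :: nat where
        1: "y \<in> carrier (E 0)" "z \<in> carrier M" "\<zero>\<^bsub>E 1\<^esub> = d 0 y" "(f [^]\<^bsub>R\<^esub> n) \<odot>\<^bsub>E 0\<^esub> y = e z"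
           "w = loc_frac M ?S z (f [^]\<^bsub>R\<^esub> n)"
        unfolding P_def by auto
      \<comment> \<open>If \<open>d y\<close> is zero, \<open>y\<close> comes from some
        \<open>m\<close> in \<open>M\<close>. Injectivity of \<open>e\<close> gives
        \<open>f^n m = z\<close>, so the fraction \<open>z / f^n\<close> is
        \<open>m / 1\<close>.\<close>
      obtain m where m: "m \<in> carrier M" "y = e m"
        using injective_resolution_exact_0[OF E 1(1)] 1(3) by metis
      have "e ((f [^]\<^bsub>R\<^esub> n) \<odot>\<^bsub>M\<^esub> m) = e z"
        using mod_hom_smult[OF D(4) fn(1) m(1)] m(2) 1(4) by simp
      then have "(f [^]\<^bsub>R\<^esub> n) \<odot>\<^bsub>M\<^esub> m = z" by (rule e_eqD) (use m(1) 1(2) fn(1) in auto)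
      then have "loc_frac M ?S z (f [^]\<^bsub>R\<^esub> n) = loc_frac M ?S m \<one>\<^bsub>R\<^esub>"
        using m(1) 1(2) fn S.S_one by (intro S.loc_frac_eqI) auto
      then show "w \<in> localization_away_map R f M ` carrier M"
        using m(1) 1(5) by (auto simp: localization_away_map_def)
    qed
  qed
  then show ?thesis
    by (simp add: cohomology_def cocycles_def coboundaries_def cokernel_def localization_away_def)
qed

text \<open>Torsion cohomology and Ext are computed from arbitrary injective resolutions with
  unrelated element types, so independence of the resolution is part of what is proved.\<close>

theorem theorem3p2:
  fixes V :: "('a, 'r) ring_scheme"
    and \<mm> :: "'a set"
    and M :: "('a, 'b) module"
  assumes "valuation_ring V"
    and "maximalideal \<mm> V"
    and "\<mm> \<noteq> {\<zero>\<^bsub>V\<^esub>}"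
    and "module V M"
  shows
    "(principalideal \<mm> V \<longrightarrow>
       (\<forall>(e :: 'b \<Rightarrow> 'c) E d. injective_resolution V M e E d \<longrightarrow>
          (\<forall>i\<ge>2. zero_module (torsion_cohomology V \<mm> E d i)) \<and>
          (\<forall>f\<in>carrier V. \<mm> = Idl\<^bsub>V\<^esub> {f} \<longrightarrow>
             mod_isomorphic V (torsion_cohomology V \<mm> E d 1)
               (cokernel M (localization_away V f M) (localization_away_map V f M)))))
     \<and>
     (\<not> principalideal \<mm> V \<longrightarrow>
       (\<forall>(e :: 'b \<Rightarrow> 'c) E d (e' :: 'b \<Rightarrow> 'd) E' d'.
          injective_resolution V M e E d \<and> injective_resolution V M e' E' d' \<longrightarrow>
          (\<forall>i. mod_isomorphic V (torsion_cohomology V \<mm> E d i)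
                 (Ext_module V (residue_module V \<mm>) E' d' i))) \<and>
       torsion V \<mm> M = {x \<in> carrier M. \<forall>a\<in>\<mm>. a \<odot>\<^bsub>M\<^esub> x = \<zero>\<^bsub>M\<^esub>} \<and>
       torsion V \<mm> M = socle V M)"
proof (rule conjI; rule impI)
  interpret V: domain V using assms(1) by (simp add: valuation_ring_def)
  interpret m: maximalideal \<mm> V by fact
  assume principal: "principalideal \<mm> V"
  show "\<forall>(e :: 'b \<Rightarrow> 'c) E d. injective_resolution V M e E d \<longrightarrow>
          (\<forall>i\<ge>2. zero_module (torsion_cohomology V \<mm> E d i)) \<and>
          (\<forall>f\<in>carrier V. \<mm> = Idl\<^bsub>V\<^esub> {f} \<longrightarrow>
             mod_isomorphic V (torsion_cohomology V \<mm> E d 1)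
               (cokernel M (localization_away V f M) (localization_away_map V f M)))"
  proof (intro allI impI)
    fix e :: "'b \<Rightarrow> 'c" and E d assume E: "injective_resolution V M e E d"
    \<comment> \<open>The torsion complex is literally the complex of \<open>f\<close>-power torsion
      elements, so the results for principal ideals transfer by rewriting.\<close>
    have coh: "torsion_cohomology V \<mm> E d
        = cohomology (\<lambda>j. (E j)\<lparr>carrier := power_torsion V f (E j)\<rparr>) d"
      if "f \<in> carrier V" "\<mm> = Idl\<^bsub>V\<^esub> {f}" for f
      using that torsion_principal[OF injective_resolutionD(3)[OF E] that(1)]
      by (simp add: fun_eq_iff torsion_cohomology_def torsion_module_def power_torsion_def)
    \<comment> \<open>This is where \<mm> being nonzero enters: division in injective modules needs
      a nonzero generator.\<close>
    have nz: "f \<noteq> \<zero>\<^bsub>V\<^esub>" if "\<mm> = Idl\<^bsub>V\<^esub> {f}" for f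
      using that assms(3) V.genideal_zero by auto
    obtain g where "g \<in> carrier V" "\<mm> = Idl\<^bsub>V\<^esub> {g}"
      using principalideal.generate[OF principal] by blast
    note vanish = power_torsion_cohomology_vanishes[OF V.domain_axioms this(1) nz[OF this(2)] E,
        folded coh[OF this]]
    have "mod_isomorphic V (torsion_cohomology V \<mm> E d 1)
        (cokernel M (localization_away V f M) (localization_away_map V f M))"
      if f: "f \<in> carrier V" "\<mm> = Idl\<^bsub>V\<^esub> {f}" for f
      using power_torsion_cohomology_1[OF V.domain_axioms f(1) nz[OF f(2)] E] by (simp only: coh[OF f])
    with vanish show "(\<forall>i\<ge>2. zero_module (torsion_cohomology V \<mm> E d i)) \<and>
          (\<forall>f\<in>carrier V. \<mm> = Idl\<^bsub>V\<^esub> {f} \<longrightarrow>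
             mod_isomorphic V (torsion_cohomology V \<mm> E d 1)
               (cokernel M (localization_away V f M) (localization_away_map V f M)))"
      by blast
  qed
next
  interpret V: domain V using assms(1) by (simp add: valuation_ring_def)
  interpret m: maximalideal \<mm> V by fact
  assume "\<not> principalideal \<mm> V"
  then have idem: "ideal_prod V \<mm> \<mm> = \<mm>"
    by (rule nonprincipal_maximal_idempotent[OF assms(1,2)])
  \<comment> \<open>Idempotence of \<mm> makes the torsion complex equal to the subcomplex killed by
    \<mm>, to which the comparison with Ext applies.\<close>
  have "mod_isomorphic V (torsion_cohomology V \<mm> E d i) (Ext_module V (residue_module V \<mm>) E' d' i)"
    if "injective_resolution V M e E d" "injective_resolution V M e' E' d'"
    for e :: "'b \<Rightarrow> 'c" and E d and e' :: "'b \<Rightarrow> 'd" and E' d' i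
    using m.annihilated_cohomology_iso_Ext[OF V.is_cring that]
    by (simp add: torsion_cohomology_def torsion_module_def annihilated_complex_def[abs_def]
        V.torsion_idempotent[OF m.is_ideal idem])
  then show "(\<forall>(e :: 'b \<Rightarrow> 'c) E d (e' :: 'b \<Rightarrow> 'd) E' d'.
          injective_resolution V M e E d \<and> injective_resolution V M e' E' d' \<longrightarrow>
          (\<forall>i. mod_isomorphic V (torsion_cohomology V \<mm> E d i)
                 (Ext_module V (residue_module V \<mm>) E' d' i))) \<and>
       torsion V \<mm> M = {x \<in> carrier M. \<forall>a\<in>\<mm>. a \<odot>\<^bsub>M\<^esub> x = \<zero>\<^bsub>M\<^esub>} \<and>
       torsion V \<mm> M = socle V M"
    using V.torsion_idempotent[OF m.is_ideal idem, of M] socle_valuation_ring[OF assms(1,2,4)]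
    by (auto simp: annihilated_def)
qed

end
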